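(* Let $X$ be a Coxeter graph of type $ADE$. Then the IC basis for $TL(X)$ with respect to the triple $(\{t_w\}_{w\in W_c},\ \bar{\ },\ \mathcal{L})$ is precisely the monomial basis $\{b_w: w\in W_c\}$. That is, $\{b_w\}_{w\in W_c}$ is the unique $\mathbb{Z}[v^{-1}]$-basis $\{c_w\}_{w\in W_c}$ of $\mathcal{L}$ such that $\overline{c_w}=c_w$ and $\pi(c_w)=\pi(v^{-\ell(w)}t_w)$ for all $w\in W_c$.
   Context: Let $\mathcal{A}=\mathbb{Z}[v,v^{-1}]$, $\mathcal{A}^-=\mathbb{Z}[v^{-1}]$, $q=v^2$, where $v$ is an indeterminate. Let $X$ be a Coxeter graph with associated Coxeter group $W=W(X)$, set of generating involutions $S(X)$, identity $e$ and length function $\ell$. The Hecke algebra $\mathcal{H}(X)$ is the $\mathcal{A}$-algebra with $\mathcal{A}$-basis $\{T_w: w\in W\}$ and multiplication determined, for $s\in S(X)$ and $w\in W$, by $T_sT_w=T_{sw}$ if $\ell(sw)>\ell(w)$, and $T_sT_w=qT_{sw}+(q-1)T_w$ if $\ell(sw)<\ell(w)$. "Type $ADE$" means that $X$ is of type $A$, of type $D$, or of type $E_n$ for some $n\ge 6$ (arbitrary rank allowed), where $E_n$ is the simply laced graph consisting of a straight line of nodes numbered $1,2,\ldots,n-1$ together with a node numbered $0$ connected only to node $3$. Let $J(X)$ be the two-sided ideal of $\mathcal{H}(X)$ generated by all elements $\sum_{w\in\langle s_i,s_j\rangle}T_w$, where $(s_i,s_j)$ runs over all pairs of elements of $S(X)$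 corresponding to adjacent nodes of $X$. The generalized Temperley--Lieb algebra is $TL(X)=\mathcal{H}(X)/J(X)$, and $t_w$ denotes the image of $T_w$ in $TL(X)$. For $s_i,s_j\in S(X)$ corresponding to adjacent nodes, let $w_{ij}$ be the longest element of $\langle s_i,s_j\rangle$. An element $w\in W$ is complex if it can be written $w=x_1w_{ij}x_2$ for some such pair, with $x_1,x_2\in W$ and $\ell(w)=\ell(x_1)+\ell(w_{ij})+\ell(x_2)$. Let $W_c=W_c(X)$ be the set of elements of $W$ that are not complex. It is known (Graham) that $\{t_w:w\in W_c\}$ is an $\mathcal{A}$-basis of $TL(X)$. The map $\bar{\ }:TL(X)\to TL(X)$ is the $\mathbb{Z}$-linear ring automorphism of order 2 which sends $v$ to $v^{-1}$ and $t_w$ to $t_{w^{-1}}^{-1}$ (the elements $t_w$ are invertible). Let $\mathcal{L}$ be the free $\mathcal{A}^-$-submodule of $TL(X)$ with basis $\{v^{-\ell(w)}t_w: w\in W_c\}$, and let $\pi:\mathcal{L}\to\mathcal{L}/v^{-1}\mathcal{L}$ be the canonical projection. An IC basis of $TL(X)$ with respect to $(\{t_w\}_{w\in W_c},\bar{\ },\mathcal{L})$ is, if it exists uniquely, the unique $\mathcal{A}^-$-basis $\{c_w\}_{w\in W_c}$ of $\mathcal{L}$ with $\overline{c_w}=c_w$ and $\pi(c_w)=\pi(v^{-\ell(w)}t_w)$ for all $w\in W_c$. For $s\in S(X)$ put $b_s=v^{-1}t_s+v^{-1}t_e$. For $w\in W_c$ with reduced expression $w=s_1s_2\cdots s_r$,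 put $b_w=b_{s_1}b_{s_2}\cdots b_{s_r}$; this does not depend on the chosen reduced expression. The set $\{b_w:w\in W_c\}$ is an $\mathcal{A}$-basis of $TL(X)$, called the monomial basis. *)

theory Defs
  imports
    "HOL-Library.Poly_Mapping"
    "HOL-Library.FuncSet"
    "HOL-Algebra.Ring"
    "HOL-Algebra.Module"
    "HOL-Algebra.QuotRing"
    "HOL-Algebra.Generated_Groups"
begin

section \<open>Coxeter graphs of type ADE\<close>

text \<open>
  Only simply laced Coxeter graphs are needed: adjacent nodes have Coxeter exponent 3, distinct
  non-adjacent nodes have exponent 2.  The relation \<open>adj\<close> is relevant on \<open>nodes\<close> only.
\<close>

record 'a coxeter_graph =
  nodes :: "'a set"
  adj :: "'a \<Rightarrow> 'a \<Rightarrow> bool"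

definition graph_iso :: "'a coxeter_graph \<Rightarrow> 'b coxeter_graph \<Rightarrow> bool" where
  "graph_iso X Y \<longleftrightarrow>
    (\<exists>f. bij_betw f (nodes X) (nodes Y) \<and>
      (\<forall>s\<in>nodes X. \<forall>t\<in>nodes X. adj X s t \<longleftrightarrow> adj Y (f s) (f t)))"

definition line_adj :: "nat \<Rightarrow> nat \<Rightarrow> bool" where
  "line_adj i j \<longleftrightarrow> 1 \<le> i \<and> 1 \<le> j \<and> (j = i + 1 \<or> i = j + 1)"

definition graph_A :: "nat \<Rightarrow> nat coxeter_graph" where
  "graph_A n = \<lparr> nodes = {1..n}, adj = line_adj \<rparr>"

text \<open>The straight line on \<open>1, \<dots>, n - 1\<close> together with a node \<open>0\<close> joined to node \<open>k\<close> only.\<close>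

definition forked_line :: "nat \<Rightarrow> nat \<Rightarrow> nat coxeter_graph" where
  "forked_line k n =
    \<lparr> nodes = {0..<n}, adj = (\<lambda>i j. line_adj i j \<or> (i = 0 \<and> j = k) \<or> (i = k \<and> j = 0)) \<rparr>"

definition graph_D :: "nat \<Rightarrow> nat coxeter_graph" where
  "graph_D n = forked_line 2 n"

definition graph_E :: "nat \<Rightarrow> nat coxeter_graph" where
  "graph_E n = forked_line 3 n"

definition type_ADE :: "'a coxeter_graph \<Rightarrow> bool" where
  "type_ADE X \<longleftrightarrow>
    (\<exists>n\<ge>1. graph_iso X (graph_A n)) \<or>
    (\<exists>n\<ge>4. graph_iso X (graph_D n)) \<or>
    (\<exists>n\<ge>6. graph_iso X (graph_E n))"


section \<open>Coxeter groups\<close>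

definition cox_exponent :: "'a coxeter_graph \<Rightarrow> 'a \<Rightarrow> 'a \<Rightarrow> nat" where
  "cox_exponent X s t = (if s = t then 1 else if adj X s t then 3 else 2)"

text \<open>
  The congruence on words in the nodes generated by \<open>(s t)\<^sup>m = 1\<close>, where \<open>m\<close> is the exponent of
  \<open>s\<close> and \<open>t\<close>.  The case \<open>s = t\<close> says that generators are involutions, so the quotient monoid is
  already the group with this presentation.
\<close>

inductive cox_eq :: "'a coxeter_graph \<Rightarrow> 'a list \<Rightarrow> 'a list \<Rightarrow> bool" for X where
  cox_refl: "x \<in> lists (nodes X) \<Longrightarrow> cox_eq X x x"
| cox_sym: "cox_eq X x y \<Longrightarrow> cox_eq X y x"
| cox_trans: "cox_eq X x y \<Longrightarrow> cox_eq X y z \<Longrightarrow> cox_eq X x z"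
| cox_rel: "x \<in> lists (nodes X) \<Longrightarrow> y \<in> lists (nodes X) \<Longrightarrow> s \<in> nodes X \<Longrightarrow> t \<in> nodes X \<Longrightarrow>
    cox_eq X (x @ concat (replicate (cox_exponent X s t) [s, t]) @ y) (x @ y)"

definition cox_class :: "'a coxeter_graph \<Rightarrow> 'a list \<Rightarrow> 'a list set" where
  "cox_class X x = {y. cox_eq X x y}"

text \<open>A group element is the set of all words in the generators that represent it.\<close>

definition cox_group :: "'a coxeter_graph \<Rightarrow> 'a list set monoid" where
  "cox_group X =
    \<lparr> carrier = cox_class X ` lists (nodes X),
      mult = (\<lambda>A B. \<Union>x\<in>A. \<Union>y\<in>B. cox_class X (x @ y)),
      one = cox_class X [] \<rparr>"

definition gen :: "'a coxeter_graph \<Rightarrow> 'a \<Rightarrow> 'a list set" where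
  "gen X s = cox_class X [s]"

definition cox_length :: "'a list set \<Rightarrow> nat" where
  "cox_length w = (LEAST n. \<exists>x\<in>w. length x = n)"

definition reduced_expr :: "'a list set \<Rightarrow> 'a list \<Rightarrow> bool" where
  "reduced_expr w x \<longleftrightarrow> x \<in> w \<and> length x = cox_length w"

definition dihedral :: "'a coxeter_graph \<Rightarrow> 'a \<Rightarrow> 'a \<Rightarrow> 'a list set set" where
  "dihedral X s t = generate (cox_group X) {gen X s, gen X t}"

definition longest :: "'a coxeter_graph \<Rightarrow> 'a \<Rightarrow> 'a \<Rightarrow> 'a list set" where
  "longest X s t = (ARG_MAX cox_length w. w \<in> dihedral X s t)"

definition complex_elt :: "'a coxeter_graph \<Rightarrow> 'a list set \<Rightarrow> bool" where
  "complex_elt X w \<longleftrightarrow>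
    (\<exists>s\<in>nodes X. \<exists>t\<in>nodes X. adj X s t \<and>
      (\<exists>x1\<in>carrier (cox_group X). \<exists>x2\<in>carrier (cox_group X).
        w = x1 \<otimes>\<^bsub>cox_group X\<^esub> longest X s t \<otimes>\<^bsub>cox_group X\<^esub> x2 \<and>
        cox_length w = cox_length x1 + cox_length (longest X s t) + cox_length x2))"

definition W_c :: "'a coxeter_graph \<Rightarrow> 'a list set set" where
  "W_c X = {w \<in> carrier (cox_group X). \<not> complex_elt X w}"


section \<open>Laurent polynomials and bases\<close>

text \<open>
  \<open>int \<Rightarrow>\<^sub>0 int\<close> with convolution product is the group ring of the integers over the integers:
  \<open>Poly_Mapping.single k c\<close> is the Laurent monomial with exponent \<open>k\<close> and coefficient \<open>c\<close>.
\<close>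

type_synonym laurent = "int \<Rightarrow>\<^sub>0 int"

definition v :: laurent where "v = Poly_Mapping.single 1 1"

definition vinv :: laurent where "vinv = Poly_Mapping.single (-1) 1"

definition q :: laurent where "q = v ^ 2"

definition laurent_ring :: "laurent ring" where
  "laurent_ring = \<lparr> carrier = UNIV, mult = (*), one = 1, zero = 0, add = (+) \<rparr>"

definition A_minus :: "laurent set" where
  "A_minus = {a. \<forall>k\<in>Poly_Mapping.keys a. k \<le> 0}"

text \<open>Finitely supported coefficient families on \<open>I\<close> with values in the subring \<open>K\<close>.\<close>

definition coeffs :: "laurent set \<Rightarrow> 'i set \<Rightarrow> ('i \<Rightarrow>\<^sub>0 laurent) set" where
  "coeffs K I = {f. Poly_Mapping.keys f \<subseteq> I \<and> (\<forall>i. Poly_Mapping.lookup f i \<in> K)}"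

definition lincomb ::
    "(laurent, 'm, 'e) module_scheme \<Rightarrow> ('i \<Rightarrow> 'm) \<Rightarrow> ('i \<Rightarrow>\<^sub>0 laurent) \<Rightarrow> 'm" where
  "lincomb M c f =
    (\<Oplus>\<^bsub>M\<^esub>i\<in>Poly_Mapping.keys f. Poly_Mapping.lookup f i \<odot>\<^bsub>M\<^esub> c i)"

definition is_basis ::
    "laurent set \<Rightarrow> (laurent, 'm, 'e) module_scheme \<Rightarrow> 'm set \<Rightarrow> 'i set \<Rightarrow> ('i \<Rightarrow> 'm) \<Rightarrow> bool" where
  "is_basis K M L I c \<longleftrightarrow>
    (\<forall>i\<in>I. c i \<in> L) \<and>
    L = lincomb M c ` coeffs K I \<and>
    (\<forall>f\<in>coeffs K I. lincomb M c f = \<zero>\<^bsub>M\<^esub> \<longrightarrow> f = 0)"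


section \<open>Hecke algebras and generalized Temperley--Lieb algebras\<close>

text \<open>
  The library's locale for algebras requires a commutative multiplication, hence the explicit
  compatibility conditions below.
\<close>

definition hecke_algebra ::
    "'a coxeter_graph \<Rightarrow> (laurent, 'h) module \<Rightarrow> ('a list set \<Rightarrow> 'h) \<Rightarrow> bool" where
  "hecke_algebra X H T \<longleftrightarrow>
    ring H \<and> module laurent_ring H \<and>
    (\<forall>a. \<forall>x\<in>carrier H. \<forall>y\<in>carrier H.
      (a \<odot>\<^bsub>H\<^esub> x) \<otimes>\<^bsub>H\<^esub> y = a \<odot>\<^bsub>H\<^esub> (x \<otimes>\<^bsub>H\<^esub> y) \<and>
      x \<otimes>\<^bsub>H\<^esub> (a \<odot>\<^bsub>H\<^esub> y) = a \<odot>\<^bsub>H\<^esub> (x \<otimes>\<^bsub>H\<^esub> y)) \<and>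
    is_basis UNIV H (carrier H) (carrier (cox_group X)) T \<and>
    (\<forall>s\<in>nodes X. \<forall>w\<in>carrier (cox_group X).
      let sw = gen X s \<otimes>\<^bsub>cox_group X\<^esub> w in
      (cox_length sw > cox_length w \<longrightarrow> T (gen X s) \<otimes>\<^bsub>H\<^esub> T w = T sw) \<and>
      (cox_length sw < cox_length w \<longrightarrow>
        T (gen X s) \<otimes>\<^bsub>H\<^esub> T w = (q \<odot>\<^bsub>H\<^esub> T sw) \<oplus>\<^bsub>H\<^esub> ((q - 1) \<odot>\<^bsub>H\<^esub> T w)))"

definition J_ideal ::
    "'a coxeter_graph \<Rightarrow> (laurent, 'h) module \<Rightarrow> ('a list set \<Rightarrow> 'h) \<Rightarrow> 'h set" where
  "J_ideal X H T =
    Idl\<^bsub>H\<^esub> {\<Oplus>\<^bsub>H\<^esub>w\<in>dihedral X s t. T w | s t. s \<in> nodes X \<and> t \<in> nodes X \<and> adj X s t}"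

text \<open>The quotient ring, with the scalar multiplication induced on cosets.\<close>

definition TL ::
    "'a coxeter_graph \<Rightarrow> (laurent, 'h) module \<Rightarrow> ('a list set \<Rightarrow> 'h) \<Rightarrow> (laurent, 'h set) module" where
  "TL X H T = ring.extend (H Quot J_ideal X H T)
    (module.fields (\<lambda>a C. \<Union>x\<in>C. J_ideal X H T +>\<^bsub>H\<^esub> (a \<odot>\<^bsub>H\<^esub> x)))"

definition tl_t ::
    "'a coxeter_graph \<Rightarrow> (laurent, 'h) module \<Rightarrow> ('a list set \<Rightarrow> 'h) \<Rightarrow> 'a list set \<Rightarrow> 'h set" where
  "tl_t X H T w = J_ideal X H T +>\<^bsub>H\<^esub> T w"

text \<open>
  Extensionality only serves to make the map unique as a HOL function.  Semilinearity follows from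
  the image of \<open>v\<close>, as the map is a ring homomorphism.
\<close>

definition tl_bar ::
    "'a coxeter_graph \<Rightarrow> (laurent, 'h) module \<Rightarrow> ('a list set \<Rightarrow> 'h) \<Rightarrow> 'h set \<Rightarrow> 'h set" where
  "tl_bar X H T = (THE f.
    f \<in> extensional (carrier (TL X H T)) \<and>
    f \<in> ring_iso (TL X H T) (TL X H T) \<and>
    (\<forall>x\<in>carrier (TL X H T). f (f x) = x) \<and>
    f (v \<odot>\<^bsub>TL X H T\<^esub> \<one>\<^bsub>TL X H T\<^esub>) = vinv \<odot>\<^bsub>TL X H T\<^esub> \<one>\<^bsub>TL X H T\<^esub> \<and>
    (\<forall>w\<in>carrier (cox_group X).
      f (tl_t X H T w) = inv\<^bsub>TL X H T\<^esub> (tl_t X H T (inv\<^bsub>cox_group X\<^esub> w))))"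

definition tl_tnorm ::
    "'a coxeter_graph \<Rightarrow> (laurent, 'h) module \<Rightarrow> ('a list set \<Rightarrow> 'h) \<Rightarrow> 'a list set \<Rightarrow> 'h set" where
  "tl_tnorm X H T w = (vinv ^ cox_length w) \<odot>\<^bsub>TL X H T\<^esub> tl_t X H T w"

definition lattice ::
    "'a coxeter_graph \<Rightarrow> (laurent, 'h) module \<Rightarrow> ('a list set \<Rightarrow> 'h) \<Rightarrow> 'h set set" where
  "lattice X H T = lincomb (TL X H T) (tl_tnorm X H T) ` coeffs A_minus (W_c X)"

definition lattice_proj ::
    "'a coxeter_graph \<Rightarrow> (laurent, 'h) module \<Rightarrow> ('a list set \<Rightarrow> 'h) \<Rightarrow> 'h set \<Rightarrow> 'h set set" where
  "lattice_proj X H T x =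
    ((\<lambda>y. vinv \<odot>\<^bsub>TL X H T\<^esub> y) ` lattice X H T) +>\<^bsub>TL X H T\<^esub> x"

definition IC_basis ::
    "'a coxeter_graph \<Rightarrow> (laurent, 'h) module \<Rightarrow> ('a list set \<Rightarrow> 'h) \<Rightarrow>
     ('a list set \<Rightarrow> 'h set) \<Rightarrow> bool" where
  "IC_basis X H T c \<longleftrightarrow>
    is_basis A_minus (TL X H T) (lattice X H T) (W_c X) c \<and>
    (\<forall>w\<in>W_c X. tl_bar X H T (c w) = c w \<and>
      lattice_proj X H T (c w) = lattice_proj X H T (tl_tnorm X H T w))"

definition tl_b ::
    "'a coxeter_graph \<Rightarrow> (laurent, 'h) module \<Rightarrow> ('a list set \<Rightarrow> 'h) \<Rightarrow> 'a \<Rightarrow> 'h set" where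
  "tl_b X H T s =
    (vinv \<odot>\<^bsub>TL X H T\<^esub> tl_t X H T (gen X s)) \<oplus>\<^bsub>TL X H T\<^esub>
    (vinv \<odot>\<^bsub>TL X H T\<^esub> tl_t X H T \<one>\<^bsub>cox_group X\<^esub>)"

definition tl_b_word ::
    "'a coxeter_graph \<Rightarrow> (laurent, 'h) module \<Rightarrow> ('a list set \<Rightarrow> 'h) \<Rightarrow> 'a list \<Rightarrow> 'h set" where
  "tl_b_word X H T x = foldr (\<lambda>s y. tl_b X H T s \<otimes>\<^bsub>TL X H T\<^esub> y) x \<one>\<^bsub>TL X H T\<^esub>"

text \<open>The common value of the products over all reduced expressions of \<open>w\<close>.\<close>

definition monomial ::
    "'a coxeter_graph \<Rightarrow> (laurent, 'h) module \<Rightarrow> ('a list set \<Rightarrow> 'h) \<Rightarrow> 'a list set \<Rightarrow> 'h set" where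
  "monomial X H T w = (THE y. \<exists>x. reduced_expr w x \<and> y = tl_b_word X H T x)"

end

theory Submission
  imports Defs "HOL-Library.Multiset"
begin

text \<open>
  Write \<open>\<delta> = v + v\<^sup>-\<^sup>1\<close>.  The generators \<open>b\<^sub>s\<close> of the Temperley--Lieb algebra satisfy
  \<open>b\<^sub>s b\<^sub>s = \<delta> b\<^sub>s\<close>, \<open>b\<^sub>s b\<^sub>t b\<^sub>s = b\<^sub>s\<close> for adjacent \<open>s, t\<close>, and \<open>b\<^sub>s b\<^sub>t = b\<^sub>t b\<^sub>s\<close> for the other
  pairs.  So the product \<open>b\<^sub>I\<close> along any word \<open>I\<close> equals \<open>\<delta>\<^sup>k b\<^sub>J\<close>, where \<open>J\<close> is a word to which no
  reduction applies and \<open>k\<close> counts the reductions \<open>ss \<rightarrow> s\<close> that were made; this number is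
  \<open>loops I\<close>, and \<open>J\<close> is \<open>nf I\<close>.  As \<open>v\<^sup>-\<^sup>1 t\<^sub>s = b\<^sub>s - v\<^sup>-\<^sup>1\<close>, multiplying out along a reduced word \<open>x\<close>
  of \<open>w\<close> gives (\<open>T_word_expansion\<close>)

    \<open>v\<^bsup>-|x|\<^esup> t\<^sub>w = \<Sum>\<^sub>I (- v\<^sup>-\<^sup>1)\<^bsup>|x|-|I|\<^esup> \<delta>\<^bsup>loops I\<^esup> b\<^bsub>nf I\<^esub>\<close>,

  the sum being over the subwords \<open>I\<close> of \<open>x\<close>.  For \<open>w\<close> in \<open>W\<^sub>c\<close>, the term \<open>I = x\<close> is the
  monomial \<open>b\<^sub>w\<close>.  The crucial
  fact is the estimate \<open>loops I < |x| - |I|\<close> for every proper subword of an irreducible word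
  (\<open>tight\<close>, proved in \<open>FC_tight\<close>): it puts all other coefficients into \<open>v\<^sup>-\<^sup>1\<int>[v\<^sup>-\<^sup>1]\<close>.  Hence the
  transition from the normalized standard basis to the monomials is unitriangular with off-diagonal
  entries in \<open>v\<^sup>-\<^sup>1\<int>[v\<^sup>-\<^sup>1]\<close> (\<open>tnorm_monomial\<close>), the two bases span the same lattice
  (\<open>lattice_eq\<close>), and they agree modulo \<open>v\<^sup>-\<^sup>1\<close> times this lattice.  Monomials are bar invariant, because
  \<open>b\<^sub>s\<close> is.  They are the only basis with these properties, since the difference of two candidates has
  bar invariant coefficients in \<open>v\<^sup>-\<^sup>1\<int>[v\<^sup>-\<^sup>1]\<close>, and these vanish (\<open>bar_invariant_small\<close>).

  The estimate is where the type of the graph enters.  Irreducible words represent exactly the elements of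
  \<open>W\<^sub>c\<close>.  Induction on the length works as soon as \<open>x\<close>, or its reversal, is equivalent to some
  \<open>s t u\<close> with \<open>s, t\<close> adjacent, or all letters of \<open>x\<close> commute.  Suppose that an irreducible word has none
  of these properties.  Glued to its mirror image along a maximal commuting prefix, it gives a
  longer irreducible word without these properties (\<open>irreducible_extension\<close>).  Repetition yields arbitrarily long
  irreducible words, whereas over the graph \<open>E\<^sub>n\<close> their length is bounded (\<open>fork_bounded\<close>), and all
  graphs of type ADE are full subgraphs of graphs \<open>E\<^sub>n\<close> (\<open>type_ADE_embedding\<close>).

  It remains to see that the monomials are linearly independent.  The reductions are
  confluent modulo commutations (\<open>confluence\<close>), so that \<open>loops\<close> and \<open>nf\<close> are well defined and the
  coefficient of a given irreducible word is a function on all words (\<open>chi\<close>).  Such functions carry an action of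
  operators \<open>u b\<^sub>s - 1\<close>, which satisfy the Hecke relations when \<open>u\<^sup>2 + 1 = u d\<close> for the loop value \<open>d\<close>.  For
  \<open>u = 1, d = 2\<close> this is an action of the Coxeter group; it shows that irreducible words are
  reduced and that two of them representing the same element differ by commutations
  (\<open>FC_shortest\<close>).  For \<open>u = v, d = \<delta>\<close>, together with
  Matsumoto's theorem, each such function becomes a functional on the Hecke algebra which vanishes on
  the ideal \<open>J\<close> (\<open>J_null\<close>) and thereby separates the monomials (\<open>comb_inj\<close>).
\<close>

section \<open>Words up to commutation\<close>

text \<open>
  The congruence of the partially commutative (trace) monoid in which the letters related by \<open>ind\<close> commute.
\<close>
inductive trace_eq :: "('b \<Rightarrow> 'b \<Rightarrow> bool) \<Rightarrow> 'b list \<Rightarrow> 'b list \<Rightarrow> bool" for ind where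
  refl: "trace_eq ind x x"
| swap: "trace_eq ind x (p @ a # b # r) \<Longrightarrow> ind a b \<Longrightarrow> trace_eq ind x (p @ b # a # r)"

lemma trace_eq_trans: "trace_eq ind y z \<Longrightarrow> trace_eq ind x y \<Longrightarrow> trace_eq ind x z"
  by (induction rule: trace_eq.induct) (auto intro: trace_eq.intros)

lemma trace_eq_swapI: "ind a b \<Longrightarrow> trace_eq ind (p @ a # b # r) (p @ b # a # r)"
  by (rule trace_eq.swap[OF trace_eq.refl])

lemma trace_eq_sym:
  assumes "\<And>a b. ind a b \<Longrightarrow> ind b a"
  shows "trace_eq ind x y \<Longrightarrow> trace_eq ind y x"
proof (induction rule: trace_eq.induct)
  case (swap x p a b r)
  have "trace_eq ind (p @ b # a # r) (p @ a # b # r)" by (rule trace_eq_swapI) (rule assms[OF swap.hyps(2)])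
  then show ?case by (rule trace_eq_trans[OF swap.IH])
qed (rule trace_eq.refl)

lemma trace_eq_context: "trace_eq ind x y \<Longrightarrow> trace_eq ind (p @ x @ r) (p @ y @ r)"
proof (induction rule: trace_eq.induct)
  case (swap x p' a b r')
  then show ?case using trace_eq.swap[of ind "p @ x @ r" "p @ p'" a b "r' @ r"] by simp
qed (rule trace_eq.refl)

lemma trace_eq_Cons: "trace_eq ind x y \<Longrightarrow> trace_eq ind (a # x) (a # y)"
  using trace_eq_context[of ind x y "[a]" "[]"] by simp

lemma trace_eq_append:
  "trace_eq ind x x' \<Longrightarrow> trace_eq ind y y' \<Longrightarrow> trace_eq ind (x @ y) (x' @ y')"
  using trace_eq_context[of ind y y' x' "[]"] trace_eq_context[of ind x x' "[]" y]
    trace_eq_trans[of ind "x' @ y" "x' @ y'" "x @ y"]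
  by simp

lemma trace_eq_mset: "trace_eq ind x y \<Longrightarrow> mset x = mset y"
  by (induction rule: trace_eq.induct) auto

lemma trace_eq_set: "trace_eq ind x y \<Longrightarrow> set x = set y"
  by (metis trace_eq_mset set_mset_mset)

lemma trace_eq_length: "trace_eq ind x y \<Longrightarrow> length x = length y"
  by (metis trace_eq_mset size_mset)

lemma trace_eq_distinct: "trace_eq ind x y \<Longrightarrow> distinct x \<longleftrightarrow> distinct y"
  by (metis trace_eq_mset mset_eq_imp_distinct_iff)

lemma trace_eq_filter: "trace_eq ind x y \<Longrightarrow> trace_eq ind (filter P x) (filter P y)"
proof (induction rule: trace_eq.induct)
  case (swap x p a b r)
  then show ?case
    using trace_eq.swap[of ind "filter P x" "filter P p" a b "filter P r"]
    by (cases "P a"; cases "P b") auto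
qed (rule trace_eq.refl)

lemma trace_eq_rev:
  assumes "\<And>a b. ind a b \<Longrightarrow> ind b a"
  shows "trace_eq ind x y \<Longrightarrow> trace_eq ind (rev x) (rev y)"
proof (induction rule: trace_eq.induct)
  case (swap x p a b r)
  then show ?case using trace_eq.swap[of ind "rev x" "rev r" b a "rev p"] assms by auto
qed (rule trace_eq.refl)

lemma trace_eq_map:
  "trace_eq (\<lambda>a b. ind (f a) (f b)) x y \<Longrightarrow> trace_eq ind (map f x) (map f y)"
proof (induction rule: trace_eq.induct)
  case (swap x p a b r)
  then show ?case using trace_eq.swap[of ind "map f x" "map f p" "f a" "f b" "map f r"] by auto
qed (rule trace_eq.refl)

text \<open>
  Lifting to tagged letters: commutation depends on the underlying letters only, so any
  rearrangement of a word rearranges its tagged version in the same way.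
\<close>
lemma trace_eq_lift:
  "trace_eq ind (map f u) y \<Longrightarrow> \<exists>w. y = map f w \<and> trace_eq (\<lambda>a b. ind (f a) (f b)) u w"
proof (induction "map f u" y rule: trace_eq.induct)
  case refl
  then show ?case using trace_eq.refl by blast
next
  case (swap p a b r)
  then obtain w where w: "p @ a # b # r = map f w" "trace_eq (\<lambda>a b. ind (f a) (f b)) u w" by auto
  then obtain p' a' b' r' where "w = p' @ [a', b'] @ r'" "map f p' = p" "f a' = a" "f b' = b"
    "map f r' = r"
    by (auto simp: append_eq_map_conv Cons_eq_map_conv)
  then show ?case
    using w trace_eq.swap[of "(\<lambda>a b. ind (f a) (f b))" u p' a' b' r'] swap.hyps
    by (intro exI[of _ "p' @ [b', a'] @ r'"]) auto
qed

lemma trace_eq_move_back: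
  "(\<And>z. z \<in> set m \<Longrightarrow> ind s z) \<Longrightarrow> trace_eq ind (p @ [s] @ m @ r) (p @ m @ [s] @ r)"
proof (induction m arbitrary: p)
  case (Cons a m)
  have "trace_eq ind (p @ s # a # m @ r) (p @ a # s # m @ r)"
    by (rule trace_eq_swapI) (simp add: Cons.prems)
  moreover have "trace_eq ind ((p @ [a]) @ [s] @ m @ r) ((p @ [a]) @ m @ [s] @ r)"
    by (rule Cons.IH) (simp add: Cons.prems)
  ultimately show ?case using trace_eq_trans[of ind "p @ a # s # m @ r"] by simp
qed (simp add: trace_eq.refl)

text \<open>
  The order of two letters that do not commute is an invariant of the trace of a word without
  repetitions (\<open>trace_eq_precedes\<close>).
\<close>
definition precedes :: "'b list \<Rightarrow> 'b \<Rightarrow> 'b \<Rightarrow> bool" where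
  "precedes u a b \<longleftrightarrow> filter (\<lambda>z. z = a \<or> z = b) u = [a, b]"

lemma trace_eq_precedes:
  assumes "trace_eq ind u w" "\<not> ind a b" "\<not> ind b a"
  shows "precedes u a b \<longleftrightarrow> precedes w a b"
proof -
  from assms have "filter (\<lambda>z. z = a \<or> z = b) u = filter (\<lambda>z. z = a \<or> z = b) w"
    by (induction rule: trace_eq.induct) auto
  then show ?thesis by (simp add: precedes_def)
qed

lemma precedes_append:
  assumes "distinct (p @ r)" "a \<in> set p" "b \<in> set r"
  shows "precedes (p @ r) a b"
proof -
  have "distinct xs \<Longrightarrow> z \<in> set xs \<Longrightarrow> w \<notin> set xs \<Longrightarrow> filter (\<lambda>y. y = z \<or> y = w) xs = [z]" for xs and z w :: 'b
    by (induction xs) (auto simp: filter_empty_conv)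
  from this[of p a b] this[of r b a] have "filter (\<lambda>y. y = a \<or> y = b) p = [a]"
    "filter (\<lambda>y. y = b \<or> y = a) r = [b]" using assms by auto
  moreover have "(\<lambda>y. y = b \<or> y = a) = (\<lambda>y. y = a \<or> y = b)" by auto
  ultimately show ?thesis by (simp add: precedes_def)
qed

lemma precedes_asym: "precedes u a b \<Longrightarrow> a \<noteq> b \<Longrightarrow> \<not> precedes u b a"
  by (simp add: precedes_def disj_commute)

lemma precedes_mem: "precedes u a b \<Longrightarrow> a \<in> set u \<and> b \<in> set u"
  unfolding precedes_def by (metis filter_is_subset insert_subset list.simps(15))

section \<open>Reduction of words\<close>

locale simple_graph =
  fixes E :: "'a \<Rightarrow> 'a \<Rightarrow> bool"
  assumes E_sym: "E s t \<Longrightarrow> E t s" and E_irrefl: "\<not> E s s"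
begin

definition ind :: "'a \<Rightarrow> 'a \<Rightarrow> bool" where "ind s t \<longleftrightarrow> s \<noteq> t \<and> \<not> E s t"

lemma ind_sym: "ind s t \<Longrightarrow> ind t s" using E_sym by (auto simp: ind_def)

abbreviation teq :: "'a list \<Rightarrow> 'a list \<Rightarrow> bool" (infix "\<approx>" 50) where "x \<approx> y \<equiv> trace_eq ind x y"

lemma teq_sym: "x \<approx> y \<Longrightarrow> y \<approx> x"
  by (rule trace_eq_sym) (auto dest: ind_sym)

text \<open>
  The relations \<open>b\<^sub>s b\<^sub>s = \<delta> b\<^sub>s\<close> and \<open>b\<^sub>s b\<^sub>t b\<^sub>s = b\<^sub>s\<close>, read as reductions.  The number records the
  exponent of \<open>\<delta>\<close>, that is, the closed loops that split off in the diagrammatic picture.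
\<close>
inductive rstep :: "nat \<Rightarrow> 'a list \<Rightarrow> 'a list \<Rightarrow> bool" where
  loop: "rstep 1 (p @ [s, s] @ r) (p @ [s] @ r)"
| zigzag: "E s t \<Longrightarrow> rstep 0 (p @ [s, t, s] @ r) (p @ [s] @ r)"

definition tstep :: "nat \<Rightarrow> 'a list \<Rightarrow> 'a list \<Rightarrow> bool" where
  "tstep c x y \<longleftrightarrow> (\<exists>x' y'. x \<approx> x' \<and> rstep c x' y' \<and> y' \<approx> y)"

lemma tstep_teq: "tstep c x y \<Longrightarrow> x' \<approx> x \<Longrightarrow> y \<approx> y' \<Longrightarrow> tstep c x' y'"
  unfolding tstep_def by (meson trace_eq_trans)

lemma rstep_tstep: "rstep c x y \<Longrightarrow> tstep c x y"
  unfolding tstep_def using trace_eq.refl by blast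

lemma tstep_length: "tstep c x y \<Longrightarrow> length y < length x"
  unfolding tstep_def by (auto elim!: rstep.cases dest!: trace_eq_length)

lemma tstep_context: "tstep c x y \<Longrightarrow> tstep c (p @ x @ r) (p @ y @ r)"
  unfolding tstep_def
proof (elim exE conjE)
  fix x' y' assume *: "x \<approx> x'" "rstep c x' y'" "y' \<approx> y"
  have "rstep c (p @ x' @ r) (p @ y' @ r)" using *(2)
  proof cases
    case (loop p' s r')
    then show ?thesis using rstep.loop[of "p @ p'" s "r' @ r"] by simp
  next
    case (zigzag s t p' r')
    then show ?thesis using rstep.zigzag[of s t "p @ p'" "r' @ r"] by simp
  qed
  then show "\<exists>x' y'. p @ x @ r \<approx> x' \<and> rstep c x' y' \<and> y' \<approx> p @ y @ r"
    using * by (blast intro: trace_eq_context)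
qed

section \<open>Local confluence\<close>

text \<open>
  The letters of a word are tagged by their positions and hence become distinct.  A reduction then is
  the deletion of a set of letters, and two deletions commute without further ado.  What remains is to see
  which letters two reductions of the same word can share.
\<close>
abbreviation tteq :: "('a \<times> nat) list \<Rightarrow> ('a \<times> nat) list \<Rightarrow> bool" (infix "\<approx>\<^sub>t" 50) where
  "u \<approx>\<^sub>t w \<equiv> trace_eq (\<lambda>\<alpha> \<beta>. ind (fst \<alpha>) (fst \<beta>)) u w"

lemma tteq_sym: "u \<approx>\<^sub>t w \<Longrightarrow> w \<approx>\<^sub>t u"
  by (rule trace_eq_sym) (auto dest: ind_sym)

lemma teq_trans [trans]: "x \<approx> y \<Longrightarrow> y \<approx> z \<Longrightarrow> x \<approx> z"
  by (rule trace_eq_trans)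

lemma tteq_map_fst: "u \<approx>\<^sub>t w \<Longrightarrow> map fst u \<approx> map fst w"
  by (rule trace_eq_map)

text \<open>
  \<open>\<alpha>\<close> and \<open>\<beta>\<close> carry the same letter and can be moved next to each other, up to at most one letter
  between them, collected in \<open>\<tau>\<close>, which is adjacent to theirs in the graph.  The reduction deletes
  \<open>\<tau>\<close> and one of \<open>\<alpha>\<close>, \<open>\<beta>\<close>.
\<close>
definition redex :: "('a \<times> nat) list \<Rightarrow> 'a \<times> nat \<Rightarrow> ('a \<times> nat) list \<Rightarrow> 'a \<times> nat \<Rightarrow> bool" where
  "redex u \<alpha> \<tau> \<beta> \<longleftrightarrow> (\<exists>p r. u \<approx>\<^sub>t p @ [\<alpha>] @ \<tau> @ [\<beta>] @ r) \<and> fst \<alpha> = fst \<beta> \<and>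
     length \<tau> \<le> 1 \<and> (\<forall>t\<in>set \<tau>. E (fst \<alpha>) (fst t))"

abbreviation delete :: "('a \<times> nat) set \<Rightarrow> ('a \<times> nat) list \<Rightarrow> ('a \<times> nat) list" where
  "delete D u \<equiv> filter (\<lambda>z. z \<notin> D) u"

lemma redex_delete:
  assumes "redex u \<alpha> \<tau> \<beta>" "\<alpha> \<notin> D" "\<beta> \<notin> D"
  shows "redex (delete D u) \<alpha> (delete D \<tau>) \<beta>"
proof -
  obtain p r where "u \<approx>\<^sub>t p @ [\<alpha>] @ \<tau> @ [\<beta>] @ r" using assms(1) unfolding redex_def by blast
  from trace_eq_filter[OF this, of "\<lambda>z. z \<notin> D"]
  have "delete D u \<approx>\<^sub>t delete D p @ [\<alpha>] @ delete D \<tau> @ [\<beta>] @ delete D r"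
    using assms(2,3) by simp
  moreover have "length (delete D \<tau>) \<le> 1"
    using assms(1) length_filter_le[of "\<lambda>z. z \<notin> D" \<tau>] unfolding redex_def by linarith
  ultimately show ?thesis using assms(1) unfolding redex_def by auto
qed

lemma delete_middle:
  assumes "distinct (p @ [\<alpha>] @ \<tau> @ [\<beta>] @ r)"
  shows "delete (insert \<beta> (set \<tau>)) (p @ [\<alpha>] @ \<tau> @ [\<beta>] @ r) = p @ [\<alpha>] @ r"
    and "delete (insert \<alpha> (set \<tau>)) (p @ [\<alpha>] @ \<tau> @ [\<beta>] @ r) = p @ [\<beta>] @ r"
proof -
  have "delete (insert e (set \<tau>)) p = p" "delete (insert e (set \<tau>)) r = r" if "e \<in> {\<alpha>, \<beta>}" for e
    using assms that by (intro filter_True, force)+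
  moreover have "delete (insert e (set \<tau>)) \<tau> = []" for e by (simp add: filter_empty_conv)
  ultimately show "delete (insert \<beta> (set \<tau>)) (p @ [\<alpha>] @ \<tau> @ [\<beta>] @ r) = p @ [\<alpha>] @ r"
    "delete (insert \<alpha> (set \<tau>)) (p @ [\<alpha>] @ \<tau> @ [\<beta>] @ r) = p @ [\<beta>] @ r"
    using assms by auto
qed

text \<open>
  It does not matter which of the two equal letters is deleted: the results differ in tags only.
  This freedom is used below to avoid conflicts between two redexes.
\<close>
lemma redex_reduct:
  assumes u: "distinct u" and r: "redex u \<alpha> \<tau> \<beta>"
  shows "tstep (1 - length \<tau>) (map fst u) (map fst (delete (insert \<beta> (set \<tau>)) u))"
    and "map fst (delete (insert \<beta> (set \<tau>)) u) \<approx> map fst (delete (insert \<alpha> (set \<tau>)) u)"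
proof -
  obtain p r where pq: "u \<approx>\<^sub>t p @ [\<alpha>] @ \<tau> @ [\<beta>] @ r" using r unfolding redex_def by blast
  have d: "distinct (p @ [\<alpha>] @ \<tau> @ [\<beta>] @ r)" using pq u trace_eq_distinct by blast
  have "delete (insert \<beta> (set \<tau>)) (p @ [\<alpha>] @ \<tau> @ [\<beta>] @ r) = p @ [\<alpha>] @ r"
    by (rule delete_middle[OF d])
  then have 1: "delete (insert \<beta> (set \<tau>)) u \<approx>\<^sub>t p @ [\<alpha>] @ r"
    using trace_eq_filter[OF pq] by metis
  have "delete (insert \<alpha> (set \<tau>)) (p @ [\<alpha>] @ \<tau> @ [\<beta>] @ r) = p @ [\<beta>] @ r"
    by (rule delete_middle[OF d])
  then have 2: "delete (insert \<alpha> (set \<tau>)) u \<approx>\<^sub>t p @ [\<beta>] @ r"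
    using trace_eq_filter[OF pq] by metis
  have "map fst (p @ [\<alpha>] @ r) = map fst (p @ [\<beta>] @ r)" using r by (simp add: redex_def)
  then show "map fst (delete (insert \<beta> (set \<tau>)) u) \<approx> map fst (delete (insert \<alpha> (set \<tau>)) u)"
    using teq_trans[OF tteq_map_fst[OF 1]] tteq_map_fst[OF tteq_sym[OF 2]] by simp
  have "rstep (1 - length \<tau>) (map fst (p @ [\<alpha>] @ \<tau> @ [\<beta>] @ r)) (map fst (p @ [\<alpha>] @ r))"
  proof (cases \<tau>)
    case Nil
    then show ?thesis using r rstep.loop[of "map fst p" "fst \<alpha>" "map fst r"] by (simp add: redex_def)
  next
    case (Cons t \<tau>')
    then show ?thesis
      using r rstep.zigzag[of "fst \<alpha>" "fst t" "map fst p" "map fst r"] by (auto simp: redex_def)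
  qed
  then show "tstep (1 - length \<tau>) (map fst u) (map fst (delete (insert \<beta> (set \<tau>)) u))"
    unfolding tstep_def using tteq_map_fst[OF pq] tteq_map_fst[OF tteq_sym[OF 1]] by blast
qed

lemma redex_reduct':
  assumes "distinct u" "redex u \<alpha> \<tau> \<beta>" "e \<in> {\<alpha>, \<beta>}"
  shows "tstep (1 - length \<tau>) (map fst u) (map fst (delete (insert e (set \<tau>)) u))"
  using assms redex_reduct tstep_teq[OF _ trace_eq.refl] by blast

lemma tstep_redex:
  assumes "tstep c (map fst u) y" "distinct u"
  obtains \<alpha> \<tau> \<beta> where "redex u \<alpha> \<tau> \<beta>" "c = 1 - length \<tau>"
    "\<And>e. e \<in> {\<alpha>, \<beta>} \<Longrightarrow> map fst (delete (insert e (set \<tau>)) u) \<approx> y"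
proof -
  obtain x' y' where x': "map fst u \<approx> x'" "rstep c x' y'" "y' \<approx> y"
    using assms(1) unfolding tstep_def by blast
  obtain w where w: "x' = map fst w" "u \<approx>\<^sub>t w" using trace_eq_lift[OF x'(1)] by blast
  have d: "distinct w" using w assms(2) trace_eq_distinct by blast
  have "\<exists>p \<alpha> \<tau> \<beta> r. w = p @ [\<alpha>] @ \<tau> @ [\<beta>] @ r \<and> y' = map fst (p @ [\<alpha>] @ r) \<and> fst \<alpha> = fst \<beta> \<and>
      length \<tau> \<le> 1 \<and> (\<forall>t\<in>set \<tau>. E (fst \<alpha>) (fst t)) \<and> c = 1 - length \<tau>"
    using x'(2)
  proof cases
    case (loop p s r)
    then obtain p' \<alpha> \<beta> r' where "w = p' @ [\<alpha>, \<beta>] @ r'" "map fst p' = p" "fst \<alpha> = s" "fst \<beta> = s"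
      "map fst r' = r"
      using w(1) by (auto simp: map_eq_append_conv map_eq_Cons_conv)
    then show ?thesis using loop
      by (intro exI[of _ p'] exI[of _ \<alpha>] exI[of _ "[]"] exI[of _ \<beta>] exI[of _ r']) auto
  next
    case (zigzag s t p r)
    then obtain p' \<alpha> \<tau> \<beta> r' where "w = p' @ [\<alpha>, \<tau>, \<beta>] @ r'" "map fst p' = p" "fst \<alpha> = s" "fst \<tau> = t"
      "fst \<beta> = s" "map fst r' = r"
      using w(1) by (auto simp: map_eq_append_conv map_eq_Cons_conv)
    then show ?thesis using zigzag
      by (intro exI[of _ p'] exI[of _ \<alpha>] exI[of _ "[\<tau>]"] exI[of _ \<beta>] exI[of _ r']) auto
  qed
  then obtain p \<alpha> \<tau> \<beta> r where *: "w = p @ [\<alpha>] @ \<tau> @ [\<beta>] @ r" "y' = map fst (p @ [\<alpha>] @ r)"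
    "fst \<alpha> = fst \<beta>" "length \<tau> \<le> 1" "\<forall>t\<in>set \<tau>. E (fst \<alpha>) (fst t)" "c = 1 - length \<tau>" by blast
  have r: "redex u \<alpha> \<tau> \<beta>" using w * unfolding redex_def by blast
  have "delete (insert \<beta> (set \<tau>)) w = p @ [\<alpha>] @ r"
    using delete_middle(1)[of p \<alpha> \<tau> \<beta> r] d * by simp
  then have "map fst (delete (insert \<beta> (set \<tau>)) u) \<approx> y'"
    using tteq_map_fst[OF trace_eq_filter[OF w(2)]] * by metis
  then have "map fst (delete (insert \<beta> (set \<tau>)) u) \<approx> y" using x'(3) trace_eq_trans by blast
  moreover from this have "map fst (delete (insert \<alpha> (set \<tau>)) u) \<approx> y"
    using redex_reduct(2)[OF assms(2) r] by (meson teq_sym trace_eq_trans)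
  ultimately show ?thesis using that[OF r *(6)] by blast
qed

text \<open>
  The last clause makes a redex rigid: every letter between \<open>\<alpha>\<close> and \<open>\<beta>\<close> that does not
  commute with them belongs to \<open>\<tau>\<close>.
\<close>
lemma redex_order:
  assumes u: "distinct u" and r: "redex u \<alpha> \<tau> \<beta>"
  shows "\<alpha> \<noteq> \<beta>" "\<alpha> \<notin> set \<tau>" "\<beta> \<notin> set \<tau>" "distinct \<tau>"
    "precedes u \<alpha> \<beta>" "\<And>t. t \<in> set \<tau> \<Longrightarrow> precedes u \<alpha> t" "\<And>t. t \<in> set \<tau> \<Longrightarrow> precedes u t \<beta>"
    and "\<And>z. precedes u \<alpha> z \<Longrightarrow> precedes u z \<beta> \<Longrightarrow> \<not> ind (fst \<alpha>) (fst z) \<Longrightarrow> z \<noteq> \<alpha> \<Longrightarrow> z \<noteq> \<beta> \<Longrightarrow> z \<in> set \<tau>"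
proof -
  obtain p r where pq: "u \<approx>\<^sub>t p @ [\<alpha>] @ \<tau> @ [\<beta>] @ r" using r unfolding redex_def by blast
  let ?w = "p @ [\<alpha>] @ \<tau> @ [\<beta>] @ r"
  have d: "distinct ?w" using pq u trace_eq_distinct by blast
  have l: "fst \<alpha> = fst \<beta>" and t: "\<And>t. t \<in> set \<tau> \<Longrightarrow> E (fst \<alpha>) (fst t)" using r unfolding redex_def by auto
  have nind: "\<not> ind (fst a) (fst b) \<Longrightarrow> precedes u a b \<longleftrightarrow> precedes ?w a b" for a b
    by (rule trace_eq_precedes[OF pq]) (auto dest: ind_sym)
  show "\<alpha> \<noteq> \<beta>" "\<alpha> \<notin> set \<tau>" "\<beta> \<notin> set \<tau>" "distinct \<tau>" using d by auto
  show "precedes u \<alpha> \<beta>"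
    using precedes_append[of "p @ [\<alpha>]" "\<tau> @ [\<beta>] @ r" \<alpha> \<beta>] d nind[of \<alpha> \<beta>] l by (simp add: ind_def)
  show "precedes u \<alpha> z" if "z \<in> set \<tau>" for z
    using precedes_append[of "p @ [\<alpha>]" "\<tau> @ [\<beta>] @ r" \<alpha> z] d nind[of \<alpha> z] t[OF that] that by (simp add: ind_def)
  show "precedes u z \<beta>" if "z \<in> set \<tau>" for z
    using precedes_append[of "p @ [\<alpha>] @ \<tau>" "[\<beta>] @ r" z \<beta>] d nind[of z \<beta>] E_sym[OF t[OF that]] that l
    by (simp add: ind_def)
  show "z \<in> set \<tau>" if z: "precedes u \<alpha> z" "precedes u z \<beta>" "\<not> ind (fst \<alpha>) (fst z)" "z \<noteq> \<alpha>" "z \<noteq> \<beta>" for z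
  proof -
    have w: "precedes ?w \<alpha> z" "precedes ?w z \<beta>" using nind[of \<alpha> z] nind[of z \<beta>] z l ind_sym by auto
    have "z \<notin> set p" using precedes_append[of p "[\<alpha>] @ \<tau> @ [\<beta>] @ r" z \<alpha>] d w(1) z(4) precedes_asym by fastforce
    moreover have "z \<notin> set r"
      using precedes_append[of "p @ [\<alpha>] @ \<tau> @ [\<beta>]" r \<beta> z] d w(2) z(5) precedes_asym by fastforce
    ultimately show ?thesis using precedes_mem[OF w(1)] z by auto
  qed
qed

lemma precedes_trans_lab: "precedes u a b \<Longrightarrow> precedes u b c \<Longrightarrow> distinct u \<Longrightarrow> a \<noteq> b \<Longrightarrow> b \<noteq> c \<Longrightarrow> precedes u a c"
proof -
  assume a: "precedes u a b" "precedes u b c" "distinct u" "a \<noteq> b" "b \<noteq> c"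
  obtain p r where u: "u = p @ b # r" using precedes_mem[OF a(1)] by (meson split_list)
  have "a \<in> set p" using precedes_append[of "p @ [b]" r b a] precedes_mem[OF a(1)] precedes_asym[OF a(1)] a u by auto
  moreover have "c \<in> set r" using precedes_append[of p "b # r" c b] precedes_mem[OF a(2)] precedes_asym[OF a(2)] a u by auto
  ultimately show ?thesis using precedes_append[of p "b # r" a c] u a by auto
qed

lemma precedes_total: "distinct u \<Longrightarrow> a \<in> set u \<Longrightarrow> b \<in> set u \<Longrightarrow> a \<noteq> b \<Longrightarrow> precedes u a b \<or> precedes u b a"
proof -
  assume a: "distinct u" "a \<in> set u" "b \<in> set u" "a \<noteq> b"
  obtain p r where u: "u = p @ b # r" using a(3) by (meson split_list)
  show ?thesis
    using precedes_append[of "p @ [b]" r b a] precedes_append[of p "b # r" a b] a u by auto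
qed

lemma redex_same_first:
  assumes u: "distinct u" and r: "redex u \<alpha> \<tau> \<beta>" and r': "redex u \<alpha> \<tau>' \<beta>'"
  shows "\<beta> = \<beta>' \<and> \<tau> = \<tau>'"
proof -
  note o = redex_order[OF u r] and o' = redex_order[OF u r']
  have l: "fst \<alpha> = fst \<beta>" "fst \<alpha> = fst \<beta>'" using r r' by (auto simp: redex_def)
  have t: "\<And>t. t \<in> set \<tau> \<Longrightarrow> E (fst \<alpha>) (fst t)" "\<And>t. t \<in> set \<tau>' \<Longrightarrow> E (fst \<alpha>) (fst t)"
    using r r' by (auto simp: redex_def)
  have b: "\<beta> = \<beta>'"
  proof (rule ccontr)
    assume n: "\<beta> \<noteq> \<beta>'"
    have "\<beta> \<in> set \<tau>' \<or> \<beta>' \<in> set \<tau>"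
      using precedes_total[OF u _ _ n] o(5)[THEN precedes_mem] o'(5)[THEN precedes_mem]
        o(8)[of \<beta>'] o'(8)[of \<beta>] o(1,5) o'(1,5) n l by (auto simp: ind_def)
    then show False using t l E_irrefl by metis
  qed
  have "z \<in> set \<tau>'" if "z \<in> set \<tau>" for z
    using o(6)[OF that] o(7)[OF that] o'(8)[of z] b t(1)[OF that] that o(2,3) by (auto simp: ind_def)
  moreover have "z \<in> set \<tau>" if "z \<in> set \<tau>'" for z
    using o'(6)[OF that] o'(7)[OF that] o(8)[of z] b t(2)[OF that] that o'(2,3) by (auto simp: ind_def)
  ultimately have "set \<tau> = set \<tau>'" by blast
  moreover have "length \<tau> \<le> 1" "length \<tau>' \<le> 1" using r r' by (auto simp: redex_def)
  ultimately have "\<tau> = \<tau>'" by (cases \<tau>; cases \<tau>') auto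
  with b show ?thesis by simp
qed

lemma redex_same_last:
  assumes u: "distinct u" and r: "redex u \<alpha> \<tau> \<beta>" and r': "redex u \<alpha>' \<tau>' \<beta>"
  shows "\<alpha> = \<alpha>'"
proof (rule ccontr)
  assume n: "\<alpha> \<noteq> \<alpha>'"
  note o = redex_order[OF u r] and o' = redex_order[OF u r']
  have l: "fst \<alpha> = fst \<beta>" "fst \<alpha>' = fst \<beta>" using r r' by (auto simp: redex_def)
  have t: "\<And>t. t \<in> set \<tau> \<Longrightarrow> E (fst \<alpha>) (fst t)" "\<And>t. t \<in> set \<tau>' \<Longrightarrow> E (fst \<alpha>') (fst t)"
    using r r' by (auto simp: redex_def)
  have "\<alpha> \<in> set \<tau>' \<or> \<alpha>' \<in> set \<tau>"
    using precedes_total[OF u _ _ n] o(5)[THEN precedes_mem] o'(5)[THEN precedes_mem]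
      o(8)[of \<alpha>'] o'(8)[of \<alpha>] o(1,5) o'(1,5) n l by (auto simp: ind_def)
  then show False using t l E_irrefl by metis
qed

text \<open>
  If a redex starts at the middle letter of another one, the two form an alternating word \<open>s t s t\<close>.
  Both reductions then leave \<open>s t\<close>.
\<close>
lemma redex_overlap_right:
  assumes u: "distinct u" and r: "redex u \<alpha> \<tau> \<beta>" and t: "t \<in> set \<tau>" and r': "redex u t \<tau>' \<beta>'"
  shows "\<tau> = [t] \<and> \<tau>' = [\<beta>]"
proof -
  note o = redex_order[OF u r] and o' = redex_order[OF u r']
  have l: "fst \<alpha> = fst \<beta>" "fst t = fst \<beta>'" "E (fst \<alpha>) (fst t)" using r r' t by (auto simp: redex_def)
  have n: "\<beta> \<noteq> \<beta>'" "\<alpha> \<noteq> \<beta>'" using l E_irrefl by metis+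
  have "\<not> precedes u \<beta>' \<beta>"
  proof
    assume b: "precedes u \<beta>' \<beta>"
    have "precedes u \<alpha> \<beta>'" using precedes_trans_lab[OF o(6)[OF t] o'(5) u] o o'(1) t by metis
    from o(8)[OF this b] l n have "\<beta>' \<in> set \<tau>" by (auto simp: ind_def)
    moreover have "length \<tau> \<le> 1" using r by (auto simp: redex_def)
    ultimately show False using t o'(1) by (cases \<tau>) auto
  qed
  then have "precedes u \<beta> \<beta>'" using precedes_total[OF u _ _ n(1)] precedes_mem[OF o(5)] precedes_mem[OF o'(5)] by blast
  from o'(8)[OF o(7)[OF t] this] have "\<beta> \<in> set \<tau>'" using l n o(3) t E_sym by (auto simp: ind_def)
  moreover have "length \<tau> \<le> 1" "length \<tau>' \<le> 1" using r r' by (auto simp: redex_def)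
  ultimately show ?thesis using t by (cases \<tau>; cases \<tau>') auto
qed

lemma redex_overlap_left:
  assumes u: "distinct u" and r: "redex u \<alpha> \<tau> \<beta>" and t: "t \<in> set \<tau>" and r': "redex u \<alpha>' \<tau>' t"
  shows "\<tau> = [t] \<and> \<tau>' = [\<alpha>]"
proof -
  note o = redex_order[OF u r] and o' = redex_order[OF u r']
  have l: "fst \<alpha> = fst \<beta>" "fst t = fst \<alpha>'" "E (fst \<alpha>) (fst t)" using r r' t by (auto simp: redex_def)
  have n: "\<alpha> \<noteq> \<alpha>'" "\<beta> \<noteq> \<alpha>'" using l E_irrefl by metis+
  have "\<not> precedes u \<alpha> \<alpha>'"
  proof
    assume b: "precedes u \<alpha> \<alpha>'"
    have "precedes u \<alpha>' \<beta>" using precedes_trans_lab[OF o'(5) o(7)[OF t] u] o o'(1) t by metis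
    from o(8)[OF b this] l n have "\<alpha>' \<in> set \<tau>" by (auto simp: ind_def)
    moreover have "length \<tau> \<le> 1" using r by (auto simp: redex_def)
    ultimately show False using t o'(1) by (cases \<tau>) auto
  qed
  then have "precedes u \<alpha>' \<alpha>" using precedes_total[OF u _ _ n(1)] precedes_mem[OF o(5)] precedes_mem[OF o'(5)] by blast
  from o'(8)[OF this o(6)[OF t]] have "\<alpha> \<in> set \<tau>'" using l n o(2) t E_sym by (auto simp: ind_def)
  moreover have "length \<tau> \<le> 1" "length \<tau>' \<le> 1" using r r' by (auto simp: redex_def)
  ultimately show ?thesis using t by (cases \<tau>; cases \<tau>') auto
qed

text \<open>
  Besides the words, the exponents of \<open>\<delta>\<close> along the two branches have to agree.
\<close>
definition joinable :: "nat \<Rightarrow> 'a list \<Rightarrow> nat \<Rightarrow> 'a list \<Rightarrow> bool" where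
  "joinable c y d z \<longleftrightarrow> (c = d \<and> y \<approx> z) \<or>
     (\<exists>c' d' w. tstep c' y w \<and> tstep d' z w \<and> c + c' = d + d')"

lemma joinable_teq:
  assumes "joinable c y d z" "y \<approx> y'" "z \<approx> z'"
  shows "joinable c y' d z'"
  using assms(1) unfolding joinable_def
proof (elim disjE exE conjE)
  assume "c = d" "y \<approx> z"
  moreover have "y' \<approx> z'" by (rule teq_trans[OF teq_sym[OF assms(2)] teq_trans[OF \<open>y \<approx> z\<close> assms(3)]])
  ultimately show "c = d \<and> y' \<approx> z' \<or> (\<exists>c' d' w. tstep c' y' w \<and> tstep d' z' w \<and> c + c' = d + d')" by blast
next
  fix c' d' w assume "tstep c' y w" "tstep d' z w" "c + c' = d + d'"
  then show "c = d \<and> y' \<approx> z' \<or> (\<exists>c' d' w. tstep c' y' w \<and> tstep d' z' w \<and> c + c' = d + d')"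
    using tstep_teq[OF _ teq_sym[OF assms(2)] trace_eq.refl] tstep_teq[OF _ teq_sym[OF assms(3)] trace_eq.refl]
    by blast
qed

text \<open>
  If neither reduction touches the outer letters of the other redex, both redexes survive, and the
  two deletions can be made in either order.  A middle letter may be deleted by both; then a
  zigzag turns into a loop, on both branches alike.
\<close>
lemma redex_join_commuting:
  assumes u: "distinct u" and r: "redex u \<alpha> \<tau> \<beta>" and r': "redex u \<alpha>' \<tau>' \<beta>'"
    and e: "e \<in> {\<alpha>, \<beta>}" "e' \<in> {\<alpha>', \<beta>'}"
    and disj: "{\<alpha>, \<beta>} \<inter> insert e' (set \<tau>') = {}" "{\<alpha>', \<beta>'} \<inter> insert e (set \<tau>) = {}"
  shows "joinable (1 - length \<tau>) (map fst (delete (insert e (set \<tau>)) u))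
    (1 - length \<tau>') (map fst (delete (insert e' (set \<tau>')) u))"
proof -
  let ?D = "insert e (set \<tau>)" and ?D' = "insert e' (set \<tau>')"
  have r1: "redex (delete ?D u) \<alpha>' (delete ?D \<tau>') \<beta>'" by (rule redex_delete[OF r']) (use disj in auto)
  have r2: "redex (delete ?D' u) \<alpha> (delete ?D' \<tau>) \<beta>" by (rule redex_delete[OF r]) (use disj in auto)
  have s1: "tstep (1 - length (delete ?D \<tau>')) (map fst (delete ?D u))
      (map fst (delete (insert e' (set (delete ?D \<tau>'))) (delete ?D u)))"
    by (rule redex_reduct'[OF _ r1 e(2)]) (use u in simp)
  have s2: "tstep (1 - length (delete ?D' \<tau>)) (map fst (delete ?D' u))
      (map fst (delete (insert e (set (delete ?D' \<tau>))) (delete ?D' u)))"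
    by (rule redex_reduct'[OF _ r2 e(1)]) (use u in simp)
  have "delete (insert e' (set (delete ?D \<tau>'))) (delete ?D u) =
      delete (insert e (set (delete ?D' \<tau>))) (delete ?D' u)"
    by (auto simp: filter_filter intro!: filter_cong)
  moreover have "1 - length \<tau> + (1 - length (delete ?D \<tau>')) = 1 - length \<tau>' + (1 - length (delete ?D' \<tau>))"
  proof -
    have "e \<notin> set \<tau>'" "e' \<notin> set \<tau>" using e disj by auto
    moreover have "length \<tau> \<le> 1" "length \<tau>' \<le> 1" using r r' by (auto simp: redex_def)
    ultimately show ?thesis by (cases \<tau>; cases \<tau>') auto
  qed
  ultimately show ?thesis using s1 s2 unfolding joinable_def by metis
qed

text \<open>
  If the redexes have different outer letters, then either they do not interfere or they overlap in \<open>s t s t\<close>.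
  If they have the same outer letter and do not coincide, they share at most one end, the last
  letter of one being the first of the other, and each reduction can delete its other end.
\<close>
lemma local_confluence:
  assumes "tstep c x y" "tstep d x z"
  shows "joinable c y d z"
proof -
  define u where "u = zip x [0..<length x]"
  have xu: "x = map fst u" and u: "distinct u" by (auto simp: u_def distinct_zipI2)
  obtain \<alpha> \<tau> \<beta> where r: "redex u \<alpha> \<tau> \<beta>" and c: "c = 1 - length \<tau>"
    and y: "\<And>e. e \<in> {\<alpha>, \<beta>} \<Longrightarrow> map fst (delete (insert e (set \<tau>)) u) \<approx> y"
    using tstep_redex[OF assms(1)[unfolded xu] u] by metis
  obtain \<alpha>' \<tau>' \<beta>' where r': "redex u \<alpha>' \<tau>' \<beta>'" and d: "d = 1 - length \<tau>'"
    and z: "\<And>e. e \<in> {\<alpha>', \<beta>'} \<Longrightarrow> map fst (delete (insert e (set \<tau>')) u) \<approx> z"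
    using tstep_redex[OF assms(2)[unfolded xu] u] by metis
  note o = redex_order[OF u r] and o' = redex_order[OF u r']
  have l: "fst \<alpha> = fst \<beta>" "fst \<alpha>' = fst \<beta>'" using r r' by (auto simp: redex_def)
  have t: "\<And>t. t \<in> set \<tau> \<Longrightarrow> E (fst \<alpha>) (fst t)" "\<And>t. t \<in> set \<tau>' \<Longrightarrow> E (fst \<alpha>') (fst t)"
    using r r' by (auto simp: redex_def)
  \<comment> \<open>the letters \<open>e\<close> and \<open>e'\<close> are the ends to be deleted; a suitable choice makes the redexes independent\<close>
  have commuting: ?thesis if "e \<in> {\<alpha>, \<beta>}" "e' \<in> {\<alpha>', \<beta>'}" "{\<alpha>, \<beta>} \<inter> insert e' (set \<tau>') = {}"
    "{\<alpha>', \<beta>'} \<inter> insert e (set \<tau>) = {}" for e e'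
  proof -
    have "map fst (delete (insert e (set \<tau>)) u) \<approx> y" "map fst (delete (insert e' (set \<tau>')) u) \<approx> z"
      using y z that by blast+
    then show ?thesis
      using joinable_teq[OF redex_join_commuting[OF u r r' that]] c d by simp
  qed
  have same: ?thesis if "e \<in> {\<alpha>, \<beta>}" "e' \<in> {\<alpha>', \<beta>'}" "insert e (set \<tau>) = insert e' (set \<tau>')"
    "length \<tau> = length \<tau>'" for e e'
  proof -
    have "y \<approx> z" using teq_trans[OF teq_sym[OF y[OF that(1)]]] z[OF that(2)] that(3) by simp
    then show ?thesis using that c d by (simp add: joinable_def)
  qed
  show ?thesis
  proof (cases "fst \<alpha> = fst \<alpha>'")
    case True
    have nt: "\<alpha> \<notin> set \<tau>'" "\<beta> \<notin> set \<tau>'" "\<alpha>' \<notin> set \<tau>" "\<beta>' \<notin> set \<tau>"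
      using True l t E_irrefl by metis+
    consider "\<alpha> = \<alpha>'" | "\<beta> = \<beta>'" | "\<alpha> = \<beta>'" "\<alpha> \<noteq> \<alpha>'" "\<beta> \<noteq> \<beta>'" | "\<alpha>' = \<beta>" "\<alpha> \<noteq> \<alpha>'" "\<beta> \<noteq> \<beta>'"
      | "{\<alpha>, \<beta>} \<inter> {\<alpha>', \<beta>'} = {}" by auto
    then show ?thesis
    proof cases
      case 1
      then show ?thesis using redex_same_first[OF u r] r' same[of \<alpha> \<alpha>'] by auto
    next
      case 2
      then have "\<alpha> = \<alpha>'" using redex_same_last[OF u r] r' by blast
      then show ?thesis using redex_same_first[OF u r] r' same[of \<alpha> \<alpha>'] by auto
    next
      case 3
      have "\<alpha>' \<noteq> \<beta>" using o'(5) 3(1) precedes_asym[OF o(5) o(1)] by auto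
      show ?thesis using commuting[of \<beta> \<alpha>'] 3 o(1-3) o'(1-3) nt \<open>\<alpha>' \<noteq> \<beta>\<close> by auto
    next
      case 4
      have "\<alpha> \<noteq> \<beta>'" using o'(5) 4(1) precedes_asym[OF o(5) o(1)] by auto
      then show ?thesis using commuting[of \<alpha> \<beta>'] 4 o(1-3) o'(1-3) nt \<open>\<alpha> \<noteq> \<beta>'\<close> by auto
    next
      case 5
      then show ?thesis using commuting[of \<beta> \<beta>'] o(1-3) o'(1-3) nt by auto
    qed
  next
    case False
    then have ne: "{\<alpha>, \<beta>} \<inter> {\<alpha>', \<beta>'} = {}" using l by auto
    consider "\<alpha>' \<in> set \<tau>" | "\<beta>' \<in> set \<tau>" | "\<alpha> \<in> set \<tau>'" | "\<beta> \<in> set \<tau>'"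
      | "{\<alpha>, \<beta>} \<inter> set \<tau>' = {}" "{\<alpha>', \<beta>'} \<inter> set \<tau> = {}" by blast
    then show ?thesis
    proof cases
      case 1
      then have "\<tau> = [\<alpha>']" "\<tau>' = [\<beta>]" using redex_overlap_right[OF u r _ r'] by auto
      then show ?thesis using same[of \<beta> \<alpha>'] by auto
    next
      case 2
      then have "\<tau> = [\<beta>']" "\<tau>' = [\<alpha>]" using redex_overlap_left[OF u r _ r'] by auto
      then show ?thesis using same[of \<alpha> \<beta>'] by auto
    next
      case 3
      then have "\<tau>' = [\<alpha>]" "\<tau> = [\<beta>']" using redex_overlap_right[OF u r' _ r] by auto
      then show ?thesis using same[of \<alpha> \<beta>'] by auto
    next
      case 4
      then have "\<tau>' = [\<beta>]" "\<tau> = [\<alpha>']" using redex_overlap_left[OF u r' _ r] by auto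
      then show ?thesis using same[of \<beta> \<alpha>'] by auto
    next
      case 5
      then show ?thesis using commuting[of \<beta> \<beta>'] ne by auto
    qed
  qed
qed

section \<open>Normal forms\<close>

inductive reduces :: "nat \<Rightarrow> 'a list \<Rightarrow> 'a list \<Rightarrow> bool" where
  stop: "x \<approx> y \<Longrightarrow> reduces 0 x y"
| more: "tstep c x y \<Longrightarrow> reduces k y z \<Longrightarrow> reduces (c + k) x z"

text \<open>
  The irreducible words are the reduced words of the fully commutative elements (lemma \<open>W_c_iff\<close>), hence the name.
\<close>
definition FC :: "'a list \<Rightarrow> bool" where "FC x \<longleftrightarrow> (\<nexists>c y. tstep c x y)"

lemma FC_teq: "x \<approx> y \<Longrightarrow> FC x \<Longrightarrow> FC y"
  unfolding FC_def using tstep_teq[OF _ _ trace_eq.refl] by blast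

lemma FC_factor: "FC (p @ x @ r) \<Longrightarrow> FC x"
  unfolding FC_def using tstep_context by blast

lemma reduces_trans: "reduces k x y \<Longrightarrow> reduces l y z \<Longrightarrow> reduces (k + l) x z"
proof (induction rule: reduces.induct)
  case (stop x y)
  from stop.prems show ?case
  proof (cases rule: reduces.cases)
    case stop': stop
    then show ?thesis using reduces.stop[OF teq_trans[OF stop.hyps]] by simp
  next
    case (more c y' k)
    then show ?thesis using reduces.more[OF tstep_teq[OF more(2) stop.hyps trace_eq.refl]] by simp
  qed
next
  case (more c x y k z')
  then show ?case using reduces.more[OF more.hyps(1) more.IH[OF more.prems]] by (simp add: add.assoc)
qed

lemma reduces_context: "reduces k x y \<Longrightarrow> reduces k (p @ x @ r) (p @ y @ r)"
  by (induction rule: reduces.induct) (auto intro: reduces.intros trace_eq_context tstep_context)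

lemma reduces_tstep: "tstep c x y \<Longrightarrow> reduces c x y"
  using reduces.more[OF _ reduces.stop[OF trace_eq.refl]] by fastforce

lemma reduces_FC: "\<exists>k y. reduces k x y \<and> FC y"
proof (induction "length x" arbitrary: x rule: less_induct)
  case less
  show ?case
  proof (cases "FC x")
    case True
    then show ?thesis using reduces.stop trace_eq.refl by blast
  next
    case False
    then obtain c y where "tstep c x y" unfolding FC_def by blast
    then show ?thesis using less[OF tstep_length[of c x y]] reduces.more by blast
  qed
qed

lemma reduces_length: "reduces k x y \<Longrightarrow> k + length y \<le> length x \<and> (length y = length x \<longrightarrow> k = 0 \<and> x \<approx> y)"
proof (induction rule: reduces.induct)
  case (more c x y k z)
  have "c \<le> 1" using more.hyps(1) unfolding tstep_def by (auto elim: rstep.cases)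
  then show ?case using more.IH tstep_length[OF more.hyps(1)] by auto
qed (auto dest: trace_eq_length)

lemma reduces_from_FC: "reduces k x y \<Longrightarrow> FC x \<Longrightarrow> k = 0 \<and> x \<approx> y"
  by (cases rule: reduces.cases) (auto simp: FC_def)

text \<open>
  Newman's argument, with the exponents of \<open>\<delta>\<close> carried along; reductions shorten words, so they terminate.
\<close>
lemma confluence:
  "reduces k x y \<Longrightarrow> FC y \<Longrightarrow> reduces l x z \<Longrightarrow> FC z \<Longrightarrow> k = l \<and> y \<approx> z"
proof (induction "length x" arbitrary: x k y l z rule: less_induct)
  case less
  show ?case
  proof (cases "FC x")
    case True
    then show ?thesis
      using reduces_from_FC[OF less.prems(1) True] reduces_from_FC[OF less.prems(3) True]
        teq_trans[OF teq_sym] by blast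
  next
    case False
    obtain c k' x1 where 1: "tstep c x x1" "reduces k' x1 y" "k = c + k'"
      using less.prems(1) by (rule reduces.cases) (use False less.prems(2) FC_teq teq_sym in blast)+
    obtain d l' x2 where 2: "tstep d x x2" "reduces l' x2 z" "l = d + l'"
      using less.prems(3) by (rule reduces.cases) (use False less.prems(4) FC_teq teq_sym in blast)+
    note IH1 = less.hyps[OF tstep_length[OF 1(1)] 1(2) less.prems(2)]
    note IH2 = less.hyps[OF tstep_length[OF 2(1)] 2(2) less.prems(4)]
    from local_confluence[OF 1(1) 2(1)] show ?thesis unfolding joinable_def
    proof (elim disjE exE conjE)
      assume "c = d" "x1 \<approx> x2"
      then show ?thesis
        using IH1[OF reduces_trans[OF reduces.stop 2(2)] less.prems(4)] 1 2 by auto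
    next
      fix c' d' w assume w: "tstep c' x1 w" "tstep d' x2 w" "c + c' = d + d'"
      obtain m n where n: "reduces m w n" "FC n" using reduces_FC by blast
      show ?thesis
        using IH1[OF reduces.more[OF w(1) n(1)] n(2)] IH2[OF reduces.more[OF w(2) n(1)] n(2)] 1 2 w(3)
          teq_trans[OF _ teq_sym] by (metis add.assoc)
    qed
  qed
qed

definition nf :: "'a list \<Rightarrow> 'a list" where "nf x = (SOME y. FC y \<and> (\<exists>k. reduces k x y))"

definition loops :: "'a list \<Rightarrow> nat" where "loops x = (SOME k. reduces k x (nf x))"

lemma FC_nf: "FC (nf x)" and reduces_nf: "reduces (loops x) x (nf x)"
proof -
  have "FC (nf x) \<and> (\<exists>k. reduces k x (nf x))"
    unfolding nf_def by (rule someI_ex) (use reduces_FC in blast)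
  then show "FC (nf x)" "reduces (loops x) x (nf x)"
    unfolding loops_def by (auto intro: someI_ex)
qed

lemma reduces_loops: "reduces k x y \<Longrightarrow> loops x = k + loops y \<and> nf x \<approx> nf y"
  using confluence[OF reduces_nf FC_nf reduces_trans[OF _ reduces_nf] FC_nf] .

lemma loops_teq: "x \<approx> y \<Longrightarrow> loops x = loops y \<and> nf x \<approx> nf y"
  using reduces_loops[OF reduces.stop] by simp

lemma nf_FC: "FC x \<Longrightarrow> loops x = 0 \<and> nf x \<approx> x"
  using reduces_from_FC[OF reduces_nf] teq_sym by blast

lemma nf_length: "loops x + length (nf x) \<le> length x"
  using reduces_length[OF reduces_nf] by blast

lemma nf_context: "loops (p @ x @ r) = loops x + loops (p @ nf x @ r) \<and> nf (p @ x @ r) \<approx> nf (p @ nf x @ r)"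
  using reduces_loops[OF reduces_context[OF reduces_nf]] .

lemma loops_loop: "loops (p @ [s, s] @ r) = Suc (loops (p @ [s] @ r))"
    and nf_loop: "nf (p @ [s, s] @ r) \<approx> nf (p @ [s] @ r)"
  using reduces_loops[OF reduces_tstep[OF rstep_tstep[OF rstep.loop[of p s r]]]] by auto

lemma loops_zigzag: "E s t \<Longrightarrow> loops (p @ [s, t, s] @ r) = loops (p @ [s] @ r)"
    and nf_zigzag: "E s t \<Longrightarrow> nf (p @ [s, t, s] @ r) \<approx> nf (p @ [s] @ r)"
  using reduces_loops[OF reduces_tstep[OF rstep_tstep[OF rstep.zigzag[of s t p r]]]] by auto

end

section \<open>Functions on words that respect the Temperley--Lieb relations\<close>

lemma subseqs_eq_Cons: "\<exists>rest. subseqs x = x # rest \<and> (\<forall>I\<in>set rest. length I < length x)"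
proof (induction x)
  case (Cons s x)
  then obtain rest where "subseqs x = x # rest" "\<forall>I\<in>set rest. length I < length x" by blast
  then show ?case by (auto simp: Let_def intro: less_SucI)
qed simp

lemma length_subseqs_le: "I \<in> set (subseqs x) \<Longrightarrow> length I \<le> length x"
  using subseqs_eq_Cons[of x] by (auto intro: less_imp_le)

context simple_graph begin

text \<open>
  These are the functions on words that extend to linear functionals on the Temperley--Lieb algebra
  with loop value \<open>d\<close>, a word standing for the product of the generators \<open>b\<^sub>s\<close>.  They are available
  before anything is known about this algebra.
\<close>
definition admissible :: "'r::comm_ring_1 \<Rightarrow> ('a list \<Rightarrow> 'r) \<Rightarrow> bool" where
  "admissible d F \<longleftrightarrow>
    (\<forall>p s r. F (p @ [s, s] @ r) = d * F (p @ [s] @ r)) \<and>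
    (\<forall>p s t r. E s t \<longrightarrow> F (p @ [s, t, s] @ r) = F (p @ [s] @ r)) \<and>
    (\<forall>p s t r. ind s t \<longrightarrow> F (p @ [s, t] @ r) = F (p @ [t, s] @ r))"

lemma admissibleD:
  assumes "admissible d F"
  shows "F (p @ s # s # r) = d * F (p @ s # r)"
    "E s t \<Longrightarrow> F (p @ s # t # s # r) = F (p @ s # r)"
    "ind s t \<Longrightarrow> F (p @ s # t # r) = F (p @ t # s # r)"
    "F (s # s # r) = d * F (s # r)"
    "E s t \<Longrightarrow> F (s # t # s # r) = F (s # r)"
    "ind s t \<Longrightarrow> F (s # t # r) = F (t # s # r)"
proof -
  show *: "F (p @ s # s # r) = d * F (p @ s # r)"
    "E s t \<Longrightarrow> F (p @ s # t # s # r) = F (p @ s # r)"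
    "ind s t \<Longrightarrow> F (p @ s # t # r) = F (p @ t # s # r)" for p
  proof -
    have "F (p @ [s, s] @ r) = d * F (p @ [s] @ r)" "E s t \<Longrightarrow> F (p @ [s, t, s] @ r) = F (p @ [s] @ r)"
      "ind s t \<Longrightarrow> F (p @ [s, t] @ r) = F (p @ [t, s] @ r)"
      using assms unfolding admissible_def by blast+
    then show "F (p @ s # s # r) = d * F (p @ s # r)" "E s t \<Longrightarrow> F (p @ s # t # s # r) = F (p @ s # r)"
      "ind s t \<Longrightarrow> F (p @ s # t # r) = F (p @ t # s # r)" by simp_all
  qed
  show "F (s # s # r) = d * F (s # r)"
    "E s t \<Longrightarrow> F (s # t # s # r) = F (s # r)"
    "ind s t \<Longrightarrow> F (s # t # r) = F (t # s # r)"
    using *[of "[]"] by auto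
qed

text \<open>
  The functional \<open>z \<mapsto> F (T\<^sub>s z)\<close> for \<open>T\<^sub>s = u b\<^sub>s - 1\<close>; likewise \<open>ract\<close> for \<open>z \<mapsto> F (z T\<^sub>s)\<close>.  If
  \<open>u\<^sup>2 + 1 = u d\<close>, then \<open>T\<^sub>s\<close> satisfies the braid relations and the quadratic relation
  \<open>T\<^sub>s\<^sup>2 = u\<^sup>2 + (u\<^sup>2 - 1) T\<^sub>s\<close>.
\<close>
definition lact :: "'r::comm_ring_1 \<Rightarrow> 'a \<Rightarrow> ('a list \<Rightarrow> 'r) \<Rightarrow> 'a list \<Rightarrow> 'r" where
  "lact u s F = (\<lambda>z. u * F (s # z) - F z)"

definition ract :: "'r::comm_ring_1 \<Rightarrow> 'a \<Rightarrow> ('a list \<Rightarrow> 'r) \<Rightarrow> 'a list \<Rightarrow> 'r" where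
  "ract u s F = (\<lambda>z. u * F (z @ [s]) - F z)"

lemma admissible_shift: "admissible d F \<Longrightarrow> admissible d (\<lambda>z. F (p @ z @ r))"
  unfolding admissible_def by (metis append.assoc)

lemma admissible_lincomb:
  "admissible d F \<Longrightarrow> admissible d G \<Longrightarrow> admissible d (\<lambda>z. a * F z - b * G z)"
  unfolding admissible_def
  by (auto simp: right_diff_distrib mult.left_commute[of d] simp del: append_Cons)
    (metis (no_types, lifting))

lemma admissible_lact: "admissible d F \<Longrightarrow> admissible d (lact u s F)"
  using admissible_lincomb[OF admissible_shift[of d F "[s]" "[]"], of F u 1] by (simp add: lact_def)

lemma admissible_ract: "admissible d F \<Longrightarrow> admissible d (ract u s F)"
  using admissible_lincomb[OF admissible_shift[of d F "[]" "[s]"], of F u 1] by (simp add: ract_def)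

lemma admissible_fold: "admissible d F \<Longrightarrow> admissible d (fold (lact u) x F)"
  by (induction x arbitrary: F) (auto intro: admissible_lact)

text \<open>
  On the level of functions, this is what associativity of the algebra amounts to.
\<close>
lemma lact_ract: "lact u s (ract u t F) = ract u t (lact u s F)"
  by (auto simp: lact_def ract_def algebra_simps)

lemma fold_lact_ract: "fold (lact u) x (ract u t F) = ract u t (fold (lact u) x F)"
  by (induction x arbitrary: F) (auto simp: lact_ract)

lemma lact_square:
  assumes "admissible d F" "u * u + 1 = u * d"
  shows "lact u s (lact u s F) = (\<lambda>z. u * u * F z + (u * u - 1) * lact u s F z)"
proof
  fix z
  have "u * (u * d) = u * (u * u + 1)" using assms(2) by simp
  then have "u * (u * (d * F (s # z))) = u * (u * u + 1) * F (s # z)" by (metis mult.assoc)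
  then show "lact u s (lact u s F) z = u * u * F z + (u * u - 1) * lact u s F z"
    using admissibleD(4)[OF assms(1)] by (simp add: lact_def algebra_simps)
qed

lemma lact_commute: "admissible d F \<Longrightarrow> ind s t \<Longrightarrow> lact u s (lact u t F) = lact u t (lact u s F)"
proof
  fix z assume a: "admissible d F" "ind s t"
  show "lact u s (lact u t F) z = lact u t (lact u s F) z"
    using admissibleD(6)[OF a, of z] by (simp add: lact_def algebra_simps)
qed

lemma lact_braid:
  assumes "admissible d F" "u * u + 1 = u * d" "E s t"
  shows "lact u s (lact u t (lact u s F)) = lact u t (lact u s (lact u t F))"
proof
  fix z
  have e: "u * (u * d) = u * (u * u + 1)" using assms(2) by simp
  then have "u * (u * (d * F (s # z))) = u * (u * u + 1) * F (s # z)"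
    "u * (u * (d * F (t # z))) = u * (u * u + 1) * F (t # z)"
    by (metis mult.assoc)+
  then show "lact u s (lact u t (lact u s F)) z = lact u t (lact u s (lact u t F)) z"
    using admissibleD(4,5)[OF assms(1)] assms(3) E_sym[OF assms(3)]
    by (simp add: lact_def algebra_simps)
qed

inductive braid_eq :: "'a list \<Rightarrow> 'a list \<Rightarrow> bool" where
  reflexive: "braid_eq x x"
| commute: "braid_eq x (p @ s # t # r) \<Longrightarrow> ind s t \<Longrightarrow> braid_eq x (p @ t # s # r)"
| braid: "braid_eq x (p @ s # t # s # r) \<Longrightarrow> E s t \<Longrightarrow> braid_eq x (p @ t # s # t # r)"

lemma braid_eq_trans: "braid_eq y z \<Longrightarrow> braid_eq x y \<Longrightarrow> braid_eq x z"
  by (induction rule: braid_eq.induct) (blast intro: braid_eq.intros)+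

lemma braid_eq_Cons: "braid_eq x y \<Longrightarrow> braid_eq (a # x) (a # y)"
proof (induction rule: braid_eq.induct)
  case (commute x p s t r)
  then show ?case using braid_eq.commute[of "a # x" "a # p" s t r] by simp
next
  case (braid x p s t r)
  then show ?case using braid_eq.braid[of "a # x" "a # p" s t r] by simp
qed (rule reflexive)

lemma fold_lact_braid_eq:
  assumes "admissible d F" "u * u + 1 = u * d"
  shows "braid_eq x y \<Longrightarrow> fold (lact u) x F = fold (lact u) y F"
proof (induction rule: braid_eq.induct)
  case (commute x p s t r)
  then show ?case
    using lact_commute[OF admissible_fold[OF assms(1), of u p] commute.hyps(2), of u] by simp
next
  case (braid x p s t r)
  then show ?case
    using lact_braid[OF admissible_fold[OF assms(1), of u p] assms(2) braid.hyps(2)] by simp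
qed simp

text \<open>
  The left hand side is the value of \<open>F\<close> at \<open>T\<^sub>s T\<^sub>t \<dots>\<close>, the product along \<open>x\<close>.  Expanding each factor
  \<open>u b\<^sub>s - 1\<close> amounts to choosing the subword of those letters that contribute \<open>b\<^sub>s\<close>.
\<close>
lemma fold_lact_expand:
  "fold (lact u) x F [] = (\<Sum>I\<leftarrow>subseqs x. u ^ length I * (-1) ^ (length x - length I) * F I)"
proof (induction x arbitrary: F)
  case (Cons s x)
  have m: "map (\<lambda>I. u ^ length I * (-1) ^ (length x - length I) * lact u s F I) (subseqs x) =
     map (\<lambda>I. u ^ length (s # I) * (-1) ^ (length (s # x) - length (s # I)) * F (s # I) +
       u ^ length I * (-1) ^ (length (s # x) - length I) * F I) (subseqs x)"
    by (rule map_cong) (auto simp: lact_def algebra_simps Suc_diff_le dest: length_subseqs_le)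
  have "fold (lact u) (s # x) F [] =
     (\<Sum>I\<leftarrow>subseqs x. u ^ length I * (-1) ^ (length x - length I) * lact u s F I)"
    by (simp add: Cons.IH)
  also have "\<dots> = (\<Sum>I\<leftarrow>subseqs (s # x). u ^ length I * (-1) ^ (length (s # x) - length I) * F I)"
    unfolding m by (simp add: sum_list_addf Let_def o_def)
  finally show ?case .
qed simp

text \<open>
  The coefficient of the irreducible word \<open>c\<close>.  Confluence makes it admissible.
\<close>
definition chi :: "'r::comm_ring_1 \<Rightarrow> 'a list \<Rightarrow> 'a list \<Rightarrow> 'r" where
  "chi d c x = (if nf x \<approx> c then d ^ loops x else 0)"

lemma nf_teq_cong: "nf x \<approx> nf y \<Longrightarrow> nf x \<approx> c \<longleftrightarrow> nf y \<approx> c"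
  using teq_trans teq_sym by blast

lemma admissible_chi: "admissible d (chi d c)"
proof -
  have "chi d c x = chi d c y" if "x \<approx> y" for x y
    using loops_teq[OF that] nf_teq_cong[of x y c] by (simp add: chi_def)
  then show ?thesis
    using nf_teq_cong[OF nf_loop, of _ _ _ c] nf_teq_cong[OF nf_zigzag, of _ _ _ _ c]
      loops_loop loops_zigzag trace_eq_swapI[of ind]
    unfolding admissible_def by (simp add: chi_def)
qed

text \<open>
  A subword of \<open>y\<close> whose normal form is \<open>x\<close> has at least the length of \<open>x\<close>; if \<open>y\<close> is no longer
  than \<open>x\<close>, it has to be \<open>y\<close> itself, and no reduction can be involved.
\<close>
lemma chi_support:
  assumes "fold (lact u) y (chi d x) [] \<noteq> 0"
  shows "length x \<le> length y" "length x = length y \<Longrightarrow> y \<approx> x"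
proof -
  have "\<exists>I\<in>set (subseqs y). chi d x I \<noteq> 0"
    using assms unfolding fold_lact_expand by (metis (no_types, lifting) mult_zero_right sum_list_0 map_cong)
  then obtain I where I: "I \<in> set (subseqs y)" "nf I \<approx> x" unfolding chi_def by (auto split: if_splits)
  have 1: "length x \<le> length I" using nf_length[of I] trace_eq_length[OF I(2)] by simp
  then show "length x \<le> length y" using length_subseqs_le[OF I(1)] by simp
  assume "length x = length y"
  then have "I = y" using 1 I(1) subseqs_eq_Cons[of y] by (auto dest: leD)
  then have "y \<approx> nf I" using reduces_length[OF reduces_nf[of y]] nf_length[of y] 1
      trace_eq_length[OF I(2)] \<open>length x = length y\<close> by auto
  then show "y \<approx> x" using I(2) teq_trans by blast
qed

lemma chi_self:
  assumes "FC x"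
  shows "fold (lact u) x (chi d x) [] = u ^ length x"
proof -
  obtain rest where r: "subseqs x = x # rest" "\<And>I. I \<in> set rest \<Longrightarrow> length I < length x"
    using subseqs_eq_Cons by blast
  have "chi d x I = 0" if "I \<in> set rest" for I
    using nf_length[of I] trace_eq_length[of ind "nf I" x] r(2)[OF that] by (auto simp: chi_def)
  then have "(\<Sum>I\<leftarrow>rest. u ^ length I * (-1) ^ (length x - length I) * chi d x I) = 0"
    by (induction rest) auto
  moreover have "chi d x x = 1" using nf_FC[OF assms] by (simp add: chi_def)
  ultimately show ?thesis unfolding fold_lact_expand r(1) by simp
qed

end

section \<open>Irreducible words as words with large gaps\<close>

text \<open>
  At least two neighbours of \<open>s\<close> separate consecutive occurrences of \<open>s\<close>.  In contrast to \<open>FC\<close>, this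
  does not refer to equivalent words.
\<close>
definition gap_ok :: "('b \<Rightarrow> 'b \<Rightarrow> bool) \<Rightarrow> 'b list \<Rightarrow> bool" where
  "gap_ok E x \<longleftrightarrow> (\<forall>p s m r. x = p @ s # m @ s # r \<and> s \<notin> set m \<longrightarrow> 2 \<le> length (filter (E s) m))"

lemma gap_okD: "gap_ok E (p @ s # m @ s # r) \<Longrightarrow> s \<notin> set m \<Longrightarrow> 2 \<le> length (filter (E s) m)"
  unfolding gap_ok_def by blast

lemma gap_ok_factor: "gap_ok E (p @ x @ r) \<Longrightarrow> gap_ok E x"
  unfolding gap_ok_def
proof (intro allI impI, elim conjE)
  fix p' s m r'
  assume a: "\<forall>p' s m r'. p @ x @ r = p' @ s # m @ s # r' \<and> s \<notin> set m \<longrightarrow> 2 \<le> length (filter (E s) m)"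
    and x: "x = p' @ s # m @ s # r'" "s \<notin> set m"
  have "p @ x @ r = (p @ p') @ s # m @ s # (r' @ r)" by (simp add: x)
  then show "2 \<le> length (filter (E s) m)" using a x(2) by blast
qed

lemma map_split_gap:
  assumes "map f x = P @ a # L @ b # R"
  obtains p a' m b' r where "x = p @ a' # m @ b' # r" "map f p = P" "f a' = a" "map f m = L" "f b' = b"
proof -
  obtain p y where 1: "x = p @ y" "map f p = P" "map f y = a # L @ b # R"
    using assms by (auto simp: map_eq_append_conv)
  obtain a' z where 2: "y = a' # z" "f a' = a" "map f z = L @ b # R" using 1(3) by (auto simp: map_eq_Cons_conv)
  obtain m w where 3: "z = m @ w" "map f m = L" "map f w = b # R" using 2(3) by (auto simp: map_eq_append_conv)
  obtain b' r where 4: "w = b' # r" "f b' = b" using 3(3) by (auto simp: map_eq_Cons_conv)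
  show ?thesis using that[of p a' m b' r] 1 2 3 4 by simp
qed

lemma filter_split:
  "filter A x = P @ Q \<Longrightarrow> \<exists>p r. x = p @ r \<and> filter A p = P \<and> filter A r = Q"
proof (induction P arbitrary: x)
  case Nil
  then show ?case by (intro exI[of _ "[]"] exI[of _ x]) simp
next
  case (Cons a P)
  then have "filter A x = a # (P @ Q)" by simp
  from filter_eq_ConsD[OF this] obtain us vs where
    1: "x = us @ a # vs" "\<forall>u\<in>set us. \<not> A u" "A a" "filter A vs = P @ Q" by auto
  obtain p r where "vs = p @ r" "filter A p = P" "filter A r = Q" using Cons.IH[OF 1(4)] by blast
  then show ?case using 1 by (intro exI[of _ "us @ a # p"] exI[of _ r]) simp
qed

lemma filter_eq_singletonD:
  assumes "filter P m = [t]"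
  obtains m1 m2 where "m = m1 @ t # m2" "\<forall>z\<in>set m1. \<not> P z" "P t" "filter P m2 = []"
  using filter_eq_ConsD[OF assms] that by metis

lemma gap_ok_map:
  assumes "gap_ok E x" and inj: "inj_on f (set x)"
    and E: "\<And>s t. s \<in> set x \<Longrightarrow> t \<in> set x \<Longrightarrow> E' (f s) (f t) \<longleftrightarrow> E s t"
  shows "gap_ok E' (map f x)"
  unfolding gap_ok_def
proof (intro allI impI, elim conjE)
  fix p s m r assume *: "map f x = p @ s # m @ s # r" "s \<notin> set m"
  obtain p' a m' b r' where x: "x = p' @ a # m' @ b # r'" and f: "f a = s" "map f m' = m" "f b = s"
    using map_split_gap[OF *(1)] by metis
  have b: "b = a" using inj_onD[OF inj, of b a] x f by auto
  have "a \<notin> set m'" using f *(2) by auto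
  then have "2 \<le> length (filter (E a) m')" using gap_okD[of E p' a m' r'] assms(1) x b by auto
  moreover have "filter (E' s) m = map f (filter (E a) m')"
    unfolding f(2)[symmetric] filter_map using E x f(1) by (auto intro!: filter_cong arg_cong[of _ _ "map f"])
  ultimately show "2 \<le> length (filter (E' s) m)" by simp
qed

lemma first_split: "m @ s # r = m' @ s # r' \<Longrightarrow> s \<notin> set m \<Longrightarrow> s \<notin> set m' \<Longrightarrow> m = m'"
  by (induction m arbitrary: m') (case_tac m', auto)+

lemma append_eq_split:
  assumes "p @ s # r = U @ V"
  shows "(\<exists>w. U = p @ s # w \<and> r = w @ V) \<or> (\<exists>w. p = U @ w \<and> V = w @ s # r)"
  using assms by (auto simp: append_eq_append_conv2 Cons_eq_append_conv append_eq_Cons_conv)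

context simple_graph begin

lemma filter_split_gap:
  assumes "filter A x = P @ a # L @ b # R"
  obtains p m r where "x = p @ a # m @ b # r" "filter A m = L"
proof -
  obtain p y where 1: "x = p @ y" "filter A y = a # L @ b # R" using filter_split[OF assms] by blast
  obtain y1 y2 where 2: "y = y1 @ a # y2" "filter A y2 = L @ b # R" using filter_eq_ConsD[OF 1(2)] by auto
  obtain m z where 3: "y2 = m @ z" "filter A m = L" "filter A z = b # R" using filter_split[OF 2(2)] by blast
  obtain z1 z2 where 4: "z = z1 @ b # z2" "\<forall>u\<in>set z1. \<not> A u" using filter_eq_ConsD[OF 3(3)] by blast
  show ?thesis using that[of "p @ y1" "m @ z1" z2] 1 2 3 4 by simp
qed

text \<open>
  Neighbours of \<open>s\<close> may change places with each other, but not with \<open>s\<close>; so what is invariant is the pattern of the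
  occurrences of \<open>s\<close> among its neighbours.
\<close>
lemma teq_star_profile:
  "x \<approx> y \<Longrightarrow> map (\<lambda>z. z = s) (filter (\<lambda>z. z = s \<or> E s z) x) = map (\<lambda>z. z = s) (filter (\<lambda>z. z = s \<or> E s z) y)"
proof (induction rule: trace_eq.induct)
  case (swap x p a b r)
  then show ?case using E_sym by (auto simp: ind_def)
qed simp

text \<open>
  In a gap with at most one neighbour of \<open>s\<close>, all other letters commute with \<open>s\<close>; moving the two
  occurrences together exhibits \<open>s s\<close> or \<open>s t s\<close>.  Conversely, a reducible word is equivalent to
  one with a small gap, and the sizes of the gaps can be read off from the invariant above.
\<close>
lemma FC_iff_gap_ok: "FC x \<longleftrightarrow> gap_ok E x"
proof
  assume FC: "FC x"
  show "gap_ok E x" unfolding gap_ok_def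
  proof (intro allI impI, rule ccontr, elim conjE)
    fix p s m r assume x: "x = p @ s # m @ s # r" "s \<notin> set m" and l: "\<not> 2 \<le> length (filter (E s) m)"
    show False
    proof (cases "filter (E s) m")
      case Nil
      then have "x \<approx> p @ m @ [s, s] @ r"
        using trace_eq_move_back[of m ind s p "s # r"] x by (auto simp: ind_def filter_empty_conv)
      then show False using tstep_teq[OF rstep_tstep[OF rstep.loop[of "p @ m" s r]] _ trace_eq.refl] FC
        unfolding FC_def by auto
    next
      case (Cons t L)
      then have L: "filter (E s) m = [t]" using l by (cases L) auto
      then obtain m1 m2 where m: "m = m1 @ t # m2" "\<forall>z\<in>set m1. \<not> E s z" "E s t" "filter (E s) m2 = []"
        by (rule filter_eq_singletonD)
      have "p @ [s] @ m1 @ (t # m2 @ s # r) \<approx> p @ m1 @ [s] @ (t # m2 @ s # r)"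
        by (rule trace_eq_move_back) (use x m in \<open>auto simp: ind_def\<close>)
      moreover have "(p @ m1 @ [s, t]) @ [s] @ m2 @ r \<approx> (p @ m1 @ [s, t]) @ m2 @ [s] @ r"
        by (rule trace_eq_move_back) (use x m in \<open>auto simp: ind_def filter_empty_conv\<close>)
      from teq_sym[OF this] have "(p @ m1 @ [s, t]) @ m2 @ [s] @ r \<approx> (p @ m1 @ [s, t]) @ [s] @ m2 @ r" .
      ultimately have "x \<approx> (p @ m1) @ [s, t, s] @ (m2 @ r)"
        using teq_trans[of "p @ s # m1 @ t # m2 @ s # r"] x m by simp
      then show False
        using tstep_teq[OF rstep_tstep[OF rstep.zigzag[of s t "p @ m1" "m2 @ r"]] _ trace_eq.refl] FC m(3)
        unfolding FC_def by auto
    qed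
  qed
next
  assume g: "gap_ok E x"
  show "FC x" unfolding FC_def tstep_def
  proof (rule notI, elim exE conjE)
    fix c y x' y' assume x': "x \<approx> x'" "rstep c x' y'"
    have "\<exists>s L P R. length L \<le> 1 \<and> (\<forall>t\<in>set L. E s t) \<and> x' = P @ s # L @ s # R"
      using x'(2)
    proof cases
      case (loop p s r)
      then show ?thesis by (intro exI[of _ s] exI[of _ "[]"] exI[of _ p] exI[of _ r]) auto
    next
      case (zigzag s t p r)
      then show ?thesis by (intro exI[of _ s] exI[of _ "[t]"] exI[of _ p] exI[of _ r]) auto
    qed
    then obtain s L P R where L: "length L \<le> 1" "\<forall>t\<in>set L. E s t" "x' = P @ s # L @ s # R" by blast
    let ?A = "\<lambda>z. z = s \<or> E s z"
    have "filter ?A L = L" using L(2) by simp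
    then have "map (\<lambda>z. z = s) (filter ?A x) =
        map (\<lambda>z. z = s) (filter ?A P) @ True # map (\<lambda>z. z = s) L @ True # map (\<lambda>z. z = s) (filter ?A R)"
      using teq_star_profile[OF x'(1), of s] L(3) by simp
    then obtain P' a L' b R' where "filter ?A x = P' @ a # L' @ b # R'" "(a = s) = True"
      "map (\<lambda>z. z = s) L' = map (\<lambda>z. z = s) L" "(b = s) = True"
      by (rule map_split_gap)
    then have f: "filter ?A x = P' @ s # L' @ s # R'" "map (\<lambda>z. z = s) L' = map (\<lambda>z. z = s) L" by simp_all
    obtain p m r where x: "x = p @ s # m @ s # r" "filter ?A m = L'" using filter_split_gap[OF f(1)] .
    have "s \<notin> set L" using L(2) E_irrefl by blast
    then have "True \<notin> set (map (\<lambda>z. z = s) L')" unfolding f(2) by auto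
    then have "s \<notin> set L'" by auto
    then have "s \<notin> set m" using x(2) by auto
    then have "2 \<le> length (filter (E s) m)" using gap_okD g x(1) by metis
    moreover have "length (filter (E s) m) = length (filter (E s) L')"
      unfolding x(2)[symmetric] by (auto intro!: arg_cong[of _ _ length] filter_cong)
    moreover have "length L' = length L" using f(2) by (metis length_map)
    ultimately show False using L(1) length_filter_le[of "E s" L'] by linarith
  qed
qed

lemma gap_ok_rev: "gap_ok E x \<Longrightarrow> gap_ok E (rev x)"
  unfolding gap_ok_def
proof (intro allI impI, elim conjE)
  fix p s m r assume a: "\<forall>p s m r. x = p @ s # m @ s # r \<and> s \<notin> set m \<longrightarrow> 2 \<le> length (filter (E s) m)"
    and x: "rev x = p @ s # m @ s # r" "s \<notin> set m"
  have "x = rev r @ s # rev m @ s # rev p" using arg_cong[OF x(1), of rev] by simp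
  then have "2 \<le> length (filter (E s) (rev m))"
    using a[rule_format, of "rev r" s "rev m" "rev p"] x(2) by simp
  then show "2 \<le> length (filter (E s) m)" by (simp add: rev_filter[symmetric])
qed

lemma FC_rev: "FC x \<Longrightarrow> FC (rev x)" using gap_ok_rev by (simp add: FC_iff_gap_ok)

lemma teq_rev: "x \<approx> y \<Longrightarrow> rev x \<approx> rev y"
  by (rule trace_eq_rev) (auto dest: ind_sym)

lemma tstep_rev: "tstep c x y \<Longrightarrow> tstep c (rev x) (rev y)"
proof -
  assume "tstep c x y"
  then obtain x' y' where *: "x \<approx> x'" "rstep c x' y'" "y' \<approx> y" unfolding tstep_def by blast
  have "rstep c (rev x') (rev y')" using *(2)
  proof cases
    case (loop p s r)
    then show ?thesis using rstep.loop[of "rev r" s "rev p"] by simp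
  next
    case (zigzag s t p r)
    then show ?thesis using rstep.zigzag[of s t "rev r" "rev p"] by simp
  qed
  then show ?thesis unfolding tstep_def using teq_rev * by blast
qed

lemma loops_rev: "loops (rev x) = loops x"
proof -
  have "reduces k x y \<Longrightarrow> reduces k (rev x) (rev y)" for k x y
    by (induction rule: reduces.induct)
      (auto intro: reduces.intros tstep_rev teq_rev)
  then have "loops (rev x) = loops x + loops (rev (nf x))" using reduces_loops reduces_nf by blast
  then show ?thesis using nf_FC[OF FC_rev[OF FC_nf]] by simp
qed

section \<open>Star reducibility\<close>

text \<open>
  A form of the condition \<open>x \<approx> s t \<dots>\<close> with \<open>s, t\<close> adjacent (see \<open>star_left_iff\<close>) that can be
  tested on prefixes of \<open>x\<close>.
\<close>
definition star_left :: "'a list \<Rightarrow> bool" where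
  "star_left x \<longleftrightarrow> (\<exists>s t p m r. x = p @ s # m @ t # r \<and> E s t \<and> (\<forall>z\<in>set p. ind s z) \<and>
    (\<forall>z\<in>set (p @ m). ind t z))"

definition commuting :: "'a list \<Rightarrow> bool" where
  "commuting x \<longleftrightarrow> distinct x \<and> (\<forall>a\<in>set x. \<forall>b\<in>set x. \<not> E a b)"

lemma teq_head:
  "trace_eq ind (s # y) x \<Longrightarrow> \<exists>p r. x = p @ s # r \<and> (\<forall>z\<in>set p. ind s z) \<and> y \<approx> p @ r"
proof (induction "s # y" x rule: trace_eq.induct)
  case refl
  then show ?case by (intro exI[of _ "[]"] exI[of _ y]) (simp add: trace_eq.refl)
next
  case (swap p' a b r')
  then obtain p r where *: "p' @ a # b # r' = p @ s # r" "\<forall>z\<in>set p. ind s z" "y \<approx> p @ r" by auto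
  from append_eq_split[of p s r p' "a # b # r'"] *(1)
  consider w where "p' = p @ s # w" "r = w @ a # b # r'" | w where "p = p' @ w" "a # b # r' = w @ s # r"
    by auto
  then show ?case
  proof cases
    case 1
    have "y \<approx> (p @ w) @ b # a # r'" using trace_eq.swap[of ind y "p @ w" a b r'] * 1 swap.hyps by simp
    then show ?thesis using * 1 by (intro exI[of _ p] exI[of _ "w @ b # a # r'"]) simp
  next
    case 2
    show ?thesis
    proof (cases w)
      case Nil
      then show ?thesis using * 2 swap.hyps by (intro exI[of _ "p @ [b]"] exI[of _ "r'"]) auto
    next
      case w: (Cons w1 w')
      show ?thesis
      proof (cases w')
        case Nil
        then show ?thesis using * 2 w swap.hyps by (intro exI[of _ "p'"] exI[of _ "a # r'"]) auto
      next
        case (Cons w2 w'')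
        have "y \<approx> p' @ b # a # w'' @ r"
          using trace_eq.swap[of ind y p' a b "w'' @ r"] * 2 w Cons swap.hyps by simp
        then show ?thesis using * 2 w Cons by (intro exI[of _ "p' @ b # a # w''"] exI[of _ r]) auto
      qed
    qed
  qed
qed

lemma star_left_iff: "star_left x \<longleftrightarrow> (\<exists>s t y. E s t \<and> x \<approx> s # t # y)"
proof
  assume "star_left x"
  then obtain s t p m r where x: "x = p @ s # m @ t # r" "E s t" "\<forall>z\<in>set p. ind s z"
    "\<forall>z\<in>set (p @ m). ind t z" unfolding star_left_def by blast
  have "[] @ [s] @ p @ (m @ t # r) \<approx> [] @ p @ [s] @ (m @ t # r)"
    by (rule trace_eq_move_back) (use x in auto)
  moreover have "[s] @ [t] @ (p @ m) @ r \<approx> [s] @ (p @ m) @ [t] @ r"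
    by (rule trace_eq_move_back) (use x in auto)
  ultimately have "s # t # p @ m @ r \<approx> x" using teq_trans[of "s # t # p @ m @ r"] x by simp
  then show "\<exists>s t y. E s t \<and> x \<approx> s # t # y" using teq_sym x(2) by blast
next
  assume "\<exists>s t y. E s t \<and> x \<approx> s # t # y"
  then obtain s t y where e: "E s t" "s # t # y \<approx> x" using teq_sym by blast
  obtain p r where 1: "x = p @ s # r" "\<forall>z\<in>set p. ind s z" "t # y \<approx> p @ r" using teq_head[OF e(2)] by blast
  obtain p2 r2 where 2: "p @ r = p2 @ t # r2" "\<forall>z\<in>set p2. ind t z" using teq_head[OF 1(3)] by blast
  have "t \<notin> set p" using 1(2) e(1) by (auto simp: ind_def)
  then obtain m where "p2 = p @ m" "r = m @ t # r2" using append_eq_split[of p2 t r2 p r] 2(1) by auto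
  then show "star_left x" unfolding star_left_def using 1 2 e(1) by blast
qed

lemma star_left_teq: "x \<approx> y \<Longrightarrow> star_left x \<longleftrightarrow> star_left y"
  unfolding star_left_iff using teq_trans teq_sym by blast

text \<open>
  The witness \<open>t\<close> is the first occurrence of its letter in the word, and so it lies in \<open>a\<close>.
\<close>
lemma star_left_prefix:
  assumes "star_left (a @ b)" "set b \<subseteq> set a"
  shows "star_left a"
proof -
  obtain s t p m r where x: "p @ s # m @ t # r = a @ b" "E s t" "\<forall>z\<in>set p. ind s z"
    "\<forall>z\<in>set (p @ m). ind t z" using assms(1) unfolding star_left_def by metis
  have t: "t \<notin> set (p @ s # m)" using x E_irrefl by (auto simp: ind_def)
  from append_eq_split[of "p @ s # m" t r a b] x(1)
  consider w where "a = (p @ s # m) @ t # w" | w where "p @ s # m = a @ w" "b = w @ t # r" by auto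
  then show ?thesis
  proof cases
    case 1
    then show ?thesis unfolding star_left_def using x
      by (intro exI[of _ s] exI[of _ t] exI[of _ p] exI[of _ m] exI[of _ w]) simp
  next
    case 2
    then have "t \<in> set a" using assms(2) by auto
    then show ?thesis using 2(1) t by (metis Un_iff set_append)
  qed
qed

lemma commuting_rev: "commuting f \<Longrightarrow> rev f \<approx> f"
proof (induction f)
  case (Cons a f)
  have "rev f @ [a] \<approx> f @ [a]"
    using trace_eq_append[OF Cons.IH trace_eq.refl] Cons.prems by (auto simp: commuting_def)
  moreover have "[] @ [a] @ f @ [] \<approx> [] @ f @ [a] @ []"
    by (rule trace_eq_move_back) (use Cons.prems in \<open>auto simp: commuting_def ind_def\<close>)
  ultimately show ?case using teq_trans[of "rev f @ [a]" "f @ [a]" "a # f"] teq_sym by auto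
qed (simp add: trace_eq.refl)

lemma commuting_teq: "x \<approx> y \<Longrightarrow> commuting x \<Longrightarrow> commuting y"
  unfolding commuting_def using trace_eq_set trace_eq_distinct by metis

lemma commuting_FC: "commuting x \<Longrightarrow> FC x"
  unfolding FC_iff_gap_ok gap_ok_def commuting_def by auto

text \<open>
  Let \<open>x \<approx> f y\<close> with a commuting prefix \<open>f\<close> of maximal length, and let \<open>z\<close> be \<open>y\<close> reversed, followed by \<open>f\<close> and \<open>y\<close>.
  As \<open>f\<close> is its own reversal up to commutation, both halves \<open>f y\<close> and \<open>rev y f\<close> are irreducible, so a
  small gap of \<open>z\<close> would have to extend across \<open>f\<close>.  By symmetry it has the form \<open>rev w f w\<close>, and being small
  it has no neighbour of \<open>s\<close> in \<open>w\<close> and at most one in \<open>f\<close>.  If there is none in \<open>f\<close>, then \<open>s\<close> can be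
  joined to \<open>f\<close>, against maximality.  If there is one, \<open>t\<close>, then \<open>f y\<close> is equivalent to a word
  \<open>t s \<dots>\<close>, against the assumption on \<open>x\<close>.
\<close>
lemma irreducible_extension:
  assumes FC: "FC x" and l: "\<not> star_left x" and r: "\<not> star_left (rev x)" and nc: "\<not> commuting x"
  obtains z where "FC z" "\<not> star_left z" "\<not> star_left (rev z)" "\<not> commuting z"
    "length x < length z" "set z = set x"
proof -
  \<comment> \<open>possible lengths of commuting prefixes of \<open>x\<close>\<close>
  let ?Q = "\<lambda>k. \<exists>f y. f @ y \<approx> x \<and> commuting f \<and> length f = k"
  have q0: "?Q 0" using trace_eq.refl[of ind x] by (intro exI[of _ "[]"] exI[of _ x]) (auto simp: commuting_def)
  have "\<forall>k. ?Q k \<longrightarrow> k \<le> length x" by (auto dest: trace_eq_length)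
  then obtain k where k: "?Q k" "\<forall>k'. ?Q k' \<longrightarrow> k' \<le> k"
    using Nat.ex_has_greatest_nat[of ?Q 0 "length x", OF q0] by auto
  then obtain f y where fy: "f @ y \<approx> x" "commuting f" "length f = k" by blast
  have max: "\<not> (commuting (f @ [s]) \<and> (f @ [s]) @ w \<approx> x)" for s w using k(2) fy(3) by fastforce
  let ?z = "rev y @ f @ y"
  have FCfy: "FC (f @ y)" using FC FC_teq fy(1) teq_sym by blast
  have revf: "rev f \<approx> f" by (rule commuting_rev[OF fy(2)])
  have rfy: "rev (f @ y) \<approx> rev y @ f" using trace_eq_append[OF trace_eq.refl revf] by auto
  have FCyf: "FC (rev y @ f)" using FC_teq[OF rfy FC_rev[OF FCfy]] .
  have lfy: "\<not> star_left (f @ y)" using l star_left_teq fy(1) by blast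
  have lyf: "\<not> star_left (rev y @ f)"
    using r star_left_teq[OF rfy] star_left_teq[OF teq_rev[OF fy(1)]] by blast
  have "y \<noteq> []" using nc fy commuting_teq by auto
  have "gap_ok E ?z" unfolding gap_ok_def
  proof (intro allI impI, elim conjE)
    fix p s m r assume z: "?z = p @ s # m @ s # r" and s: "s \<notin> set m"
    from append_eq_split[of "p @ s # m" s r "rev y @ f" y] z
    consider w where "rev y @ f = (p @ s # m) @ s # w" | w where "p @ s # m = rev y @ f @ w" "y = w @ s # r"
      by auto
    then show "2 \<le> length (filter (E s) m)"
    proof cases
      case 1
      then show ?thesis using FCyf s gap_okD[of E p s m w] by (simp add: FC_iff_gap_ok)
    next
      case 2
      from append_eq_split[of p s m "rev y" "f @ w"] 2(1)
      consider u where "rev y = p @ s # u" "m = u @ f @ w" | u where "p = rev y @ u" "f @ w = u @ s # m" by auto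
      then show ?thesis
      proof cases
        case u: 2
        then have "f @ y = u @ s # m @ s # r" using 2(2) by (metis append.assoc append_Cons)
        then show ?thesis using FCfy s gap_okD[of E u s m r] by (simp add: FC_iff_gap_ok)
      next
        case u: 1
        have "y = rev u @ s # rev p" using arg_cong[OF u(1), of rev] by simp
        \<comment> \<open>the first \<open>s\<close> in \<open>y\<close> is the mirror image of the last one in \<open>rev y\<close>\<close>
        then have w: "w = rev u" using first_split[of w s r "rev u" "rev p"] 2(2) s u(2) by simp
        let ?n = "\<lambda>x. length (filter (E s) x)"
        have n: "?n m = ?n w + ?n f + ?n w" using u(2) w by (simp add: rev_filter[symmetric])
        show ?thesis
        proof (rule ccontr)
          assume "\<not> ?thesis"
          then have nw: "?n w = 0" and nf: "?n f \<le> 1" using n by linarith+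
          then have iw: "\<And>a. a \<in> set w \<Longrightarrow> ind s a" using s u(2) by (auto simp: ind_def filter_empty_conv)
          show False
          proof (cases "filter (E s) f")
            case Nil
            then have "commuting (f @ [s])" using fy(2) s u(2) E_sym E_irrefl
              by (auto simp: commuting_def filter_empty_conv)
            moreover have "f @ [s] @ w @ r \<approx> f @ w @ [s] @ r"
              by (rule trace_eq_move_back) (use iw in auto)
            then have "(f @ [s]) @ (w @ r) \<approx> x" using teq_trans[OF _ fy(1)] 2(2) by simp
            ultimately show False using max by blast
          next
            case (Cons t L)
            then have L: "filter (E s) f = [t]" using nf by (cases L) auto
            then obtain f1 f2 where f: "f = f1 @ t # f2" "\<forall>z\<in>set f1. \<not> E s z" "E s t" "filter (E s) f2 = []"
              by (rule filter_eq_singletonD)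
            have "star_left (f @ y)" unfolding star_left_def
            proof (intro exI conjI)
              show "f @ y = f1 @ t # (f2 @ w) @ s # r" using f 2(2) by simp
              show "E t s" using f E_sym by blast
              show "\<forall>z\<in>set f1. ind t z" using fy(2) f(1) by (auto simp: commuting_def ind_def)
              show "\<forall>z\<in>set (f1 @ f2 @ w). ind s z"
                using f iw s u(2) by (auto simp: ind_def filter_empty_conv)
            qed
            then show False using lfy by blast
          qed
        qed
      qed
    qed
  qed
  then have 1: "FC ?z" by (simp add: FC_iff_gap_ok)
  have 2: "\<not> star_left ?z" using star_left_prefix[of "rev y @ f" y] lyf by auto
  have "rev ?z \<approx> ?z" using trace_eq_context[OF revf, of "rev y" y] by simp
  then have 3: "\<not> star_left (rev ?z)" using 2 star_left_teq by blast
  have len: "length x < length ?z" and set: "set ?z = set x"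
    using trace_eq_length[OF fy(1)] trace_eq_set[OF fy(1)] \<open>y \<noteq> []\<close> by auto
  have 4: "\<not> commuting ?z" using \<open>y \<noteq> []\<close> by (cases y) (auto simp: commuting_def)
  show ?thesis using that[OF 1 2 3 4 len set] .
qed

text \<open>
  If the lengths of irreducible words are bounded, the extension cannot be repeated for ever.
\<close>
lemma star_reducible:
  assumes bound: "\<And>y. FC y \<Longrightarrow> set y \<subseteq> N \<Longrightarrow> length y \<le> C"
  shows "FC x \<Longrightarrow> set x \<subseteq> N \<Longrightarrow> \<not> commuting x \<Longrightarrow> star_left x \<or> star_left (rev x)"
proof (induction "C - length x" arbitrary: x rule: less_induct)
  case less
  show ?case
  proof (rule ccontr)
    assume "\<not> ?thesis"
    then obtain z where z: "FC z" "\<not> star_left z" "\<not> star_left (rev z)" "\<not> commuting z"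
      "length x < length z" "set z = set x" using irreducible_extension[OF less.prems(1)] less.prems(3) by blast
    then have "C - length z < C - length x" using bound[of z] less.prems(2) by auto
    then show False using less.hyps[OF _ z(1)] z less.prems(2) by auto
  qed
qed

section \<open>Cancellation estimate\<close>

lemma subseqs_append: "set (subseqs (x @ y)) = {I @ J |I J. I \<in> set (subseqs x) \<and> J \<in> set (subseqs y)}"
proof (induction x)
  case (Cons a x)
  have "set (subseqs ((a # x) @ y)) = (#) a ` set (subseqs (x @ y)) \<union> set (subseqs (x @ y))"
    by (simp add: Let_def)
  also have "\<dots> = {I @ J |I J. I \<in> (#) a ` set (subseqs x) \<union> set (subseqs x) \<and> J \<in> set (subseqs y)}"
    unfolding Cons.IH by (auto simp: image_iff) (metis append_Cons)+
  finally show ?case by (simp add: Let_def)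
qed simp

lemma subseqs_rev: "set (subseqs (rev x)) = rev ` set (subseqs x)"
proof (induction x)
  case (Cons a x)
  have "set (subseqs (rev (a # x))) = {I @ J |I J. I \<in> rev ` set (subseqs x) \<and> J \<in> {[a], []}}"
    by (simp add: subseqs_append Cons.IH)
  also have "\<dots> = (\<lambda>I. rev I @ [a]) ` set (subseqs x) \<union> rev ` set (subseqs x)" by auto
  also have "\<dots> = rev ` set (subseqs (a # x))" by (simp add: Let_def image_Un image_image)
  finally show ?case .
qed simp

lemma subseqs_full: "I \<in> set (subseqs x) \<Longrightarrow> length x \<le> length I \<Longrightarrow> I = x"
  using subseqs_eq_Cons[of x] by (auto dest: leD)

lemma subseqs_teq: "x \<approx> y \<Longrightarrow> I \<in> set (subseqs y) \<Longrightarrow> \<exists>J\<in>set (subseqs x). J \<approx> I"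
proof (induction arbitrary: I rule: trace_eq.induct)
  case (refl x)
  then show ?case using trace_eq.refl by blast
next
  case (swap x p a b r)
  have "\<exists>K\<in>set (subseqs (p @ a # b # r)). K \<approx> I"
  proof -
    obtain I1 I2 I3 where I: "I = I1 @ I2 @ I3" "I1 \<in> set (subseqs p)" "I2 \<in> set (subseqs [b, a])" "I3 \<in> set (subseqs r)"
      using swap.prems subseqs_append[of p "[b, a] @ r"] subseqs_append[of "[b, a]" r] by auto
    have "\<exists>K2\<in>set (subseqs [a, b]). K2 \<approx> I2"
      using I(3) trace_eq_swapI[of ind a b "[]" "[]"] swap.hyps(2) trace_eq.refl[of ind "[]"]
        trace_eq.refl[of ind "[a]"] trace_eq.refl[of ind "[b]"] by (auto simp: Let_def)
    then obtain K2 where K: "K2 \<in> set (subseqs [a, b])" "K2 \<approx> I2" by blast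
    have "I1 @ K2 @ I3 \<in> set (subseqs (p @ [a, b] @ r))"
      unfolding subseqs_append using I K by blast
    then show ?thesis using trace_eq_context[OF K(2), of I1 I3] I(1) by auto
  qed
  then show ?case using swap.IH teq_trans by blast
qed

lemma set_subseqs_subset: "I \<in> set (subseqs x) \<Longrightarrow> set I \<subseteq> set x"
  using subseqs_powset[of x] by blast

text \<open>
  Each deleted letter contributes a factor \<open>v\<^sup>-\<^sup>1\<close> and each loop a factor \<open>\<delta>\<close> of degree 1 in \<open>v\<close>, so that tightness
  says that the subword contributes with a negative power of \<open>v\<close>.
\<close>
definition tight :: "'a list \<Rightarrow> bool" where
  "tight x \<longleftrightarrow> (\<forall>I\<in>set (subseqs x). length I < length x \<longrightarrow> loops I + length I < length x)"

lemma tight_teq: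
  assumes "x \<approx> y" "tight x" shows "tight y"
  unfolding tight_def
proof (intro ballI impI)
  fix I assume I: "I \<in> set (subseqs y)" "length I < length y"
  obtain J where "J \<in> set (subseqs x)" "J \<approx> I" using subseqs_teq[OF assms(1) I(1)] by blast
  then show "loops I + length I < length y"
    using assms(2) I(2) loops_teq[of J I] trace_eq_length[of ind J I] trace_eq_length[OF assms(1)]
    unfolding tight_def by fastforce
qed

lemma tight_rev: "tight (rev x) \<Longrightarrow> tight x"
  unfolding tight_def
proof (intro ballI impI)
  fix I assume a: "\<forall>I\<in>set (subseqs (rev x)). length I < length (rev x) \<longrightarrow> loops I + length I < length (rev x)"
    and I: "I \<in> set (subseqs x)" "length I < length x"
  have "rev I \<in> set (subseqs (rev x))" using I(1) by (simp add: subseqs_rev)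
  then show "loops I + length I < length x" using a I(2) loops_rev[of I] by fastforce
qed

text \<open>
  If \<open>s y\<close> is reducible, the first letter takes part in the reduction.  If it meets an equal letter, one
  loop arises and the rest is \<open>y\<close>.  If it forms \<open>s t s\<close> with two letters of \<open>y\<close>, what remains is \<open>y\<close>
  without the letter \<open>t\<close>, and by tightness a subword missing a single letter contains no loop.
\<close>
lemma loops_Cons_tight:
  assumes FC: "FC y" and t: "tight y"
  shows "loops (s # y) \<le> 1" "(\<nexists>z. y \<approx> s # z) \<Longrightarrow> loops (s # y) = 0"
proof -
  have "loops (s # y) = 0 \<or> (loops (s # y) = 1 \<and> (\<exists>z. y \<approx> s # z))"
  proof (cases "FC (s # y)")
    case True
    then show ?thesis using nf_FC by blast
  next
    case False
    then obtain p a m r where g: "s # y = p @ a # m @ a # r" "a \<notin> set m" "\<not> 2 \<le> length (filter (E a) m)"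
      unfolding FC_iff_gap_ok gap_ok_def by blast
    have "p = []"
    proof (cases p)
      case (Cons b p')
      then have "y = p' @ a # m @ a # r" using g(1) by simp
      then show ?thesis using gap_okD[of E p' a m r] FC g by (simp add: FC_iff_gap_ok)
    qed simp
    then have y: "y = m @ s # r" and a: "a = s" using g(1) by auto
    show ?thesis
    proof (cases "filter (E s) m")
      case Nil
      then have *: "[] @ [s] @ m @ r \<approx> [] @ m @ [s] @ r"
        by (intro trace_eq_move_back) (use g a in \<open>auto simp: ind_def filter_empty_conv\<close>)
      then have y': "s # m @ r \<approx> y" using y by simp
      have "loops (s # y) = loops ([] @ [s, s] @ (m @ r))"
        using loops_teq[OF trace_eq_Cons[OF y']] by simp
      also have "\<dots> = Suc (loops (s # m @ r))" by (simp add: loops_loop[of "[]", simplified])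
      also have "loops (s # m @ r) = 0" using loops_teq[OF y'] nf_FC[OF FC] by simp
      finally show ?thesis using teq_sym[OF y'] by auto
    next
      case (Cons t L)
      then have "filter (E s) m = [t]" using g(3) a by (cases L) auto
      then obtain m1 m2 where m: "m = m1 @ t # m2" "\<forall>z\<in>set m1. \<not> E s z" "E s t" "filter (E s) m2 = []"
        by (rule filter_eq_singletonD)
      have i: "\<And>z. z \<in> set m1 \<union> set m2 \<Longrightarrow> ind s z" using m g a by (auto simp: ind_def filter_empty_conv)
      have "[] @ [s] @ m1 @ (t # m2 @ s # r) \<approx> [] @ m1 @ [s] @ (t # m2 @ s # r)"
        by (rule trace_eq_move_back) (use i in auto)
      moreover have 2: "(m1 @ [s, t]) @ [s] @ m2 @ r \<approx> (m1 @ [s, t]) @ m2 @ [s] @ r"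
        by (rule trace_eq_move_back) (use i in auto)
      ultimately have "s # y \<approx> m1 @ [s, t, s] @ (m2 @ r)"
        using teq_trans[OF _ teq_sym[OF 2], of "s # y"] y m by simp
      then have "loops (s # y) = loops (m1 @ [s] @ m2 @ r)"
        using loops_teq loops_zigzag[OF m(3), of m1 "m2 @ r"] by auto
      also have "\<dots> = loops (m1 @ m2 @ [s] @ r)"
        using loops_teq[OF trace_eq_move_back[of m2 ind s m1 r]] i by blast
      also have "\<dots> = 0"
      proof -
        have "[] \<in> set (subseqs [t])" by simp
        then have "m1 @ [] @ m2 @ [s] @ r \<in> set (subseqs (m1 @ [t] @ m2 @ [s] @ r))"
          unfolding subseqs_append using subseqs_refl by blast
        then have "m1 @ m2 @ [s] @ r \<in> set (subseqs y)" using y m(1) by simp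
        from bspec[OF t[unfolded tight_def] this] show ?thesis using y m(1) by simp
      qed
      finally show ?thesis by simp
    qed
  qed
  then show "loops (s # y) \<le> 1" "(\<nexists>z. y \<approx> s # z) \<Longrightarrow> loops (s # y) = 0" by auto
qed

lemma reduces_set: "reduces k x y \<Longrightarrow> set y \<subseteq> set x"
proof (induction rule: reduces.induct)
  case (more c x y k z)
  then show ?case unfolding tstep_def by (auto elim!: rstep.cases dest!: trace_eq_set)
qed (auto dest: trace_eq_set)

lemma set_nf: "set (nf x) \<subseteq> set x"
  using reduces_set[OF reduces_nf] .

text \<open>
  The induction step, by the choice that a subword \<open>I\<close> of \<open>s t u\<close> makes for its first two letters.  If
  \<open>s\<close> is deleted, \<open>I\<close> is a subword of \<open>t u\<close>.  If \<open>I = s t K\<close>, then multiplication by \<open>t\<close>, which cannot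
  decrease the number of loops, turns \<open>I\<close> into \<open>t s t K\<close>, which reduces to \<open>t K\<close>.  If \<open>I = s K\<close>, the letter \<open>s\<close>
  adds at most one loop to those of \<open>K\<close>, paid for by the deleted \<open>t\<close>; the boundary case \<open>K = u\<close> needs
  that \<open>u\<close> does not start with \<open>s\<close>, which holds because \<open>s t s\<close> is reducible.
\<close>
lemma tight_star_left:
  assumes x: "x = s # t # u" "E s t" "FC x" "set x \<subseteq> N"
    and IH: "\<And>y. length y < length x \<Longrightarrow> FC y \<Longrightarrow> set y \<subseteq> N \<Longrightarrow> tight y"
  shows "tight x"
  unfolding tight_def
proof (intro ballI impI)
  fix I assume I: "I \<in> set (subseqs x)" "length I < length x"
  have FCu: "FC (t # u)" "FC u" using FC_factor[of "[s]" "t # u" "[]"] FC_factor[of "[s, t]" u "[]"] x by auto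
  have tu: "tight (t # u)" "tight u" using IH FCu x by auto
  consider "I \<in> set (subseqs (t # u))" | K where "I = s # t # K" "K \<in> set (subseqs u)"
    | K where "I = s # K" "K \<in> set (subseqs u)"
    using I(1) x(1) by (auto simp: Let_def)
  then show "loops I + length I < length x"
  proof cases
    case 1
    show ?thesis
    proof (cases "length I < length (t # u)")
      case True
      then show ?thesis using tu(1) 1 x(1) unfolding tight_def by fastforce
    next
      case False
      then have "I = t # u" using subseqs_full[OF 1] by simp
      then show ?thesis using nf_FC[OF FCu(1)] x(1) by simp
    qed
  next
    case 2
    have "t # K \<in> set (subseqs (t # u))" "length (t # K) < length (t # u)" using 2 I(2) x(1) by (auto simp: Let_def)
    then have "loops (t # K) + length (t # K) < length (t # u)" using tu(1) unfolding tight_def by blast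
    moreover have "loops I \<le> loops (t # K)"
      using loops_zigzag[OF E_sym[OF x(2)], of "[]" K] nf_context[of "[t]" I "[]"] 2(1) by simp
    ultimately show ?thesis using 2(1) x(1) by simp
  next
    case 3
    show ?thesis
    proof (cases "length K < length u")
      case True
      then have 1: "loops K + length K < length u" using tu(2) 3(2) unfolding tight_def by blast
      have "tight (nf K)"
      proof (rule IH[OF _ FC_nf])
        show "length (nf K) < length x" using nf_length[of K] 1 x(1) by simp
        show "set (nf K) \<subseteq> N" using set_nf[of K] set_subseqs_subset[OF 3(2)] x by auto
      qed
      then have "loops (s # nf K) \<le> 1" using loops_Cons_tight(1)[OF FC_nf] by blast
      then have "loops I \<le> loops K + 1" using nf_context[of "[s]" K "[]"] 3(1) by simp
      then show ?thesis using 1 3(1) x(1) by simp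
    next
      case False
      then have K: "K = u" using subseqs_full[OF 3(2)] by simp
      have "\<nexists>z. u \<approx> s # z"
      proof (rule notI, elim exE)
        fix z assume "u \<approx> s # z"
        then have "x \<approx> s # t # s # z" using x(1) trace_eq_context[of ind u "s # z" "[s, t]" "[]"] by simp
        then have "FC ([] @ [s, t, s] @ z)" using FC_teq x(3) by simp
        then show False using rstep_tstep[OF rstep.zigzag[OF x(2)]] unfolding FC_def by blast
      qed
      then have "loops I = 0" using loops_Cons_tight(2)[OF FCu(2) tu(2)] 3(1) K by simp
      then show ?thesis using 3(1) K x(1) by simp
    qed
  qed
qed

text \<open>
  Reversal respects tightness, so star reducibility on either side allows the induction to proceed; and
  in a word of distinct commuting letters no loop ever occurs.
\<close>
theorem FC_tight:
  assumes bound: "\<And>y. FC y \<Longrightarrow> set y \<subseteq> N \<Longrightarrow> length y \<le> C"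
  shows "FC x \<Longrightarrow> set x \<subseteq> N \<Longrightarrow> tight x"
proof (induction "length x" arbitrary: x rule: less_induct)
  case less
  have star: "tight y" if y: "star_left y" "FC y" "set y \<subseteq> N" "length y = length x" for y
  proof -
    obtain s t u where stu: "E s t" "y \<approx> s # t # u" using y(1) unfolding star_left_iff by blast
    have "tight (s # t # u)"
    proof (rule tight_star_left[OF HOL.refl stu(1), of u N])
      show "FC (s # t # u)" using FC_teq[OF stu(2) y(2)] .
      show "set (s # t # u) \<subseteq> N" using trace_eq_set[OF stu(2)] y(3) by simp
      show "\<And>z. length z < length (s # t # u) \<Longrightarrow> FC z \<Longrightarrow> set z \<subseteq> N \<Longrightarrow> tight z"
        using less.hyps trace_eq_length[OF stu(2)] y(4) by simp
    qed
    then show ?thesis using tight_teq[OF teq_sym[OF stu(2)]] by blast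
  qed
  show ?case
  proof (cases "commuting x")
    case True
    have "loops I = 0" if "I \<in> set (subseqs x)" for I
    proof -
      have "commuting I" using True set_subseqs_subset[OF that] subseqs_distinctD[OF that]
        unfolding commuting_def by blast
      then show ?thesis using nf_FC commuting_FC by blast
    qed
    then show ?thesis unfolding tight_def by simp
  next
    case False
    then consider "star_left x" | "star_left (rev x)"
      using star_reducible[OF bound less.prems] by blast
    then show ?thesis
    proof cases
      case 1
      then show ?thesis using star less.prems by blast
    next
      case 2
      then show ?thesis using star[OF 2 FC_rev[OF less.prems(1)]] less.prems(2) tight_rev by simp
    qed
  qed
qed

end

section \<open>Bounded length of irreducible words over graphs of type E\<close>

text \<open>
  The graph \<open>E\<^sub>n\<close> for all \<open>n\<close> at once: a line \<open>1, 2, 3, \<dots>\<close> and a node \<open>0\<close> joined to the branch node 3.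
\<close>
abbreviation fork :: "nat \<Rightarrow> nat \<Rightarrow> bool" where
  "fork i j \<equiv> line_adj i j \<or> (i = 0 \<and> j = 3) \<or> (i = 3 \<and> j = 0)"

text \<open>
  This condition is to hold for all factors that avoid \<open>i\<close>, also at the ends of the word, whereas
  \<open>one_between\<close> speaks of the gaps between two occurrences of \<open>i\<close> only.
\<close>
definition at_most_one_between :: "'b \<Rightarrow> 'b \<Rightarrow> 'b list \<Rightarrow> bool" where
  "at_most_one_between i j x \<longleftrightarrow> (\<forall>p m r. x = p @ m @ r \<and> i \<notin> set m \<longrightarrow> count_list m j \<le> 1)"

definition one_between :: "'b \<Rightarrow> 'b \<Rightarrow> 'b list \<Rightarrow> bool" where
  "one_between i j x \<longleftrightarrow> (\<forall>p m r. x = p @ i # m @ i # r \<and> i \<notin> set m \<longrightarrow> count_list m j = 1)"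

lemma at_most_one_betweenD: "at_most_one_between i j (p @ m @ r) \<Longrightarrow> i \<notin> set m \<Longrightarrow> count_list m j \<le> 1"
  unfolding at_most_one_between_def by blast

lemma at_most_one_between_factor: "at_most_one_between i j (p @ x @ r) \<Longrightarrow> at_most_one_between i j x"
  unfolding at_most_one_between_def
proof (intro allI impI, elim conjE)
  fix p' m r' assume a: "\<forall>p' m r'. p @ x @ r = p' @ m @ r' \<and> i \<notin> set m \<longrightarrow> count_list m j \<le> 1"
    and x: "x = p' @ m @ r'" "i \<notin> set m"
  show "count_list m j \<le> 1" using a[rule_format, of "p @ p'" m "r' @ r"] x by simp
qed

lemma consecutive_occurrences:
  assumes "2 \<le> count_list x j"
  obtains a m b where "x = a @ j # m @ j # b" "j \<notin> set m"
proof -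
  have "j \<in> set x" using assms by (metis count_notin not_numeral_le_zero)
  then obtain a y where 1: "x = a @ j # y" "j \<notin> set a" using split_list_first by metis
  then have "count_list y j \<noteq> 0" using assms by simp
  then have "j \<in> set y" using count_notin by metis
  then obtain m b where "y = m @ j # b" "j \<notin> set m" using split_list_first by metis
  then show ?thesis using that[of a m b] 1 by simp
qed

lemma length_filter_le_count2:
  assumes "\<And>z. P z \<Longrightarrow> z = a \<or> z = b"
  shows "length (filter P m) \<le> count_list m a + count_list m b"
proof (induction m)
  case (Cons z m)
  then show ?case using assms[of z] by (cases "P z") auto
qed simp

lemma length_filter_le_count3:
  assumes "\<And>z. P z \<Longrightarrow> z = a \<or> z = b \<or> z = c"
  shows "length (filter P m) \<le> count_list m a + count_list m b + count_list m c"
proof (induction m)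
  case (Cons z m)
  then show ?case using assms[of z] by (cases "P z") auto
qed simp

text \<open>
  The node \<open>j\<close> has no neighbours besides \<open>i\<close> and \<open>k\<close>.  So two consecutive occurrences of \<open>j\<close> without an \<open>i\<close> between
  them would have to be separated by two occurrences of \<open>k\<close>.  In this way sparsity spreads from the
  end of an arm towards the branch node.
\<close>
lemma at_most_one_between_step:
  assumes g: "gap_ok E x" and k: "at_most_one_between j k x" and E: "\<And>z. E j z \<Longrightarrow> z = i \<or> z = k"
  shows "at_most_one_between i j x"
  unfolding at_most_one_between_def
proof (intro allI impI, elim conjE, rule ccontr)
  fix p m r assume x: "x = p @ m @ r" "i \<notin> set m" and "\<not> count_list m j \<le> 1"
  then obtain a m' b where m: "m = a @ j # m' @ j # b" "j \<notin> set m'"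
    using consecutive_occurrences[of m j] by auto
  have "2 \<le> length (filter (E j) m')" using gap_okD[of E "p @ a" j m' "b @ r"] g x m by simp
  also have "\<dots> \<le> count_list m' i + count_list m' k" by (rule length_filter_le_count2[OF E])
  also have "count_list m' i = 0" using x(2) m(1) count_notin by fastforce
  finally show False
    using at_most_one_betweenD[of j k "p @ a @ [j]" m' "j # b @ r"] k x(1) m by simp
qed

lemma at_most_one_between_self: "at_most_one_between j j x"
  unfolding at_most_one_between_def by (auto simp: count_notin)

lemma count_le_parent: "at_most_one_between i j x \<Longrightarrow> count_list x j \<le> count_list x i + 1"
proof (induction "length x" arbitrary: x rule: less_induct)
  case less
  show ?case
  proof (cases "i \<in> set x")
    case False
    then show ?thesis using at_most_one_betweenD[of i j "[]" x "[]"] less.prems by simp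
  next
    case True
    then obtain m r where x: "x = m @ i # r" "i \<notin> set m" using split_list_first by metis
    have "count_list m j \<le> 1" using at_most_one_betweenD[of i j "[]" m "i # r"] less.prems x by simp
    moreover have "count_list r j \<le> count_list r i + 1"
      using less.hyps[of r] at_most_one_between_factor[of i j "m @ [i]" r "[]"] less.prems x(1) by simp
    moreover have "i = j \<Longrightarrow> ?thesis" by simp
    ultimately show ?thesis using x count_notin[OF x(2)] by (cases "i = j") auto
  qed
qed

lemma one_between_count: "one_between i j x \<Longrightarrow> count_list x i \<le> count_list x j + 1"
proof (induction "length x" arbitrary: x rule: less_induct)
  case less
  show ?case
  proof (cases "2 \<le> count_list x i")
    case True
    then obtain a m b where x: "x = a @ i # m @ i # b" "i \<notin> set m" using consecutive_occurrences by metis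
    have "i \<in> set x" using x by simp
    then obtain a' y where y: "x = a' @ i # y" "i \<notin> set a'" using split_list_first by metis
    have "i \<in> set y" using True y count_notin[of i y] by fastforce
    then obtain m' b' where z: "y = m' @ i # b'" "i \<notin> set m'" using split_list_first by metis
    have 1: "count_list m' j = 1" using less.prems y z unfolding one_between_def by blast
    have "one_between i j (i # b')" unfolding one_between_def
    proof (intro allI impI, elim conjE)
      fix p m r assume *: "i # b' = p @ i # m @ i # r" "i \<notin> set m"
      then show "count_list m j = 1"
        using less.prems[unfolded one_between_def, rule_format, of "a' @ i # m' @ p" m r] y z by simp
    qed
    then have "count_list (i # b') i \<le> count_list (i # b') j + 1"
      using less.hyps[of "i # b'"] y z by simp
    then show ?thesis using y z 1 count_notin by (cases "i = j") (auto simp: count_notin)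
  qed simp
qed

context
  fixes x :: "nat list" and n :: nat
  assumes g: "gap_ok fork x" and n: "4 \<le> n" and x: "set x \<subseteq> {..<n}"
begin

lemma arm_sparse: "3 \<le> i \<Longrightarrow> at_most_one_between i (Suc i) x"
proof (induction "n - i" arbitrary: i rule: less_induct)
  case less
  show ?case
  proof (cases "i < n")
    case True
    have "at_most_one_between (Suc i) (Suc (Suc i)) x" using less True by simp
    then show ?thesis
      by (rule at_most_one_between_step[OF g]) (use less.prems in \<open>auto simp: line_adj_def\<close>)
  next
    case False
    then have "Suc i \<notin> set x" using x by auto
    then show ?thesis unfolding at_most_one_between_def by (auto simp: count_notin)
  qed
qed

lemma short_arms_sparse:
  "at_most_one_between 2 (Suc 0) x" "at_most_one_between 3 2 x" "at_most_one_between 3 0 x"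
proof -
  show 1: "at_most_one_between 2 (Suc 0) x"
    by (rule at_most_one_between_step[OF g at_most_one_between_self]) (auto simp: line_adj_def)
  show "at_most_one_between 3 2 x"
    by (rule at_most_one_between_step[OF g 1]) (auto simp: line_adj_def)
  show "at_most_one_between 3 0 x"
    by (rule at_most_one_between_step[OF g at_most_one_between_self]) (auto simp: line_adj_def)
qed

text \<open>
  A gap of \<open>i + 1\<close> contains at most one \<open>i + 2\<close> by sparsity and at most one \<open>i\<close>, since two of them would enclose
  another \<open>i + 1\<close>.  It needs two neighbours of \<open>i + 1\<close>, so it contains exactly one of each.
\<close>
lemma arm_alternates:
  assumes "one_between 3 4 x" "3 \<le> i"
  shows "one_between i (Suc i) x"
  using assms(2)
proof (induction i rule: dec_induct)
  case base
  then show ?case using assms(1) by simp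
next
  case (step i)
  show ?case unfolding one_between_def
  proof (intro allI impI, elim conjE)
    fix p m r assume m: "x = p @ Suc i # m @ Suc i # r" "Suc i \<notin> set m"
    have "2 \<le> length (filter (fork (Suc i)) m)" by (rule gap_okD[OF g[unfolded m(1)] m(2)])
    also have "\<dots> \<le> count_list m i + count_list m (Suc (Suc i))"
      by (rule length_filter_le_count2) (use step.hyps in \<open>auto simp: line_adj_def\<close>)
    finally have 1: "2 \<le> count_list m i + count_list m (Suc (Suc i))" .
    have 2: "count_list m (Suc (Suc i)) \<le> 1"
      using at_most_one_betweenD[of "Suc i" "Suc (Suc i)" "p @ [Suc i]" m "Suc i # r"]
        arm_sparse[of "Suc i"] step.hyps m by simp
    have "count_list m i \<le> 1"
    proof (rule ccontr)
      assume "\<not> ?thesis"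
      then obtain a m' b where m': "m = a @ i # m' @ i # b" "i \<notin> set m'"
        using consecutive_occurrences[of m i] by auto
      have "count_list m' (Suc i) = 1"
        using step.IH[unfolded one_between_def, rule_format, of "p @ Suc i # a" m' "b @ Suc i # r"] m m' by simp
      then have "Suc i \<in> set m'" using count_notin by fastforce
      then show False using m m' by simp
    qed
    then show "count_list m (Suc (Suc i)) = 1" using 1 2 by simp
  qed
qed

text \<open>
  If occurrences of \<open>i\<close> and \<open>i + 1\<close> interlace along the whole arm, each step towards its end loses at
  most one occurrence, and beyond the end there is none left.
\<close>
lemma branch_count_alternating:
  assumes "one_between 3 4 x"
  shows "count_list x 3 \<le> n"
proof -
  have "n \<notin> set x" using x by auto
  have "count_list x (n - k) \<le> k" if "k \<le> n - 3" for k
    using that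
  proof (induction k)
    case 0
    then show ?case using \<open>n \<notin> set x\<close> by (simp add: count_notin)
  next
    case (Suc k)
    have "one_between (n - Suc k) (Suc (n - Suc k)) x" by (rule arm_alternates[OF assms]) (use Suc.prems n in simp)
    from one_between_count[OF this] show ?case using Suc by (simp add: Suc_diff_Suc)
  qed
  from this[of "n - 3"] show ?thesis using n by simp
qed

text \<open>
  A gap of the branch node contains each of its neighbours 0, 2, 4 at most once, and at least two of them.
  Suppose that 4 does not occur in the middle one of three successive gaps, so that 0 and 2 do.
  The outer gaps then lack 0: two occurrences of 0 must be separated by two occurrences of 3.  So
  all three gaps contain 2.  Between successive occurrences of 2 there is a single 3, hence also a 1; and
  these two occurrences of 1 are separated by a single 2, which is too few.
\<close>
lemma branch_gap:
  assumes y: "x = A @ 3 # m1 @ 3 # m2 @ 3 # m3 @ 3 # B" and m: "3 \<notin> set m1" "3 \<notin> set m2" "3 \<notin> set m3"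
  shows "count_list m2 4 = 1"
proof (rule ccontr)
  assume ne: "count_list m2 4 \<noteq> 1"
  have fac: "x = (A @ [3]) @ m1 @ (3 # m2 @ 3 # m3 @ 3 # B)" "x = (A @ 3 # m1 @ [3]) @ m2 @ (3 # m3 @ 3 # B)"
    "x = (A @ 3 # m1 @ 3 # m2 @ [3]) @ m3 @ (3 # B)" using y by simp_all
  have le1: "count_list m1 j \<le> 1" "count_list m2 j \<le> 1" "count_list m3 j \<le> 1" if "j \<in> {0, 2, 4}" for j
  proof -
    have "at_most_one_between 3 j x" using that short_arms_sparse arm_sparse[of 3] by auto
    then show "count_list m1 j \<le> 1" "count_list m2 j \<le> 1" "count_list m3 j \<le> 1"
      using at_most_one_betweenD m fac by metis+
  qed
  have ge2: "2 \<le> count_list w 0 + count_list w 2 + count_list w 4" if w: "x = p @ 3 # w @ 3 # r" "3 \<notin> set w" for p w r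
  proof -
    have "2 \<le> length (filter (fork 3) w)" by (rule gap_okD[OF g[unfolded w(1)] w(2)])
    also have "\<dots> \<le> count_list w 0 + count_list w 2 + count_list w 4"
      by (rule length_filter_le_count3) (auto simp: line_adj_def)
    finally show ?thesis .
  qed
  have n1: "2 \<le> count_list m1 0 + count_list m1 2 + count_list m1 4" by (rule ge2) (use y m in auto)
  have n2: "2 \<le> count_list m2 0 + count_list m2 2 + count_list m2 4"
    by (rule ge2[of "A @ 3 # m1"]) (use y m in auto)
  have n3: "2 \<le> count_list m3 0 + count_list m3 2 + count_list m3 4"
    by (rule ge2[of "A @ 3 # m1 @ 3 # m2"]) (use y m in auto)
  have c2: "count_list m2 0 = 1" "count_list m2 2 = 1" using n2 le1[of 0] le1[of 2] le1[of 4] ne by auto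
  have mem: "j \<in> set w" if "count_list w j = 1" for j w using that by (metis count_notin zero_neq_one)
  \<comment> \<open>the nearest occurrences of 0 in successive gaps are separated by a single neighbour of 0, the node 3 between them\<close>
  have no0: False if y0: "x = p @ 3 # w @ 3 # w' @ 3 # r" "3 \<notin> set w" "3 \<notin> set w'" "0 \<in> set w" "0 \<in> set w'" for p w w' r
  proof -
    obtain a b where w: "w = a @ 0 # b" "0 \<notin> set b" using split_list_last[OF y0(4)] by metis
    obtain a' b' where w': "w' = a' @ 0 # b'" "0 \<notin> set a'" using split_list_first[OF y0(5)] by metis
    have "2 \<le> length (filter (fork 0) (b @ 3 # a'))"
      using gap_okD[of fork "p @ 3 # a" 0 "b @ 3 # a'" "b' @ 3 # r"] g y0 w w' by simp
    also have "\<dots> \<le> count_list (b @ 3 # a') 3 + count_list (b @ 3 # a') 0"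
      by (rule length_filter_le_count2) (auto simp: line_adj_def)
    finally show False using w w' y0 by (simp add: count_notin)
  qed
  have "0 \<notin> set m1" using no0[of A m1 m2 "m3 @ 3 # B"] y m mem[OF c2(1)] by auto
  moreover have "0 \<notin> set m3" using no0[of "A @ 3 # m1" m2 m3 B] y m mem[OF c2(1)] by auto
  ultimately have c13: "count_list m1 2 = 1" "count_list m3 2 = 1"
    using n1 n3 le1[of 2] le1[of 4] by (auto simp: count_notin)
  have two: "\<exists>a b. w = a @ 2 # b \<and> 2 \<notin> set a \<and> 2 \<notin> set b" if one: "count_list w 2 = 1" for w :: "nat list"
  proof -
    obtain a b where w: "w = a @ 2 # b" "2 \<notin> set a" using split_list_first[OF mem[OF one]] by metis
    then have "count_list b 2 = 0" using one by (simp add: count_notin)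
    then show ?thesis using w by (auto simp: count_list_0_iff)
  qed
  obtain a1 b1 where w1: "m1 = a1 @ 2 # b1" "2 \<notin> set a1" "2 \<notin> set b1" using two[OF c13(1)] by blast
  obtain a2 b2 where w2: "m2 = a2 @ 2 # b2" "2 \<notin> set a2" "2 \<notin> set b2" using two[OF c2(2)] by blast
  obtain a3 b3 where w3: "m3 = a3 @ 2 # b3" "2 \<notin> set a3" "2 \<notin> set b3" using two[OF c13(2)] by blast
  have has1: "1 \<in> set (b @ 3 # a)" if "x = p @ 2 # (b @ 3 # a) @ 2 # r" "2 \<notin> set b" "2 \<notin> set a" "3 \<notin> set b" "3 \<notin> set a" for p a b r
  proof -
    have "2 \<le> length (filter (fork 2) (b @ 3 # a))" using gap_okD[OF _ , of fork p 2 "b @ 3 # a" r] g that by simp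
    also have "\<dots> \<le> count_list (b @ 3 # a) 1 + count_list (b @ 3 # a) 3"
      by (rule length_filter_le_count2) (auto simp: line_adj_def)
    also have "count_list (b @ 3 # a) 3 = 1" using that by (simp add: count_notin)
    finally have "count_list (b @ 3 # a) 1 \<noteq> 0" by linarith
    then show ?thesis using count_notin by metis
  qed
  have 1: "1 \<in> set (b1 @ 3 # a2)"
    by (rule has1[of "A @ 3 # a1" b1 a2 "b2 @ 3 # m3 @ 3 # B"]) (use y m w1 w2 in auto)
  have 2: "1 \<in> set (b2 @ 3 # a3)"
    by (rule has1[of "A @ 3 # m1 @ 3 # a2" b2 a3 "b3 @ 3 # B"]) (use y m w2 w3 in auto)
  obtain c d where cd: "b1 @ 3 # a2 = c @ 1 # d" "1 \<notin> set d" using split_list_last[OF 1] by metis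
  obtain c' d' where cd': "b2 @ 3 # a3 = c' @ 1 # d'" "1 \<notin> set c'" using split_list_first[OF 2] by metis
  have "x = A @ 3 # a1 @ 2 # (b1 @ 3 # a2) @ 2 # (b2 @ 3 # a3) @ 2 # b3 @ 3 # B" using y w1 w2 w3 by simp
  then have "x = (A @ 3 # a1 @ 2 # c) @ 1 # (d @ 2 # c') @ 1 # d' @ 2 # b3 @ 3 # B" unfolding cd cd' by simp
  then have "2 \<le> length (filter (fork 1) (d @ 2 # c'))" using gap_okD[of fork "A @ 3 # a1 @ 2 # c" 1 "d @ 2 # c'" "d' @ 2 # b3 @ 3 # B"] g cd cd' by simp
  also have "\<dots> \<le> count_list (d @ 2 # c') 2 + count_list (d @ 2 # c') 1"
    by (rule length_filter_le_count2) (auto simp: line_adj_def)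
  also have "count_list (d @ 2 # c') 1 = 0" using cd cd' by (simp add: count_notin)
  also have "count_list (d @ 2 # c') 2 = 1"
  proof -
    have "2 \<notin> set (b1 @ 3 # a2)" "2 \<notin> set (b2 @ 3 # a3)" using w1 w2 w3 by auto
    then have "2 \<notin> set d" "2 \<notin> set c'" unfolding cd cd' by auto
    then show ?thesis by (simp add: count_notin)
  qed
  finally show False by simp
qed

end

text \<open>
  Lemma \<open>branch_gap\<close> applies to all gaps but the first and the last, which accounts for the summand 2.
\<close>
lemma branch_count:
  assumes g: "gap_ok fork x" and n: "4 \<le> n" and x: "set x \<subseteq> {..<n}"
  shows "count_list x 3 \<le> n + 2"
proof (cases "2 \<le> count_list x 3")
  case True
  then have "3 \<in> set x" using count_notin[of 3 x] by fastforce
  then obtain p y where p: "x = p @ 3 # y" "3 \<notin> set p" using split_list_first by metis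
  have "3 \<in> set y" using True p count_notin[of 3 y] by fastforce
  then obtain z r where z: "y = z @ 3 # r" "3 \<notin> set r" using split_list_last by metis
  have x': "x = (p @ [3]) @ z @ (3 # r)" using p z by simp
  have gz: "gap_ok fork z" using gap_ok_factor[of fork "p @ [3]" z "3 # r"] g x' by simp
  have "one_between 3 4 z" unfolding one_between_def
  proof (intro allI impI, elim conjE)
    fix a m b assume m: "z = a @ 3 # m @ 3 # b" "3 \<notin> set m"
    have "3 \<in> set (p @ 3 # a)" by simp
    then obtain A m1 where A: "p @ 3 # a = A @ 3 # m1" "3 \<notin> set m1" using split_list_last by metis
    have "3 \<in> set (b @ 3 # r)" by simp
    then obtain m3 B where B: "b @ 3 # r = m3 @ 3 # B" "3 \<notin> set m3" using split_list_first by metis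
    have "x = (p @ 3 # a) @ 3 # m @ 3 # (b @ 3 # r)" using x' m by simp
    then have "x = A @ 3 # m1 @ 3 # m @ 3 # m3 @ 3 # B" unfolding A B by simp
    from branch_gap[OF g n x this A(2) m(2) B(2)] show "count_list m 4 = 1" .
  qed
  moreover have "set z \<subseteq> {..<n}" using x x' by auto
  ultimately have "count_list z 3 \<le> n" using branch_count_alternating[OF gz n] by blast
  then show ?thesis using x' p z by (simp add: count_notin)
qed simp

text \<open>
  Sparsity bounds the number of occurrences of each node by that of the next node towards the branch, plus one.
\<close>
lemma fork_bounded:
  assumes g: "gap_ok fork x" and n: "4 \<le> n" and x: "set x \<subseteq> {..<n}"
  shows "length x \<le> n * (2 * n + 4)"
proof -
  have c3: "count_list x 3 \<le> n + 2" by (rule branch_count[OF assms])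
  have arm: "count_list x (3 + k) \<le> n + 2 + k" for k
  proof (induction k)
    case (Suc k)
    then show ?case using count_le_parent[OF arm_sparse[OF assms, of "3 + k"]] by simp
  qed (use c3 in simp)
  have "count_list x i \<le> 2 * n + 4" if "i < n" for i
  proof -
    have "count_list x 2 \<le> n + 3" "count_list x 0 \<le> n + 3"
      using count_le_parent[OF short_arms_sparse(2)[OF assms]] count_le_parent[OF short_arms_sparse(3)[OF assms]] c3
      by auto
    moreover from this have "count_list x (Suc 0) \<le> n + 4"
      using count_le_parent[OF short_arms_sparse(1)[OF assms]] by auto
    moreover have "i = 0 \<or> i = Suc 0 \<or> i = 2 \<or> i = 3 + (i - 3)" by linarith
    moreover have "3 \<le> i \<Longrightarrow> count_list x i \<le> n + 2 + (i - 3)" using arm[of "i - 3"] by simp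
    ultimately show ?thesis using that n by (cases "3 \<le> i") auto
  qed
  then have "(\<Sum>i<n. count_list x i) \<le> (\<Sum>i<n. 2 * n + 4)" by (intro sum_mono) auto
  moreover have "(\<Sum>i<n. count_list x i) = length x"
    using sum_count_set[OF x] by (simp add: finite_lessThan)
  ultimately show ?thesis by simp
qed

section \<open>Words in a simply laced Coxeter group\<close>

locale simply_laced =
  fixes X :: "'a coxeter_graph"
  assumes adj_sym: "s \<in> nodes X \<Longrightarrow> t \<in> nodes X \<Longrightarrow> adj X s t \<Longrightarrow> adj X t s"
    and adj_irrefl: "s \<in> nodes X \<Longrightarrow> \<not> adj X s s"
begin

text \<open>
  Adjacency cut down to the nodes, as \<open>adj\<close> is arbitrary elsewhere.
\<close>
definition link :: "'a \<Rightarrow> 'a \<Rightarrow> bool" where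
  "link s t \<longleftrightarrow> s \<in> nodes X \<and> t \<in> nodes X \<and> adj X s t"

sublocale simple_graph link
  by unfold_locales (auto simp: link_def adj_sym adj_irrefl)

notation teq (infix "\<approx>" 50)

abbreviation ceq :: "'a list \<Rightarrow> 'a list \<Rightarrow> bool" (infix "\<sim>" 50) where "x \<sim> y \<equiv> cox_eq X x y"

abbreviation words :: "'a list set" where "words \<equiv> lists (nodes X)"

lemma rev_words: "rev x \<in> words \<longleftrightarrow> x \<in> words" by auto

lemma ceq_words: "x \<sim> y \<Longrightarrow> x \<in> words \<and> y \<in> words"
proof (induction rule: cox_eq.induct)
  case (cox_rel x y s t)
  have "concat (replicate k [s, t]) \<in> words" for k using cox_rel by (induction k) auto
  then show ?case using cox_rel by simp
qed auto

lemmas ceq_sym = cox_eq.cox_sym[of X]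
lemma ceq_trans [trans]: "x \<sim> y \<Longrightarrow> y \<sim> z \<Longrightarrow> x \<sim> z" by (rule cox_eq.cox_trans)
lemmas ceq_refl = cox_eq.cox_refl[of _ X]

lemma ceq_context: "x \<sim> y \<Longrightarrow> p \<in> words \<Longrightarrow> r \<in> words \<Longrightarrow> p @ x @ r \<sim> p @ y @ r"
proof (induction rule: cox_eq.induct)
  case (cox_refl x)
  then show ?case by (intro ceq_refl) auto
next
  case (cox_rel x y s t)
  then show ?case using cox_eq.cox_rel[of "p @ x" X "y @ r" s t] by simp
qed (blast intro: ceq_sym ceq_trans)+

lemma ceq_append: "x \<sim> x' \<Longrightarrow> y \<sim> y' \<Longrightarrow> x @ y \<sim> x' @ y'"
  using ceq_context[of x x' "[]" y] ceq_context[of y y' x' "[]"] ceq_words ceq_trans[of "x @ y"] by fastforce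

lemma ceq_Cons: "x \<sim> y \<Longrightarrow> s \<in> nodes X \<Longrightarrow> s # x \<sim> s # y"
  using ceq_append[OF ceq_refl[of "[s]"]] by simp

lemma ceq_cancel: "p \<in> words \<Longrightarrow> r \<in> words \<Longrightarrow> s \<in> nodes X \<Longrightarrow> p @ s # s # r \<sim> p @ r"
  using cox_eq.cox_rel[of p X r s s] by (simp add: cox_exponent_def)

lemma ceq_rev_left: "x \<in> words \<Longrightarrow> rev x @ x \<sim> []"
proof (induction x)
  case (Cons s x)
  have "rev (s # x) @ (s # x) \<sim> rev x @ x" using ceq_cancel[of "rev x" x s] Cons.prems by (simp add: rev_words)
  from ceq_trans[OF this] show ?case using Cons by simp
qed (simp add: ceq_refl)

lemma ceq_left_cancel: "p @ x \<sim> p @ y \<Longrightarrow> x \<sim> y"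
proof -
  assume a: "p @ x \<sim> p @ y"
  then have w: "p \<in> words" "x \<in> words" "y \<in> words" using ceq_words[OF a] by auto
  have "x \<sim> rev p @ p @ x" using ceq_sym[OF ceq_append[OF ceq_rev_left[OF w(1)] ceq_refl[OF w(2)]]] by simp
  also have "rev p @ p @ x \<sim> rev p @ p @ y" using ceq_append[OF ceq_refl a, of "rev p"] w by (simp add: rev_words)
  also have "rev p @ p @ y \<sim> y" using ceq_append[OF ceq_rev_left[OF w(1)] ceq_refl[OF w(3)]] by simp
  finally show ?thesis .
qed

lemma ceq_Cons_cancel: "s # x \<sim> s # y \<Longrightarrow> x \<sim> y"
  using ceq_left_cancel[of "[s]"] by simp

lemma ceq_commute:
  assumes "s \<in> nodes X" "t \<in> nodes X" "ind s t"
  shows "[s, t] \<sim> [t, s]"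
proof -
  have "cox_exponent X s t = 2" using assms by (auto simp: cox_exponent_def ind_def link_def)
  then have 1: "[s, t, s, t, t, s] \<sim> [t, s]"
    using cox_eq.cox_rel[of "[]" X "[t, s]" s t] assms by (simp add: numeral_eq_Suc)
  have "[s, t] \<sim> [s, t, s, s]" using ceq_sym[OF ceq_cancel[of "[s, t]" "[]" s]] assms by simp
  also have "[s, t, s, s] \<sim> [s, t, s, t, t, s]" using ceq_sym[OF ceq_cancel[of "[s, t, s]" "[s]" t]] assms by simp
  also note 1
  finally show ?thesis .
qed

lemma ceq_braid:
  assumes "link s t"
  shows "[s, t, s] \<sim> [t, s, t]"
proof -
  have st: "s \<in> nodes X" "t \<in> nodes X" using assms by (auto simp: link_def)
  have "cox_exponent X s t = 3" using assms adj_irrefl by (auto simp: cox_exponent_def link_def)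
  then have 1: "[s, t, s, t, s, t, t, s, t] \<sim> [t, s, t]"
    using cox_eq.cox_rel[of "[]" X "[t, s, t]" s t] st by (simp add: numeral_eq_Suc)
  have "[s, t, s] \<sim> [s, t, s, t, t]" using ceq_sym[OF ceq_cancel[of "[s, t, s]" "[]" t]] st by simp
  also have "[s, t, s, t, t] \<sim> [s, t, s, t, s, s, t]" using ceq_sym[OF ceq_cancel[of "[s, t, s, t]" "[t]" s]] st by simp
  also have "[s, t, s, t, s, s, t] \<sim> [s, t, s, t, s, t, t, s, t]"
    using ceq_sym[OF ceq_cancel[of "[s, t, s, t, s]" "[s, t]" t]] st by simp
  also note 1
  finally show ?thesis .
qed

lemma teq_ceq: "x \<approx> y \<Longrightarrow> x \<in> words \<Longrightarrow> x \<sim> y"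
proof (induction rule: trace_eq.induct)
  case (swap x p a b r)
  then have x: "x \<sim> p @ a # b # r" by blast
  have w: "p \<in> words" "r \<in> words" "a \<in> nodes X" "b \<in> nodes X" using ceq_words[OF x] by auto
  show ?case using ceq_trans[OF x] ceq_context[OF ceq_commute[OF w(3,4) swap.hyps(2)] w(1,2)] by simp
qed (rule ceq_refl)

lemma ceq_parity: "x \<sim> y \<Longrightarrow> even (length x + length y)"
proof (induction rule: cox_eq.induct)
  case (cox_rel x y s t)
  have "length (concat (replicate k [s, t])) = 2 * k" for k by (induction k) auto
  then show ?case by simp
qed auto

lemma ceq_rev: "x \<sim> y \<Longrightarrow> rev x \<sim> rev y"
proof (induction rule: cox_eq.induct)
  case (cox_rel x y s t)
  have r: "rev (concat (replicate k [s, t])) = concat (replicate k [t, s])" for k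
  proof (induction k)
    case (Suc k)
    have "concat (replicate k [t, s]) @ [t, s] = [t, s] @ concat (replicate k [t, s])" by (induction k) auto
    then show ?case using Suc by simp
  qed simp
  have "cox_exponent X s t = cox_exponent X t s" using adj_sym cox_rel by (auto simp: cox_exponent_def)
  then show ?case using cox_eq.cox_rel[of "rev y" X "rev x" t s] cox_rel r by (simp add: rev_words)
next
  case (cox_refl x)
  then show ?case by (intro ceq_refl) (simp add: rev_words)
qed (blast intro: ceq_sym ceq_trans)+

section \<open>Irreducible words are reduced\<close>

text \<open>
  For \<open>u = 1\<close> and \<open>d = 2\<close> the quadratic relation becomes \<open>T\<^sub>s\<^sup>2 = 1\<close>: the Coxeter group acts on admissible functions.
\<close>
lemma fold_lact_ceq:
  assumes F: "admissible 2 F"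
  shows "x \<sim> y \<Longrightarrow> fold (lact 1) x F = fold (lact 1) y F"
proof (induction rule: cox_eq.induct)
  case (cox_rel x y s t)
  define G where "G = fold (lact 1) x F"
  have G: "admissible 2 G" unfolding G_def by (rule admissible_fold[OF F])
  have sq: "lact 1 s (lact 1 s G) = G" if "admissible 2 G" for s G
    using lact_square[OF that, of 1 s] by simp
  have "fold (lact 1) (concat (replicate (cox_exponent X s t) [s, t])) G = G"
  proof -
    consider "s = t" | "s \<noteq> t" "link s t" | "ind s t" by (auto simp: ind_def)
    then show ?thesis
    proof cases
      case 1
      then show ?thesis using sq[OF G] by (simp add: cox_exponent_def)
    next
      case 2
      then have "cox_exponent X s t = 3" by (auto simp: cox_exponent_def link_def)
      moreover have "lact 1 t (lact 1 s (lact 1 t (lact 1 s (lact 1 t (lact 1 s G))))) = G"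
        using lact_braid[OF G _ 2(2), of 1] sq[OF G] sq[OF admissible_lact[OF G]]
          sq[OF admissible_lact[OF admissible_lact[OF G]]] by simp
      ultimately show ?thesis by (simp add: numeral_eq_Suc)
    next
      case 3
      then have "cox_exponent X s t = 2" using cox_rel by (auto simp: cox_exponent_def link_def ind_def)
      moreover have "lact 1 t (lact 1 s (lact 1 t (lact 1 s G))) = G"
        using arg_cong[OF lact_commute[OF G 3, of 1], of "\<lambda>G. lact 1 t (lact 1 s G)"]
          sq[OF G] sq[OF admissible_lact[OF G]] by simp
      ultimately show ?thesis by (simp add: numeral_eq_Suc)
    qed
  qed
  then show ?case by (simp add: G_def)
qed auto

text \<open>
  By invariance, the functional obtained from \<open>chi 2 x\<close> takes the same nonzero value at \<open>y\<close> as at \<open>x\<close>;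
  and it can be nonzero only at words longer than \<open>x\<close> or equivalent to \<open>x\<close> by commutations.
\<close>
lemma FC_shortest:
  assumes x: "FC x" "x \<sim> y"
  shows "length x \<le> length y" "length x = length y \<Longrightarrow> y \<approx> x"
proof -
  have "fold (lact 1) y (chi 2 x) [] = (1::int)"
    using fold_lact_ceq[OF admissible_chi x(2), of x, where ?'b = int] chi_self[OF x(1), of "1::int" 2] by simp
  then have "fold (lact 1) y (chi 2 x) [] \<noteq> (0::int)" by simp
  from chi_support[OF this] show "length x \<le> length y" "length x = length y \<Longrightarrow> y \<approx> x" by auto
qed

lemma commuting_single: "commuting [s]"
  using E_irrefl by (simp add: commuting_def)

lemma ceq_gen: "[s] \<sim> [t] \<Longrightarrow> s = t"
  using FC_shortest(2)[OF commuting_FC[OF commuting_single], of s "[t]"] trace_eq_set[of ind "[t]" "[s]"] by simp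

lemma FC_pair: "link s t \<Longrightarrow> FC [s, t]"
  unfolding FC_iff_gap_ok gap_ok_def using E_irrefl
  by (auto simp: Cons_eq_append_conv append_eq_Cons_conv)

lemma link_not_commute: "link s t \<Longrightarrow> \<not> [t, s] \<approx> [s, t]"
  using teq_star_profile[of "[t, s]" "[s, t]" s] E_irrefl by auto

definition reduced :: "'a list \<Rightarrow> bool" where
  "reduced x \<longleftrightarrow> x \<in> words \<and> (\<forall>y. x \<sim> y \<longrightarrow> length x \<le> length y)"

lemma red_words: "reduced x \<Longrightarrow> x \<in> words" by (simp add: reduced_def)

lemma FC_red: "FC x \<Longrightarrow> x \<in> words \<Longrightarrow> reduced x"
  unfolding reduced_def using FC_shortest by blast

text \<open>
  By parity, a shorter word would be a single letter \<open>u\<close>, and then \<open>s t = u s\<close>, which contradicts the irreducibility of \<open>s t\<close>.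
\<close>
lemma red_braid:
  assumes "link s t" shows "reduced [s, t, s]"
  unfolding reduced_def
proof (intro conjI allI impI)
  show "[s, t, s] \<in> words" using assms by (simp add: link_def)
  fix y assume y: "[s, t, s] \<sim> y"
  show "length [s, t, s] \<le> length y"
  proof (rule ccontr)
    assume "\<not> ?thesis"
    then have "length y < 3" "odd (length y)" using ceq_parity[OF y] by auto
    then have "length y = 1" by (cases "length y") (auto simp: less_Suc_eq numeral_eq_Suc)
    then obtain u where u: "y = [u]" by (auto simp: length_Suc_conv)
    have s: "s \<in> nodes X" using assms by (simp add: link_def)
    have "[s, t] \<sim> [s, t, s, s]" using ceq_sym[OF ceq_cancel[of "[s, t]" "[]" s]] assms by (simp add: link_def)
    also have "[s, t, s, s] \<sim> [u, s]" using ceq_append[OF y ceq_refl[of "[s]"]] u s by simp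
    finally have "[u, s] \<approx> [s, t]" using FC_shortest(2)[OF FC_pair[OF assms]] by simp
    moreover from this have "u = t" using trace_eq_mset[of ind "[u, s]" "[s, t]"] by simp
    ultimately show False using link_not_commute[OF assms] by simp
  qed
qed

lemma red_ceq: "reduced x \<Longrightarrow> x \<sim> y \<Longrightarrow> length y = length x \<Longrightarrow> reduced y"
  unfolding reduced_def using ceq_words ceq_trans by metis

lemma red_factor: "reduced (p @ x @ r) \<Longrightarrow> reduced x"
  unfolding reduced_def
proof (intro conjI allI impI)
  assume a: "p @ x @ r \<in> words \<and> (\<forall>y. p @ x @ r \<sim> y \<longrightarrow> length (p @ x @ r) \<le> length y)"
  then show "x \<in> words" by auto
  fix y assume "x \<sim> y"
  then have "p @ x @ r \<sim> p @ y @ r" using a by (intro ceq_context) auto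
  then show "length x \<le> length y" using a by fastforce
qed

lemma red_exists: "x \<in> words \<Longrightarrow> \<exists>y. x \<sim> y \<and> reduced y"
proof -
  assume x: "x \<in> words"
  obtain y where y: "x \<sim> y" "\<forall>z. x \<sim> z \<longrightarrow> length y \<le> length z"
    using ex_has_least_nat[of "\<lambda>y. x \<sim> y" x length, OF ceq_refl[OF x]] by auto
  then have "reduced y" unfolding reduced_def using ceq_words[OF y(1)] ceq_trans[OF y(1)] by blast
  with y(1) show ?thesis by blast
qed

section \<open>The exchange condition\<close>

definition conjugate :: "'a \<Rightarrow> 'a list \<Rightarrow> 'a list" where "conjugate s r = s # r @ [s]"

text \<open>
  For a reflection \<open>r\<close> this is the parity of the number of prefixes \<open>p c\<close> of the word, \<open>c\<close> a letter, with
  \<open>r = p c p\<^sup>-\<^sup>1\<close>.  In the permutation representation of a Coxeter group on signed reflections it is the sign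
  change at \<open>r\<close>; it depends only on the group element (\<open>eta_invariant\<close>).
\<close>
fun eta :: "'a list \<Rightarrow> 'a list \<Rightarrow> bool" where
  "eta [] r \<longleftrightarrow> False"
| "eta (s # x) r \<longleftrightarrow> (r \<sim> [s]) \<noteq> eta x (conjugate s r)"

lemma conjugate_words: "s \<in> nodes X \<Longrightarrow> r \<in> words \<Longrightarrow> conjugate s r \<in> words" by (simp add: conjugate_def)

lemma conjugate_cong: "r \<sim> r' \<Longrightarrow> s \<in> nodes X \<Longrightarrow> conjugate s r \<sim> conjugate s r'"
  using ceq_context[of r r' "[s]" "[s]"] by (simp add: conjugate_def)

lemma conjugate_conjugate: "s \<in> nodes X \<Longrightarrow> r \<in> words \<Longrightarrow> conjugate s (conjugate s r) \<sim> r"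
  using ceq_trans[of "s # s # r @ [s, s]" "r @ [s, s]" r] ceq_cancel[of "[]" "r @ [s, s]" s]
    ceq_cancel[of r "[]" s]
  by (simp add: conjugate_def)

lemma ceq_cong_right: "a \<sim> b \<Longrightarrow> r \<sim> a \<longleftrightarrow> r \<sim> b"
  using ceq_sym ceq_trans by blast

lemma ceq_cong_left: "a \<sim> b \<Longrightarrow> a \<sim> r \<longleftrightarrow> b \<sim> r"
  using ceq_sym ceq_trans by blast

lemma conjugate_ceq:
  assumes "s \<in> nodes X" "r \<in> words" "z \<in> words"
  shows "conjugate s r \<sim> z \<longleftrightarrow> r \<sim> conjugate s z"
  using conjugate_cong[of _ _ s] conjugate_conjugate[of s r] conjugate_conjugate[of s z] assms ceq_sym ceq_trans by blast

lemma eta_ceq: "r \<sim> r' \<Longrightarrow> x \<in> words \<Longrightarrow> eta x r = eta x r'"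
proof (induction x arbitrary: r r')
  case (Cons s x)
  then have "eta x (conjugate s r) = eta x (conjugate s r')" using conjugate_cong by simp
  then show ?case using ceq_cong_left[OF Cons.prems(1)] by simp
qed simp

lemma eta_append: "eta (x @ y) r \<longleftrightarrow> eta x r \<noteq> eta y (rev x @ r @ x)"
  by (induction x arbitrary: r) (auto simp: conjugate_def)

text \<open>
  In the word \<open>(s t)\<^sup>m\<close>, the reflections of the second half repeat those of the first one in the same order.
\<close>
lemma eta_relation:
  assumes "s \<in> nodes X" "t \<in> nodes X" "r \<in> words"
  shows "\<not> eta (concat (replicate (cox_exponent X s t) [s, t])) r"
proof -
  let ?z = "concat (replicate (cox_exponent X s t) [s, t])"
  have "?z \<sim> []" using cox_eq.cox_rel[of "[]" X "[]" s t] assms by simp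
  then have z: "r \<sim> ?z @ w \<longleftrightarrow> r \<sim> w" if "w \<in> words" for w
    using ceq_cong_right[OF ceq_append[OF _ ceq_refl[OF that]]] by simp
  note simps = eta.simps conjugate_ceq conjugate_words assms
  consider "s = t" | "s \<noteq> t" "link s t" | "ind s t" by (auto simp: ind_def)
  then show ?thesis
  proof cases
    case 1
    then show ?thesis using z[of "[s]"] assms conjugate_ceq[of s r "[s]"]
      by (simp add: cox_exponent_def conjugate_def)
  next
    case 2
    then have m: "cox_exponent X s t = 3" by (auto simp: cox_exponent_def link_def)
    have "eta [s, t, s, t, s, t] r \<longleftrightarrow> (r \<sim> [s]) \<noteq> ((r \<sim> [s, t, s]) \<noteq> ((r \<sim> [s, t, s, t, s]) \<noteq>
      ((r \<sim> [s, t, s, t, s, t, s]) \<noteq> ((r \<sim> [s, t, s, t, s, t, s, t, s]) \<noteq> (r \<sim> [s, t, s, t, s, t, s, t, s, t, s])))))"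
      using assms by (simp add: conjugate_ceq conjugate_words) (simp add: conjugate_def)
    then show ?thesis using z[of "[s]"] z[of "[s, t, s]"] z[of "[s, t, s, t, s]"] assms
      by (simp add: m numeral_eq_Suc del: eta.simps) blast
  next
    case 3
    then have m: "cox_exponent X s t = 2" using assms by (auto simp: cox_exponent_def link_def ind_def)
    have "eta [s, t, s, t] r \<longleftrightarrow> (r \<sim> [s]) \<noteq> ((r \<sim> [s, t, s]) \<noteq> ((r \<sim> [s, t, s, t, s]) \<noteq> (r \<sim> [s, t, s, t, s, t, s])))"
      using assms by (simp add: conjugate_ceq conjugate_words) (simp add: conjugate_def)
    then show ?thesis using z[of "[s]"] z[of "[s, t, s]"] assms
      by (simp add: m numeral_eq_Suc del: eta.simps) blast
  qed
qed

lemma eta_invariant: "x \<sim> y \<Longrightarrow> r \<in> words \<Longrightarrow> eta x r = eta y r"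
proof (induction arbitrary: r rule: cox_eq.induct)
  case (cox_rel x y s t)
  let ?z = "concat (replicate (cox_exponent X s t) [s, t])" and ?r = "rev x @ r @ x"
  have zc: "?z \<sim> []" using cox_eq.cox_rel[of "[]" X "[]" s t] cox_rel by simp
  have r: "?r \<in> words" using cox_rel by (simp add: rev_words)
  have "rev ?z @ ?r @ ?z \<sim> ?r"
    using ceq_append[OF ceq_rev[OF zc] ceq_append[OF ceq_refl[OF r] zc]] by simp
  then have "eta y (rev ?z @ ?r @ ?z) = eta y ?r" using eta_ceq cox_rel by blast
  then show ?case using eta_relation[OF cox_rel.hyps(3,4) r] by (simp add: eta_append)
qed auto

lemma eta_prefix:
  "eta x r \<Longrightarrow> x \<in> words \<Longrightarrow> r \<in> words \<Longrightarrow> \<exists>p c w. x = p @ c # w \<and> r @ p \<sim> p @ [c]"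
proof (induction x arbitrary: r)
  case (Cons s x)
  show ?case
  proof (cases "r \<sim> [s]")
    case True
    then show ?thesis by (intro exI[of _ "[]"]) simp
  next
    case False
    then have "eta x (conjugate s r)" using Cons.prems by simp
    then obtain p c w where x: "x = p @ c # w" "conjugate s r @ p \<sim> p @ [c]"
      using Cons.IH[of "conjugate s r"] conjugate_words[of s r] Cons.prems by auto
    have "r @ s # p \<sim> s # s # r @ s # p"
      using ceq_sym[OF ceq_cancel[of "[]" "r @ s # p" s]] Cons.prems x by simp
    also have "s # s # r @ s # p \<sim> s # p @ [c]" using ceq_Cons[OF x(2), of s] Cons.prems by (simp add: conjugate_def)
    finally show ?thesis using x(1) by (intro exI[of _ "s # p"] exI[of _ c] exI[of _ w]) simp
  qed
qed simp

text \<open>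
  The reflection \<open>s\<close> occurs an odd number of times either in \<open>x\<close> or in \<open>s x\<close>.  In the first case an
  occurrence is what is claimed.  In the second case \<open>s\<close> also occurs in a reduced word \<open>y\<close> of the
  shorter element \<open>s x\<close>, so that \<open>x = s y\<close> has a word shorter than \<open>y\<close>, and thus shorter than \<open>x\<close>,
  which is impossible.
\<close>
lemma exchange:
  assumes x: "reduced x" and s: "s \<in> nodes X" and n: "\<not> reduced (s # x)"
  obtains p c w where "x = p @ c # w" "s # p \<sim> p @ [c]"
proof -
  have xw: "x \<in> words" using x red_words by blast
  have "eta x [s]"
  proof (rule ccontr)
    assume ne: "\<not> eta x [s]"
    have sxw: "s # x \<in> words" using xw s by simp
    obtain y where y: "s # x \<sim> y" "reduced y" using red_exists[OF sxw] by blast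
    have len: "length y \<le> length x"
    proof (rule ccontr)
      assume "\<not> ?thesis"
      moreover have "length y \<le> length (s # x)" using y ceq_sym unfolding reduced_def by blast
      ultimately have "length (s # x) = length y" by simp
      then show False using red_ceq[OF y(2) ceq_sym[OF y(1)]] n by simp
    qed
    have "conjugate s [s] \<sim> [s]" using ceq_cancel[of "[]" "[s]" s] s by (simp add: conjugate_def)
    then have "\<not> eta x (conjugate s [s])" using eta_ceq xw ne by blast
    then have "eta (s # x) [s]" using ceq_refl[of "[s]"] s by simp
    then have "eta y [s]" using eta_invariant[OF y(1)] s by simp
    then obtain p c w where p: "y = p @ c # w" "[s] @ p \<sim> p @ [c]"
      using eta_prefix[of y "[s]"] s ceq_words[OF y(1)] by auto
    have pw: "p \<in> words" "w \<in> words" "c \<in> nodes X" using ceq_words[OF y(1)] p(1) by auto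
    have "x \<sim> s # s # x" using ceq_sym[OF ceq_cancel[of "[]" x s]] xw s by simp
    also have "s # s # x \<sim> s # y" using ceq_Cons[OF y(1) s] .
    also have "s # y \<sim> p @ c # c # w" using ceq_append[OF p(2) ceq_refl[of "c # w"]] p(1) pw by simp
    also have "p @ c # c # w \<sim> p @ w" by (rule ceq_cancel) (use pw in auto)
    finally have "length x \<le> length (p @ w)" using x unfolding reduced_def by blast
    then show False using len p(1) by simp
  qed
  then obtain p c w where "x = p @ c # w" "[s] @ p \<sim> p @ [c]"
    using eta_prefix[of x "[s]"] s xw by auto
  then show ?thesis using that by simp
qed

lemma red_Cons_cases:
  assumes x: "reduced x" and s: "s \<in> nodes X"
  shows "reduced (s # x) \<or> (\<exists>y. x \<sim> s # y \<and> reduced (s # y) \<and> length x = Suc (length y))"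
proof (cases "reduced (s # x)")
  case False
  then obtain p c w where p: "x = p @ c # w" "s # p \<sim> p @ [c]" using exchange[OF x s] by blast
  have w: "w \<in> words" using red_words[OF x] p(1) by auto
  have "s # p @ w \<sim> x" using ceq_append[OF p(2) ceq_refl[OF w]] p(1) by simp
  then have "x \<sim> s # p @ w" by (rule ceq_sym)
  then show ?thesis using red_ceq[OF x, of "s # p @ w"] p(1) by (intro disjI2 exI[of _ "p @ w"]) simp
qed simp

lemma red_ConsD: "reduced (s # x) \<Longrightarrow> reduced x" using red_factor[of "[s]" x "[]"] by simp

text \<open>
  Let the first letters \<open>s\<close> of \<open>x\<close> and \<open>t\<close> of \<open>y\<close> be different.  Exchange gives a word for the same
  element that starts with \<open>t s\<close>, and, if \<open>s\<close> and \<open>t\<close> are adjacent, a second exchange gives one that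
  starts with \<open>s t s\<close>.  The words starting with \<open>s t s\<close> and \<open>t s t\<close> are related by a braid relation; all
  other links of the chain join words with a common first letter, where induction applies.
\<close>
theorem matsumoto: "x \<sim> y \<Longrightarrow> reduced x \<Longrightarrow> reduced y \<Longrightarrow> braid_eq x y"
proof (induction "length x" arbitrary: x y rule: less_induct)
  case less
  have len: "length x = length y" using less.prems ceq_sym unfolding reduced_def by (metis antisym)
  have same: "braid_eq (s # a) (s # b)"
    if h: "s # a \<sim> s # b" "reduced (s # a)" "reduced (s # b)" "length a < length x" for s a b
    using less.hyps[OF h(4) ceq_Cons_cancel[OF h(1)] red_ConsD[OF h(2)] red_ConsD[OF h(3)]]
    by (rule braid_eq_Cons)
  show ?case
  proof (cases x)
    case Nil
    then show ?thesis using len braid_eq.reflexive by simp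
  next
    case x: (Cons s x')
    then obtain t y' where y: "y = t # y'" using len by (cases y) auto
    have st: "s \<in> nodes X" "t \<in> nodes X" using red_words[OF less.prems(2)] red_words[OF less.prems(3)] x y by auto
    show ?thesis
    proof (cases "s = t")
      case True
      then show ?thesis using same[of s x' y'] less.prems x y by simp
    next
      case False
      have "t # x \<sim> y'"
        using ceq_trans[OF ceq_Cons[OF less.prems(1) st(2)] ] ceq_cancel[of "[]" y' t] ceq_words[OF less.prems(1)] y st by simp
      then have "\<not> reduced (t # x)" using len y unfolding reduced_def by fastforce
      then obtain p c w where p: "x = p @ c # w" "t # p \<sim> p @ [c]" using exchange[OF less.prems(2) st(2)] by blast
      \<comment> \<open>otherwise \<open>t\<close> would equal the first letter \<open>s\<close> of \<open>x\<close>\<close>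
      have "p \<noteq> []" using p x False by (auto dest: ceq_gen)
      then obtain p' where p': "p = s # p'" using p(1) x by (cases p) auto
      define z' where "z' = p' @ w"
      have ww: "w \<in> words" using red_words[OF less.prems(2)] p(1) by auto
      have xz: "x \<sim> t # s # z'"
        using ceq_sym[OF ceq_append[OF p(2) ceq_refl[OF ww]]] p(1) p' by (simp add: z'_def)
      have lz: "length (t # s # z') = length x" using p(1) p' by (simp add: z'_def)
      have rz: "reduced (t # s # z')" by (rule red_ceq[OF less.prems(2) xz lz])
      have zy: "braid_eq (t # s # z') y"
        unfolding y by (rule same) (use ceq_trans[OF ceq_sym[OF xz] less.prems(1)] rz less.prems(3) y lz in auto)
      have "braid_eq x (t # s # z')"
      proof (cases "link s t")
        case nolink: False
        then have i: "ind t s" using False E_sym by (auto simp: ind_def)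
        have tz: "z' \<in> words" using red_words[OF rz] by simp
        have c: "t # s # z' \<sim> s # t # z'" using ceq_append[OF ceq_commute[OF st(2,1) i] ceq_refl[OF tz]] by simp
        have "braid_eq x (s # t # z')"
          unfolding x by (rule same) (use ceq_trans[OF xz c] red_ceq[OF rz c] less.prems(2) x in auto)
        moreover have "braid_eq (s # t # z') (t # s # z')"
          using braid_eq.commute[of "s # t # z'" "[]" s t z'] braid_eq.reflexive ind_sym[OF i] by simp
        ultimately show ?thesis using braid_eq_trans by blast
      next
        case True
        have "s # t # s # z' \<sim> x'"
          using ceq_trans[OF ceq_Cons[OF ceq_sym[OF xz] st(1)]] ceq_cancel[of "[]" x' s]
            ceq_words[OF less.prems(1)] x st by simp
        then have "\<not> reduced (s # t # s # z')" using lz x unfolding reduced_def by fastforce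
        then obtain p2 c2 w2 where p2: "t # s # z' = p2 @ c2 # w2" "s # p2 \<sim> p2 @ [c2]"
          using exchange[OF rz st(1)] by blast
        have "p2 \<noteq> []" using p2 False by (auto dest: ceq_gen)
        then obtain p3 where p3: "p2 = t # p3" "s # z' = p3 @ c2 # w2" using p2(1) by (cases p2) auto
        have "p3 \<noteq> []"
        proof
          assume "p3 = []"
          then have "[s, t] \<sim> [t, s]" using p2(2) p3 by simp
          from FC_shortest(2)[OF FC_pair[OF True] this] show False using link_not_commute[OF True] by simp
        qed
        then obtain p4 where p4: "p3 = s # p4" "z' = p4 @ c2 # w2" using p3(2) by (cases p3) auto
        have w2: "w2 \<in> words" "p4 \<in> words" using red_words[OF rz] p4 by auto
        let ?u = "p4 @ w2"
        have z2: "t # s # z' \<sim> s # t # s # ?u"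
          using ceq_sym[OF ceq_append[OF p2(2) ceq_refl[OF w2(1)]]] p3 p4 by simp
        have l2: "length (s # t # s # ?u) = length (t # s # z')" using p4 by simp
        have r2: "reduced (s # t # s # ?u)" by (rule red_ceq[OF rz z2 l2])
        have b: "s # t # s # ?u \<sim> t # s # t # ?u" using ceq_append[OF ceq_braid[OF True] ceq_refl[of ?u]] w2 by simp
        have 1: "braid_eq x (s # t # s # ?u)"
          unfolding x by (rule same) (use ceq_trans[OF xz z2] r2 less.prems(2) x in auto)
        have 2: "braid_eq (s # t # s # ?u) (t # s # t # ?u)"
          using braid_eq.braid[of "s # t # s # ?u" "[]" s t ?u] braid_eq.reflexive True by simp
        have 3: "braid_eq (t # s # t # ?u) (t # s # z')"
          by (rule same) (use ceq_sym[OF ceq_trans[OF z2 b]] red_ceq[OF r2 b] rz l2 lz in auto)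
        show ?thesis using braid_eq_trans[OF 3 braid_eq_trans[OF 2 1]] .
      qed
      then show ?thesis using braid_eq_trans[OF zy] by blast
    qed
  qed
qed

section \<open>Group elements\<close>

abbreviation W :: "'a list set monoid" where "W \<equiv> cox_group X"
abbreviation cl :: "'a list \<Rightarrow> 'a list set" where "cl \<equiv> cox_class X"

lemma cl_mem: "y \<in> cl x \<longleftrightarrow> x \<sim> y" by (simp add: cox_class_def)

lemma cl_iff: "x \<in> words \<Longrightarrow> cl x = cl y \<longleftrightarrow> x \<sim> y"
  using ceq_cong_left[of x y] ceq_refl[of x] by (auto simp: set_eq_iff cl_mem intro: ceq_sym)

lemma carrier_W: "carrier W = cl ` words" by (simp add: cox_group_def)
lemma one_W: "\<one>\<^bsub>W\<^esub> = cl []" by (simp add: cox_group_def)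

lemma mult_W:
  assumes "x \<in> words" "y \<in> words" shows "cl x \<otimes>\<^bsub>W\<^esub> cl y = cl (x @ y)"
proof -
  have 1: "cl (x' @ y') = cl (x @ y)" if "x' \<in> cl x" "y' \<in> cl y" for x' y'
    using ceq_append[of x x' y y'] cl_iff[of "x @ y" "x' @ y'"] assms that by (simp add: cl_mem)
  have "x \<in> cl x" "y \<in> cl y" using ceq_refl assms by (auto simp: cl_mem)
  then have 2: "(\<Union>x'\<in>cl x. \<Union>y'\<in>cl y. cl (x @ y)) = cl (x @ y)" by blast
  have "cl x \<otimes>\<^bsub>W\<^esub> cl y = (\<Union>x'\<in>cl x. \<Union>y'\<in>cl y. cl (x' @ y'))" by (simp add: cox_group_def)
  also have "\<dots> = (\<Union>x'\<in>cl x. \<Union>y'\<in>cl y. cl (x @ y))" by (intro SUP_cong) (simp_all add: 1)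
  finally show ?thesis using 2 by simp
qed

lemma group_W: "group W"
proof (rule groupI)
  fix a b c assume "a \<in> carrier W" "b \<in> carrier W" "c \<in> carrier W"
  then obtain x y z where "x \<in> words" "y \<in> words" "z \<in> words" "a = cl x" "b = cl y" "c = cl z"
    unfolding carrier_W by blast
  then show "a \<otimes>\<^bsub>W\<^esub> b \<otimes>\<^bsub>W\<^esub> c = a \<otimes>\<^bsub>W\<^esub> (b \<otimes>\<^bsub>W\<^esub> c)" by (simp add: mult_W)
next
  fix a assume "a \<in> carrier W"
  then obtain x where x: "x \<in> words" "a = cl x" unfolding carrier_W by blast
  have "cl (rev x) \<otimes>\<^bsub>W\<^esub> a = \<one>\<^bsub>W\<^esub>"
    using x ceq_rev_left[OF x(1)] cl_iff[of "rev x @ x" "[]"] by (simp add: mult_W one_W rev_words)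
  then show "\<exists>b\<in>carrier W. b \<otimes>\<^bsub>W\<^esub> a = \<one>\<^bsub>W\<^esub>" using x(1) unfolding carrier_W by (auto simp: rev_words)
next
  fix a b assume "a \<in> carrier W" "b \<in> carrier W"
  then obtain x y where xy: "x \<in> words" "y \<in> words" "a = cl x" "b = cl y" unfolding carrier_W by blast
  then have "x @ y \<in> words" by simp
  then show "a \<otimes>\<^bsub>W\<^esub> b \<in> carrier W" unfolding carrier_W using mult_W xy by blast
next
  fix a assume "a \<in> carrier W"
  then obtain x where "x \<in> words" "a = cl x" unfolding carrier_W by blast
  then show "\<one>\<^bsub>W\<^esub> \<otimes>\<^bsub>W\<^esub> a = a" using mult_W[of "[]" x] by (simp add: one_W)
qed (simp add: one_W carrier_W)

lemma inv_W: "x \<in> words \<Longrightarrow> inv\<^bsub>W\<^esub> (cl x) = cl (rev x)"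
  using group.inv_equality[OF group_W, of "cl (rev x)" "cl x"] ceq_rev_left[of x] cl_iff[of "rev x @ x" "[]"]
  by (simp add: carrier_W mult_W one_W rev_words)

lemma ceq_length_red: "reduced x \<Longrightarrow> x \<sim> y \<Longrightarrow> reduced y \<longleftrightarrow> length y = length x"
  using red_ceq[of x y] ceq_sym[of x y] unfolding reduced_def by (auto intro: antisym)

lemma cox_length_cl: "reduced x \<Longrightarrow> cox_length (cl x) = length x"
  unfolding cox_length_def
proof (rule Least_equality)
  assume x: "reduced x"
  show "\<exists>y\<in>cl x. length y = length x" using ceq_refl[OF red_words[OF x]] by (auto simp: cox_class_def)
  fix n assume "\<exists>y\<in>cl x. length y = n"
  then show "length x \<le> n" using x by (auto simp: reduced_def cox_class_def)
qed

lemma reduced_expr_cl: "reduced x \<Longrightarrow> reduced_expr (cl x) y \<longleftrightarrow> x \<sim> y \<and> reduced y"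
  using ceq_length_red by (auto simp: reduced_expr_def cox_length_cl cl_mem)

lemma W_red: "w \<in> carrier W \<Longrightarrow> \<exists>x. reduced x \<and> w = cl x"
proof -
  assume "w \<in> carrier W"
  then obtain x where x: "x \<in> words" "w = cl x" unfolding carrier_W by blast
  then obtain y where "x \<sim> y" "reduced y" using red_exists by blast
  then show "\<exists>x. reduced x \<and> w = cl x" using cl_iff[OF x(1)] x(2) by blast
qed

lemma red_cl_carrier: "reduced x \<Longrightarrow> cl x \<in> carrier W" using red_words by (auto simp: carrier_W)

lemma FC_Nil: "FC []" and FC_single: "FC [s]"
  using commuting_FC commuting_single by (auto simp: commuting_def)

lemma gen_cl: "gen X s = cl [s]" by (simp add: gen_def)

section \<open>Dihedral subgroups and complex elements\<close>

lemma dihedral_words: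
  assumes "link s t" "x \<in> lists {s, t}"
  shows "\<exists>y\<in>{[], [s], [t], [s, t], [t, s], [s, t, s]}. x \<sim> y"
  using assms(2)
proof (induction x)
  case Nil
  then show ?case using ceq_refl[of "[]"] by auto
next
  case (Cons a x)
  have st: "s \<in> nodes X" "t \<in> nodes X" using assms(1) by (auto simp: link_def)
  obtain y where y: "y \<in> {[], [s], [t], [s, t], [t, s], [s, t, s]}" "x \<sim> y" using Cons by blast
  have a: "a \<in> {s, t}" using Cons by simp
  have ax: "a # x \<sim> a # y" using ceq_Cons[OF y(2)] a st by auto
  have c: "[s, s] \<sim> []" "[t, t] \<sim> []" "[s, s, t] \<sim> [t]" "[t, t, s] \<sim> [s]" "[s, s, t, s] \<sim> [t, s]"
    using ceq_cancel[of "[]" "[]" s] ceq_cancel[of "[]" "[]" t] ceq_cancel[of "[]" "[t]" s]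
      ceq_cancel[of "[]" "[s]" t] ceq_cancel[of "[]" "[t, s]" s] st by auto
  have tst: "[t, s, t] \<sim> [s, t, s]" using ceq_sym[OF ceq_braid[OF assms(1)]] .
  have "t # [s, t, s] \<sim> t # [t, s, t]" using ceq_Cons[OF ceq_braid[OF assms(1)] st(2)] .
  also have "t # [t, s, t] \<sim> [s, t]" using ceq_cancel[of "[]" "[s, t]" t] st by simp
  finally have tsts: "[t, s, t, s] \<sim> [s, t]" .
  have w: "[s] \<sim> [s]" "[t] \<sim> [t]" "[s, t] \<sim> [s, t]" "[t, s] \<sim> [t, s]" "[s, t, s] \<sim> [s, t, s]"
    using st by (auto intro: ceq_refl)
  have "\<exists>z\<in>{[], [s], [t], [s, t], [t, s], [s, t, s]}. a # y \<sim> z"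
    using y(1) a c tst tsts w by auto
  then show ?case using ceq_trans[OF ax] by blast
qed

lemma dihedral_eq:
  assumes "link s t"
  shows "dihedral X s t = cl ` {[], [s], [t], [s, t], [t, s], [s, t, s]}"
proof
  have st: "s \<in> nodes X" "t \<in> nodes X" using assms by (auto simp: link_def)
  have w: "x \<in> words" if "x \<in> lists {s, t}" for x using that st by auto
  show "dihedral X s t \<subseteq> cl ` {[], [s], [t], [s, t], [t, s], [s, t, s]}"
  proof
    fix g assume "g \<in> dihedral X s t"
    then have "\<exists>x\<in>lists {s, t}. g = cl x"
      unfolding dihedral_def gen_cl
    proof (induction rule: generate.induct)
      case one
      then show ?case using one_W by (intro bexI[of _ "[]"]) auto
    next
      case (incl h)
      then show ?case by auto
    next
      case (inv h)
      then obtain a where "a \<in> {s, t}" "h = cl [a]" by auto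
      then show ?case using inv_W[of "[a]"] st by (intro bexI[of _ "[a]"]) auto
    next
      case (eng g h)
      then obtain x y where "x \<in> lists {s, t}" "y \<in> lists {s, t}" "g = cl x" "h = cl y" by blast
      then show ?case using mult_W[OF w w] by (intro bexI[of _ "x @ y"]) auto
    qed
    then obtain x where x: "x \<in> lists {s, t}" "g = cl x" by blast
    obtain y where "y \<in> {[], [s], [t], [s, t], [t, s], [s, t, s]}" "x \<sim> y"
      using dihedral_words[OF assms x(1)] by blast
    then show "g \<in> cl ` {[], [s], [t], [s, t], [t, s], [s, t, s]}"
      using x cl_iff[OF w[OF x(1)]] by blast
  qed
  have g: "cl [s] \<in> dihedral X s t" "cl [t] \<in> dihedral X s t" "cl [] \<in> dihedral X s t"
    unfolding dihedral_def gen_cl one_W[symmetric] by (auto intro: generate.intros)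
  have m: "cl (x @ y) \<in> dihedral X s t" if "cl x \<in> dihedral X s t" "cl y \<in> dihedral X s t" "x \<in> words" "y \<in> words" for x y
    using generate.eng[OF that(1,2)[unfolded dihedral_def]] mult_W[OF that(3,4)] by (simp add: dihedral_def)
  have "cl [s, t] \<in> dihedral X s t" "cl [t, s] \<in> dihedral X s t"
    using m[of "[s]" "[t]"] m[of "[t]" "[s]"] g st by auto
  moreover from this have "cl [s, t, s] \<in> dihedral X s t" using m[of "[s]" "[t, s]"] g st by auto
  ultimately show "cl ` {[], [s], [t], [s, t], [t, s], [s, t, s]} \<subseteq> dihedral X s t" using g by auto
qed

lemma dihedral_red:
  assumes "link s t" "x \<in> {[], [s], [t], [s, t], [t, s], [s, t, s]}"
  shows "reduced x"
  using assms FC_red[OF FC_Nil] FC_red[OF FC_single] FC_red[OF FC_pair] red_braid E_sym[OF assms(1)]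
  by (auto simp: link_def)

text \<open>
  Apart from \<open>s t s\<close>, which is the only one of length 3, these words are irreducible, and so they are
  determined by the element up to commutations.
\<close>
lemma dihedral_inj:
  assumes "link s t"
  shows "inj_on cl {[], [s], [t], [s, t], [t, s], [s, t, s]}"
proof (rule inj_onI)
  fix x y assume x: "x \<in> {[], [s], [t], [s, t], [t, s], [s, t, s]}"
    and y: "y \<in> {[], [s], [t], [s, t], [t, s], [s, t, s]}" and e: "cl x = cl y"
  have c: "x \<sim> y" using cl_iff red_words[OF dihedral_red[OF assms x]] e by blast
  have l: "length x = length y"
    using cox_length_cl[OF dihedral_red[OF assms x]] cox_length_cl[OF dihedral_red[OF assms y]] e by simp
  have "x = y" if "FC x" "x \<noteq> [s, t, s]"
  proof -
    have "y \<approx> x" using FC_shortest(2)[OF that(1) c] l by simp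
    then show ?thesis
      using x y l that(2) link_not_commute[OF assms] link_not_commute[OF E_sym[OF assms]] trace_eq_set[of ind y x] by auto
  qed
  moreover have "FC x" if "x \<noteq> [s, t, s]"
    using that x FC_Nil FC_single FC_pair[OF assms] FC_pair[OF E_sym[OF assms]] by auto
  ultimately show "x = y" using x y l by (cases "x = [s, t, s]") auto
qed

lemma longest_eq:
  assumes "link s t"
  shows "longest X s t = cl [s, t, s]"
  unfolding longest_def
proof (rule arg_maxI)
  show "cl [s, t, s] \<in> dihedral X s t" using dihedral_eq[OF assms] by blast
  fix w assume w: "w \<in> dihedral X s t"
  then obtain x where x: "x \<in> {[], [s], [t], [s, t], [t, s], [s, t, s]}" "w = cl x" using dihedral_eq[OF assms] by blast
  have l: "cox_length w = length x" using cox_length_cl[OF dihedral_red[OF assms x(1)]] x(2) by simp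
  have l3: "cox_length (cl [s, t, s]) = 3" using cox_length_cl[OF red_braid[OF assms]] by simp
  show "\<not> cox_length w > cox_length (cl [s, t, s])" using l l3 x(1) by auto
  assume "\<forall>y. y \<in> dihedral X s t \<longrightarrow> \<not> cox_length y > cox_length w"
  then have "\<not> 3 > length x" using l l3 \<open>cl [s, t, s] \<in> dihedral X s t\<close> by metis
  then show "w = cl [s, t, s]" using x by auto
qed

text \<open>
  A reduced word is reducible only by \<open>s t s\<close>, and this exhibits the longest element of a dihedral
  subgroup as a factor.  Conversely, a factorization of an irreducible element through \<open>s t s\<close> would give a word of
  the same length, which is equivalent to \<open>x\<close> by commutations and yet reducible.
\<close>
lemma W_c_iff:
  assumes x: "reduced x"
  shows "cl x \<in> W_c X \<longleftrightarrow> FC x"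
proof
  assume c: "cl x \<in> W_c X"
  show "FC x" unfolding FC_def tstep_def
  proof (rule notI, elim exE conjE)
    fix c y x' y' assume x': "x \<approx> x'" "rstep c x' y'"
    have cx: "x \<sim> x'" using teq_ceq[OF x'(1) red_words[OF x]] .
    have r: "reduced x'" using red_ceq[OF x cx] trace_eq_length[OF x'(1)] by simp
    from x'(2) show False
    proof cases
      case (loop p s r')
      then have "reduced [s, s]" using red_factor[of p "[s, s]" r'] r by simp
      moreover from this have "[s, s] \<sim> []" using ceq_cancel[of "[]" "[]" s] by (simp add: reduced_def)
      ultimately show False unfolding reduced_def by fastforce
    next
      case (zigzag s t p r')
      then have rr: "reduced p" "reduced r'" "reduced [s, t, s]"
        using red_factor[of "[]" p "[s, t, s] @ r'"] red_factor[of "p @ [s, t, s]" r' "[]"] red_factor[of p "[s, t, s]" r'] r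
        by auto
      have "cl x = cl (p @ [s, t, s] @ r')" using cl_iff[OF red_words[OF x]] cx zigzag by simp
      also have "\<dots> = cl p \<otimes>\<^bsub>W\<^esub> longest X s t \<otimes>\<^bsub>W\<^esub> cl r'"
        using rr[THEN red_words] longest_eq[OF zigzag(4)] by (simp add: mult_W)
      finally have e: "cl x = cl p \<otimes>\<^bsub>W\<^esub> longest X s t \<otimes>\<^bsub>W\<^esub> cl r'" .
      have l: "cox_length (cl x) = cox_length (cl p) + cox_length (longest X s t) + cox_length (cl r')"
        unfolding cox_length_cl[OF x] cox_length_cl[OF rr(1)] cox_length_cl[OF rr(2)]
          longest_eq[OF zigzag(4)] cox_length_cl[OF rr(3)]
        using zigzag trace_eq_length[OF x'(1)] by simp
      have "complex_elt X (cl x)" unfolding complex_elt_def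
        by (rule bexI[of _ s], rule bexI[of _ t], intro conjI, rule conjunct2[OF conjunct2[OF zigzag(4)[unfolded link_def]]],
            rule bexI[OF _ red_cl_carrier[OF rr(1)]], rule bexI[OF _ red_cl_carrier[OF rr(2)]])
          (use e l zigzag(4) in \<open>auto simp only: link_def\<close>)
      then show False using c by (simp add: W_c_def)
    qed
  qed
next
  assume FC: "FC x"
  have "\<not> complex_elt X (cl x)" unfolding complex_elt_def
  proof (rule notI, elim bexE conjE)
    fix s t x1 x2 assume st: "s \<in> nodes X" "t \<in> nodes X" "adj X s t" and x12: "x1 \<in> carrier W" "x2 \<in> carrier W"
      and e: "cl x = x1 \<otimes>\<^bsub>W\<^esub> longest X s t \<otimes>\<^bsub>W\<^esub> x2"
      and l: "cox_length (cl x) = cox_length x1 + cox_length (longest X s t) + cox_length x2"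
    have lk: "link s t" using st by (simp add: link_def)
    obtain p where p: "reduced p" "x1 = cl p" using W_red x12 by blast
    obtain r where r: "reduced r" "x2 = cl r" using W_red x12 by blast
    have "cl x = cl (p @ [s, t, s] @ r)"
      using e p r lk st red_words by (simp add: mult_W longest_eq)
    then have 1: "x \<sim> p @ [s, t, s] @ r" using cl_iff red_words[OF x] by blast
    have "length x = length (p @ [s, t, s] @ r)"
      using l p r lk x cox_length_cl[OF red_braid[OF lk]] by (simp add: cox_length_cl longest_eq)
    then have "p @ [s, t, s] @ r \<approx> x" using FC_shortest(2)[OF FC 1] by simp
    then have "FC (p @ [s, t, s] @ r)" using FC FC_teq teq_sym by blast
    then show False using rstep_tstep[OF rstep.zigzag[OF lk]] unfolding FC_def by blast
  qed
  then show "cl x \<in> W_c X" using red_cl_carrier[OF x] by (simp add: W_c_def)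
qed

lemma W_cE:
  assumes "w \<in> W_c X" obtains x where "FC x" "reduced x" "w = cl x"
  using assms W_red[of w] W_c_iff by (auto simp: W_c_def)

lemma W_c_FC: "FC x \<Longrightarrow> x \<in> words \<Longrightarrow> cl x \<in> W_c X"
  using W_c_iff[OF FC_red] by blast

end

section \<open>Algebras over Laurent polynomials\<close>

lemma laurent_ring_simps [simp]:
  "carrier laurent_ring = UNIV" "monoid.mult laurent_ring = (*)" "add laurent_ring = (+)"
  "one laurent_ring = 1" "zero laurent_ring = 0"
  by (simp_all add: laurent_ring_def)

definition coeff_scale :: "laurent \<Rightarrow> ('i \<Rightarrow>\<^sub>0 laurent) \<Rightarrow> ('i \<Rightarrow>\<^sub>0 laurent)" where
  "coeff_scale a f = Poly_Mapping.map ((*) a) f"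

lemma lookup_coeff_scale [simp]: "Poly_Mapping.lookup (coeff_scale a f) i = a * Poly_Mapping.lookup f i"
  by (simp add: coeff_scale_def Poly_Mapping.map.rep_eq when_def)

lemma keys_coeff_scale: "Poly_Mapping.keys (coeff_scale a f) \<subseteq> Poly_Mapping.keys f"
  by (auto simp: in_keys_iff)

text \<open>
  Associative algebras over the Laurent polynomials; they need not be commutative.
\<close>
locale laurent_algebra = ring M + smodule: module laurent_ring M for M :: "(laurent, 'm) module" (structure) +
  assumes smult_mult_left: "x \<in> carrier M \<Longrightarrow> y \<in> carrier M \<Longrightarrow> (a \<odot> x) \<otimes> y = a \<odot> (x \<otimes> y)"
    and smult_mult_right: "x \<in> carrier M \<Longrightarrow> y \<in> carrier M \<Longrightarrow> x \<otimes> (a \<odot> y) = a \<odot> (x \<otimes> y)"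
begin

lemma smult_closed [simp]: "x \<in> carrier M \<Longrightarrow> a \<odot> x \<in> carrier M"
  using smodule.smult_closed by simp
lemma smult_add_left: "x \<in> carrier M \<Longrightarrow> (a + b) \<odot> x = a \<odot> x \<oplus> b \<odot> x"
  using smodule.smult_l_distr[of a b x] by simp
lemma smult_add_right: "x \<in> carrier M \<Longrightarrow> y \<in> carrier M \<Longrightarrow> a \<odot> (x \<oplus> y) = a \<odot> x \<oplus> a \<odot> y"
  using smodule.smult_r_distr[of a x y] by simp
lemma smult_assoc: "x \<in> carrier M \<Longrightarrow> (a * b) \<odot> x = a \<odot> (b \<odot> x)"
  using smodule.smult_assoc1[of a b x] by simp
lemma smult_one [simp]: "x \<in> carrier M \<Longrightarrow> 1 \<odot> x = x"
  using smodule.smult_one by simp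

lemma add_cancel_self: "x \<in> carrier M \<Longrightarrow> x \<oplus> x = x \<Longrightarrow> x = \<zero>"
  using add.l_cancel_one[of x x] by simp

lemma smult_zero_left [simp]: "x \<in> carrier M \<Longrightarrow> 0 \<odot> x = \<zero>"
  using smult_add_left[of x 0 0] by (intro add_cancel_self) auto
lemma smult_zero_right [simp]: "a \<odot> \<zero> = \<zero>"
  using smult_add_right[of \<zero> \<zero> a] by (intro add_cancel_self) auto
lemma smult_minus_left: "x \<in> carrier M \<Longrightarrow> (- a) \<odot> x = \<ominus> (a \<odot> x)"
  using smult_add_left[of x "- a" a] by (intro minus_equality[symmetric]) auto

lemma finsum_induct:
  assumes "finite A" "\<And>i. i \<in> A \<Longrightarrow> f i \<in> carrier M \<and> P (f i)" "P \<zero>"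
    "\<And>x y. x \<in> carrier M \<Longrightarrow> y \<in> carrier M \<Longrightarrow> P x \<Longrightarrow> P y \<Longrightarrow> P (x \<oplus> y)"
  shows "P (finsum M f A)"
  using assms(1,2)
proof (induction A rule: finite_induct)
  case (insert i A)
  then have "f \<in> A \<rightarrow> carrier M" "f i \<in> carrier M" by auto
  then show ?case using insert assms(4) by (simp add: finsum_closed)
qed (simp add: assms(3))

lemma lincomb_superset:
  assumes "finite A" "Poly_Mapping.keys f \<subseteq> A" "\<And>i. i \<in> A \<Longrightarrow> c i \<in> carrier M"
  shows "lincomb M c f = (\<Oplus>i\<in>A. Poly_Mapping.lookup f i \<odot> c i)"
  unfolding lincomb_def
  by (rule add.finprod_mono_neutral_cong_left[OF assms(1,2)])
    (use assms in \<open>auto simp: in_keys_iff\<close>)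

lemma lincomb_closed:
  "(\<And>i. i \<in> I \<Longrightarrow> c i \<in> carrier M) \<Longrightarrow> Poly_Mapping.keys f \<subseteq> I \<Longrightarrow> lincomb M c f \<in> carrier M"
  unfolding lincomb_def by (rule finsum_closed) auto

lemma lincomb_zero [simp]: "lincomb M c 0 = \<zero>"
  by (simp add: lincomb_def)

lemma lincomb_single:
  assumes "c i \<in> carrier M" shows "lincomb M c (Poly_Mapping.single i a) = a \<odot> c i"
  using lincomb_superset[of "{i}" "Poly_Mapping.single i a" c] assms by simp

lemma lincomb_add:
  assumes c: "\<And>i. i \<in> I \<Longrightarrow> c i \<in> carrier M" and f: "Poly_Mapping.keys f \<subseteq> I" and g: "Poly_Mapping.keys g \<subseteq> I"
  shows "lincomb M c (f + g) = lincomb M c f \<oplus> lincomb M c g"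
proof -
  let ?A = "Poly_Mapping.keys f \<union> Poly_Mapping.keys g"
  have A: "\<And>i. i \<in> ?A \<Longrightarrow> c i \<in> carrier M" using c f g by blast
  have l: "lincomb M c h = (\<Oplus>i\<in>?A. Poly_Mapping.lookup h i \<odot> c i)"
    if "Poly_Mapping.keys h \<subseteq> ?A" for h
    by (rule lincomb_superset[OF _ that A]) auto
  have "lincomb M c (f + g) = (\<Oplus>i\<in>?A. Poly_Mapping.lookup (f + g) i \<odot> c i)"
    by (rule l[OF keys_add])
  also have "\<dots> = (\<Oplus>i\<in>?A. Poly_Mapping.lookup f i \<odot> c i \<oplus> Poly_Mapping.lookup g i \<odot> c i)"
    by (rule finsum_cong') (use A in \<open>auto simp: lookup_add smult_add_left\<close>)
  also have "\<dots> = (\<Oplus>i\<in>?A. Poly_Mapping.lookup f i \<odot> c i) \<oplus> (\<Oplus>i\<in>?A. Poly_Mapping.lookup g i \<odot> c i)"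
    by (rule finsum_addf) (use A in auto)
  also have "\<dots> = lincomb M c f \<oplus> lincomb M c g" by (simp add: l)
  finally show ?thesis .
qed

lemma lincomb_scale:
  assumes c: "\<And>i. i \<in> I \<Longrightarrow> c i \<in> carrier M" and f: "Poly_Mapping.keys f \<subseteq> I"
  shows "lincomb M c (coeff_scale a f) = a \<odot> lincomb M c f"
proof -
  let ?A = "Poly_Mapping.keys f"
  have A: "\<And>i. i \<in> ?A \<Longrightarrow> c i \<in> carrier M" using c f by blast
  have "lincomb M c (coeff_scale a f) = (\<Oplus>i\<in>?A. a \<odot> (Poly_Mapping.lookup f i \<odot> c i))"
    using A keys_coeff_scale[of a f]
    by (subst lincomb_superset[of ?A]) (auto simp: smult_assoc intro!: finsum_cong')
  also have "\<dots> = a \<odot> lincomb M c f"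
    unfolding lincomb_def using smodule.finsum_smult_ldistr[of ?A a "\<lambda>i. Poly_Mapping.lookup f i \<odot> c i"] A by simp
  finally show ?thesis .
qed

lemma lincomb_induct:
  assumes "\<And>i. i \<in> Poly_Mapping.keys f \<Longrightarrow> c i \<in> carrier M" "P \<zero>"
    "\<And>x y. x \<in> carrier M \<Longrightarrow> y \<in> carrier M \<Longrightarrow> P x \<Longrightarrow> P y \<Longrightarrow> P (x \<oplus> y)"
    "\<And>i. i \<in> Poly_Mapping.keys f \<Longrightarrow> P (Poly_Mapping.lookup f i \<odot> c i)"
  shows "P (lincomb M c f)"
  unfolding lincomb_def by (rule finsum_induct) (use assms in auto)

lemma basis_functional:
  assumes b: "is_basis UNIV M (carrier M) I c"
  obtains \<phi> :: "'m \<Rightarrow> laurent" where "\<And>x y. x \<in> carrier M \<Longrightarrow> y \<in> carrier M \<Longrightarrow> \<phi> (x \<oplus> y) = \<phi> x + \<phi> y"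
    "\<And>a x. x \<in> carrier M \<Longrightarrow> \<phi> (a \<odot> x) = a * \<phi> x" "\<And>i. i \<in> I \<Longrightarrow> \<phi> (c i) = g i"
proof -
  have c: "\<And>i. i \<in> I \<Longrightarrow> c i \<in> carrier M" using b by (auto simp: is_basis_def)
  define co where "co x = (SOME f. Poly_Mapping.keys f \<subseteq> I \<and> lincomb M c f = x)" for x
  have co: "Poly_Mapping.keys (co x) \<subseteq> I \<and> lincomb M c (co x) = x" if "x \<in> carrier M" for x
  proof -
    have "x \<in> lincomb M c ` coeffs UNIV I" using b that by (simp add: is_basis_def)
    then obtain f where "Poly_Mapping.keys f \<subseteq> I \<and> lincomb M c f = x" by (auto simp: coeffs_def)
    then show ?thesis unfolding co_def by (rule someI)
  qed
  have add: "lincomb M c (f + g) = lincomb M c f \<oplus> lincomb M c g"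
    if "Poly_Mapping.keys f \<subseteq> I" "Poly_Mapping.keys g \<subseteq> I" for f g
    by (rule lincomb_add[where I = I]) (use c that in auto)
  have scl: "lincomb M c (coeff_scale a f) = a \<odot> lincomb M c f" if "Poly_Mapping.keys f \<subseteq> I" for f a
    by (rule lincomb_scale[where I = I]) (use c that in auto)
  have uniq: "f = g" if fg: "Poly_Mapping.keys f \<subseteq> I" "Poly_Mapping.keys g \<subseteq> I" "lincomb M c f = lincomb M c g" for f g
  proof -
    have k: "Poly_Mapping.keys (coeff_scale (- 1) g) \<subseteq> I" by (rule subset_trans[OF keys_coeff_scale fg(2)])
    have "lincomb M c (f + coeff_scale (- 1) g) = lincomb M c f \<oplus> (- 1) \<odot> lincomb M c g"
      unfolding add[OF fg(1) k] scl[OF fg(2)] ..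
    also have "\<dots> = \<zero>" using fg(3) lincomb_closed[OF c fg(2)] by (simp add: smult_minus_left r_neg)
    finally have z: "lincomb M c (f + coeff_scale (- 1) g) = \<zero>" .
    have "f + coeff_scale (- 1) g \<in> coeffs UNIV I" using fg(1) k keys_add[of f "coeff_scale (- 1) g"] by (auto simp: coeffs_def)
    moreover have "\<forall>f\<in>coeffs UNIV I. lincomb M c f = \<zero> \<longrightarrow> f = 0" using b by (simp add: is_basis_def)
    ultimately have "f + coeff_scale (- 1) g = 0" using z by simp
    then have "Poly_Mapping.lookup (f + coeff_scale (- 1) g) i = 0" for i by simp
    then show ?thesis by (intro poly_mapping_eqI) (simp add: lookup_add)
  qed
  define \<phi> where "\<phi> x = (\<Sum>i\<in>Poly_Mapping.keys (co x). Poly_Mapping.lookup (co x) i * g i)" for x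
  have ext_sum: "(\<Sum>i\<in>Poly_Mapping.keys f. Poly_Mapping.lookup f i * g i) = (\<Sum>i\<in>A. Poly_Mapping.lookup f i * g i)"
    if "finite A" "Poly_Mapping.keys f \<subseteq> A" for f A
    by (rule sum.mono_neutral_left[OF that]) (auto simp: in_keys_iff)
  show ?thesis
  proof (rule that[of \<phi>])
    fix x y assume xy: "x \<in> carrier M" "y \<in> carrier M"
    have "co (x \<oplus> y) = co x + co y"
      by (rule uniq) (use co[of x] co[of y] co[of "x \<oplus> y"] xy add[of "co x" "co y"]
        subset_trans[OF keys_add[of "co x" "co y"], of I] in auto)
    then show "\<phi> (x \<oplus> y) = \<phi> x + \<phi> y"
      unfolding \<phi>_def
      using ext_sum[where A = "Poly_Mapping.keys (co x) \<union> Poly_Mapping.keys (co y)" and f = "co x"]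
        ext_sum[where A = "Poly_Mapping.keys (co x) \<union> Poly_Mapping.keys (co y)" and f = "co y"]
        ext_sum[where A = "Poly_Mapping.keys (co x) \<union> Poly_Mapping.keys (co y)" and f = "co x + co y"]
        keys_add[of "co x" "co y"]
      by (simp add: lookup_add distrib_right sum.distrib)
  next
    fix a x assume x: "x \<in> carrier M"
    have "co (a \<odot> x) = coeff_scale a (co x)"
      by (rule uniq) (use co x scl[of "co x" a] keys_coeff_scale[of a "co x"] in auto)
    then show "\<phi> (a \<odot> x) = a * \<phi> x"
      unfolding \<phi>_def using ext_sum[where A = "Poly_Mapping.keys (co x)" and f = "coeff_scale a (co x)"] keys_coeff_scale[of a "co x"]
      by (simp add: sum_distrib_left mult.assoc)
  next
    fix i assume i: "i \<in> I"
    have "co (c i) = Poly_Mapping.single i 1"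
      by (rule uniq) (use co c i lincomb_single[of c i 1] in auto)
    then show "\<phi> (c i) = g i" by (simp add: \<phi>_def)
  qed
qed

end

lemma v_vinv [simp]: "v * vinv = 1" "vinv * v = 1"
  by (simp_all add: v_def vinv_def mult_single)

section \<open>The Hecke algebra\<close>

text \<open>
  The loop value that belongs to \<open>u = v\<close>.
\<close>
definition delta :: laurent where "delta = v + vinv"

lemma v_delta: "v * v + 1 = v * delta" by (simp add: delta_def algebra_simps)

context simple_graph begin

lemma fold_lact_linear:
  "fold (lact u) x (\<lambda>z. a * F z + b * G z) = (\<lambda>z. a * fold (lact u) x F z + b * fold (lact u) x G z)"
proof (induction x arbitrary: F G)
  case (Cons s x)
  have "lact u s (\<lambda>z. a * F z + b * G z) = (\<lambda>z. a * lact u s F z + b * lact u s G z)"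
    by (auto simp: lact_def algebra_simps)
  then show ?case using Cons by simp
qed simp

end

text \<open>
  If there are no nodes, the algebra has rank one, and its basis vector could be any generator of the
  module instead of the unit.  One node is enough to force \<open>T\<^sub>e = 1\<close>.
\<close>
locale hecke = simply_laced X for X :: "'a coxeter_graph" +
  fixes H :: "(laurent, 'h) module" and T :: "'a list set \<Rightarrow> 'h"
  assumes hecke: "hecke_algebra X H T" and nonempty: "nodes X \<noteq> {}"
begin

sublocale H: laurent_algebra H
  using hecke unfolding hecke_algebra_def laurent_algebra_def laurent_algebra_axioms_def by blast

lemma T_basis: "is_basis UNIV H (carrier H) (carrier W) T"
  using hecke unfolding hecke_algebra_def by blast

lemma T_closed: "w \<in> carrier W \<Longrightarrow> T w \<in> carrier H"
  using T_basis unfolding is_basis_def by blast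

lemma T_cl_closed [simp]: "x \<in> words \<Longrightarrow> T (cl x) \<in> carrier H"
  using T_closed by (auto simp: carrier_W)

lemma T_up:
  assumes "reduced (s # x)"
  shows "T (cl [s]) \<otimes>\<^bsub>H\<^esub> T (cl x) = T (cl (s # x))"
proof -
  have x: "reduced x" "s \<in> nodes X" "x \<in> words" using red_ConsD[OF assms] red_words[OF assms] by auto
  have m: "gen X s \<otimes>\<^bsub>W\<^esub> cl x = cl (s # x)" using x by (simp add: gen_cl mult_W)
  have "\<forall>s\<in>nodes X. \<forall>w\<in>carrier W. let sw = gen X s \<otimes>\<^bsub>W\<^esub> w in
      (cox_length sw > cox_length w \<longrightarrow> T (gen X s) \<otimes>\<^bsub>H\<^esub> T w = T sw) \<and>
      (cox_length sw < cox_length w \<longrightarrow>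
        T (gen X s) \<otimes>\<^bsub>H\<^esub> T w = (q \<odot>\<^bsub>H\<^esub> T sw) \<oplus>\<^bsub>H\<^esub> ((q - 1) \<odot>\<^bsub>H\<^esub> T w))"
    using hecke unfolding hecke_algebra_def by blast
  from bspec[OF bspec[OF this x(2)] red_cl_carrier[OF x(1)]] show ?thesis
    using m cox_length_cl[OF assms] cox_length_cl[OF x(1)] by (simp add: Let_def gen_cl)
qed

lemma T_down:
  assumes "reduced (s # y)"
  shows "T (cl [s]) \<otimes>\<^bsub>H\<^esub> T (cl (s # y)) = q \<odot>\<^bsub>H\<^esub> T (cl y) \<oplus>\<^bsub>H\<^esub> (q - 1) \<odot>\<^bsub>H\<^esub> T (cl (s # y))"
proof -
  have x: "reduced y" "s \<in> nodes X" "y \<in> words" using red_ConsD[OF assms] red_words[OF assms] by auto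
  have "cl (s # s # y) = cl y" using cl_iff[of "s # s # y" y] ceq_cancel[of "[]" y s] x by simp
  then have m: "gen X s \<otimes>\<^bsub>W\<^esub> cl (s # y) = cl y" using x by (simp add: gen_cl mult_W)
  have "\<forall>s\<in>nodes X. \<forall>w\<in>carrier W. let sw = gen X s \<otimes>\<^bsub>W\<^esub> w in
      (cox_length sw > cox_length w \<longrightarrow> T (gen X s) \<otimes>\<^bsub>H\<^esub> T w = T sw) \<and>
      (cox_length sw < cox_length w \<longrightarrow>
        T (gen X s) \<otimes>\<^bsub>H\<^esub> T w = (q \<odot>\<^bsub>H\<^esub> T sw) \<oplus>\<^bsub>H\<^esub> ((q - 1) \<odot>\<^bsub>H\<^esub> T w))"
    using hecke unfolding hecke_algebra_def by blast
  from bspec[OF bspec[OF this x(2)] red_cl_carrier[OF assms]] show ?thesis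
    using m cox_length_cl[OF assms] cox_length_cl[OF x(1)] by (simp add: Let_def gen_cl)
qed

lemma hecke_induct:
  assumes "h \<in> carrier H" "P \<zero>\<^bsub>H\<^esub>"
    "\<And>x y. x \<in> carrier H \<Longrightarrow> y \<in> carrier H \<Longrightarrow> P x \<Longrightarrow> P y \<Longrightarrow> P (x \<oplus>\<^bsub>H\<^esub> y)"
    "\<And>a x. x \<in> carrier H \<Longrightarrow> P x \<Longrightarrow> P (a \<odot>\<^bsub>H\<^esub> x)" "\<And>x. reduced x \<Longrightarrow> P (T (cl x))"
  shows "P h"
proof -
  have "h \<in> lincomb H T ` coeffs UNIV (carrier W)" using T_basis assms(1) by (simp add: is_basis_def)
  then obtain f where f: "Poly_Mapping.keys f \<subseteq> carrier W" "h = lincomb H T f" by (auto simp: coeffs_def)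
  have PT: "P (T w)" if "w \<in> carrier W" for w using W_red[OF that] assms(5) by blast
  have "P (lincomb H T f)"
    by (rule H.lincomb_induct) (use f assms(2-4) T_closed PT in auto)
  then show ?thesis using f by simp
qed

text \<open>
  Comparing \<open>T\<^sub>s T\<^sub>s T\<^sub>e\<close> with \<open>T\<^sub>s T\<^sub>s\<close> shows that \<open>T\<^sub>e\<close> is idempotent, as \<open>q\<close> is invertible.  All basis vectors, and so
  the unit as well, are left multiples of \<open>T\<^sub>e\<close>.  If \<open>1 = z T\<^sub>e\<close>, then
  \<open>T\<^sub>e = z T\<^sub>e T\<^sub>e = z T\<^sub>e = 1\<close>.
\<close>
lemma T_one: "T (cl []) = \<one>\<^bsub>H\<^esub>"
proof -
  let ?e = "T (cl [])"
  obtain s where s: "s \<in> nodes X" using nonempty by blast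
  let ?t = "T (cl [s])"
  have r: "reduced [s]" using FC_red[OF FC_single] s by simp
  have c: "?e \<in> carrier H" "?t \<in> carrier H" using s by auto
  have 1: "?t \<otimes>\<^bsub>H\<^esub> ?e = ?t" using T_up[OF r] by simp
  have 2: "?t \<otimes>\<^bsub>H\<^esub> ?t = q \<odot>\<^bsub>H\<^esub> ?e \<oplus>\<^bsub>H\<^esub> (q - 1) \<odot>\<^bsub>H\<^esub> ?t" using T_down[OF r] by simp
  have "q \<odot>\<^bsub>H\<^esub> ?e \<oplus>\<^bsub>H\<^esub> (q - 1) \<odot>\<^bsub>H\<^esub> ?t = ?t \<otimes>\<^bsub>H\<^esub> ?t \<otimes>\<^bsub>H\<^esub> ?e"
    using H.m_assoc[OF c(2) c(2) c(1)] unfolding 1 2 by simp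
  also have "\<dots> = q \<odot>\<^bsub>H\<^esub> (?e \<otimes>\<^bsub>H\<^esub> ?e) \<oplus>\<^bsub>H\<^esub> (q - 1) \<odot>\<^bsub>H\<^esub> ?t"
    unfolding 2 using c 1 by (simp add: H.l_distr H.smult_mult_left)
  finally have "q \<odot>\<^bsub>H\<^esub> ?e = q \<odot>\<^bsub>H\<^esub> (?e \<otimes>\<^bsub>H\<^esub> ?e)" using c by (simp add: H.add.right_cancel)
  then have "(vinv * vinv * q) \<odot>\<^bsub>H\<^esub> ?e = (vinv * vinv * q) \<odot>\<^bsub>H\<^esub> (?e \<otimes>\<^bsub>H\<^esub> ?e)"
    using c by (simp add: H.smult_assoc)
  moreover have "vinv * vinv * q = 1" by (simp add: q_def power2_eq_square mult.assoc) (simp add: mult.assoc[symmetric])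
  ultimately have ee: "?e \<otimes>\<^bsub>H\<^esub> ?e = ?e" using c by simp
  have "\<exists>z\<in>carrier H. h = z \<otimes>\<^bsub>H\<^esub> ?e" if "h \<in> carrier H" for h
    using that
  proof (rule hecke_induct)
    show "\<exists>z\<in>carrier H. \<zero>\<^bsub>H\<^esub> = z \<otimes>\<^bsub>H\<^esub> ?e" using c by (intro bexI[of _ "\<zero>\<^bsub>H\<^esub>"]) auto
  next
    fix x y assume "\<exists>z\<in>carrier H. x = z \<otimes>\<^bsub>H\<^esub> ?e" "\<exists>z\<in>carrier H. y = z \<otimes>\<^bsub>H\<^esub> ?e"
    then obtain a b where "a \<in> carrier H" "b \<in> carrier H" "x = a \<otimes>\<^bsub>H\<^esub> ?e" "y = b \<otimes>\<^bsub>H\<^esub> ?e" by blast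
    then show "\<exists>z\<in>carrier H. x \<oplus>\<^bsub>H\<^esub> y = z \<otimes>\<^bsub>H\<^esub> ?e"
      using c by (intro bexI[of _ "a \<oplus>\<^bsub>H\<^esub> b"]) (auto simp: H.l_distr)
  next
    fix a x assume "\<exists>z\<in>carrier H. x = z \<otimes>\<^bsub>H\<^esub> ?e"
    then obtain z where "z \<in> carrier H" "x = z \<otimes>\<^bsub>H\<^esub> ?e" by blast
    then show "\<exists>z\<in>carrier H. a \<odot>\<^bsub>H\<^esub> x = z \<otimes>\<^bsub>H\<^esub> ?e"
      using c by (intro bexI[of _ "a \<odot>\<^bsub>H\<^esub> z"]) (auto simp: H.smult_mult_left)
  next
    fix x assume "reduced x"
    then show "\<exists>z\<in>carrier H. T (cl x) = z \<otimes>\<^bsub>H\<^esub> ?e"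
    proof (induction x)
      case Nil
      then show ?case using c by (intro bexI[of _ "\<one>\<^bsub>H\<^esub>"]) auto
    next
      case (Cons s x)
      obtain z where z: "z \<in> carrier H" "T (cl x) = z \<otimes>\<^bsub>H\<^esub> ?e" using Cons red_ConsD by blast
      have "s \<in> nodes X" using red_words[OF Cons.prems] by simp
      then show ?case using T_up[OF Cons.prems] z c
        by (intro bexI[of _ "T (cl [s]) \<otimes>\<^bsub>H\<^esub> z"]) (auto simp: H.m_assoc)
    qed
  qed
  then obtain z where z: "z \<in> carrier H" "\<one>\<^bsub>H\<^esub> = z \<otimes>\<^bsub>H\<^esub> ?e" by blast
  have "?e = (z \<otimes>\<^bsub>H\<^esub> ?e) \<otimes>\<^bsub>H\<^esub> ?e" using c z(2)[symmetric] by simp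
  also have "\<dots> = z \<otimes>\<^bsub>H\<^esub> ?e" using c z(1) ee by (simp add: H.m_assoc)
  finally show ?thesis using z(2) by simp
qed

definition T_word :: "'a list \<Rightarrow> 'h" where
  "T_word x = foldr (\<lambda>s h. T (cl [s]) \<otimes>\<^bsub>H\<^esub> h) x \<one>\<^bsub>H\<^esub>"

lemma T_word_simps [simp]: "T_word [] = \<one>\<^bsub>H\<^esub>" "T_word (s # x) = T (cl [s]) \<otimes>\<^bsub>H\<^esub> T_word x"
  by (simp_all add: T_word_def)

lemma T_word_closed [simp]: "x \<in> words \<Longrightarrow> T_word x \<in> carrier H"
  by (induction x) auto

lemma T_red: "reduced x \<Longrightarrow> T (cl x) = T_word x"
proof (induction x)
  case (Cons s x)
  then show ?case using T_up[OF Cons.prems] red_ConsD by simp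
qed (simp add: T_one)

section \<open>Functionals on the Hecke algebra\<close>

text \<open>
  The linear functional that sends \<open>T\<^sub>w\<close> to the value of \<open>F\<close> at the product of the \<open>v b\<^sub>s - 1\<close> along a
  reduced word of \<open>w\<close>.  For admissible \<open>F\<close>, Matsumoto's theorem makes this independent of the word
  chosen (\<open>functional_T\<close>).
\<close>
definition functional :: "('a list \<Rightarrow> laurent) \<Rightarrow> 'h \<Rightarrow> laurent" where
  "functional F = (SOME \<phi>. (\<forall>x\<in>carrier H. \<forall>y\<in>carrier H. \<phi> (x \<oplus>\<^bsub>H\<^esub> y) = \<phi> x + \<phi> y) \<and>
    (\<forall>a. \<forall>x\<in>carrier H. \<phi> (a \<odot>\<^bsub>H\<^esub> x) = a * \<phi> x) \<and>
    (\<forall>w\<in>carrier W. \<phi> (T w) = fold (lact v) (SOME x. reduced_expr w x) F []))"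

lemma functional:
  shows functional_add: "x \<in> carrier H \<Longrightarrow> y \<in> carrier H \<Longrightarrow> functional F (x \<oplus>\<^bsub>H\<^esub> y) = functional F x + functional F y"
    and functional_smult: "x \<in> carrier H \<Longrightarrow> functional F (a \<odot>\<^bsub>H\<^esub> x) = a * functional F x"
    and functional_T': "w \<in> carrier W \<Longrightarrow> functional F (T w) = fold (lact v) (SOME x. reduced_expr w x) F []"
proof -
  let ?P = "\<lambda>\<phi>. (\<forall>x\<in>carrier H. \<forall>y\<in>carrier H. \<phi> (x \<oplus>\<^bsub>H\<^esub> y) = \<phi> x + \<phi> y) \<and>
    (\<forall>a. \<forall>x\<in>carrier H. \<phi> (a \<odot>\<^bsub>H\<^esub> x) = a * \<phi> x) \<and>
    (\<forall>w\<in>carrier W. \<phi> (T w) = fold (lact v) (SOME x. reduced_expr w x) F [])"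
  have "\<exists>\<phi>. ?P \<phi>"
    using H.basis_functional[OF T_basis, of "\<lambda>w. fold (lact v) (SOME x. reduced_expr w x) F []"] by metis
  then have "?P (functional F)" unfolding functional_def by (rule someI_ex)
  then show "x \<in> carrier H \<Longrightarrow> y \<in> carrier H \<Longrightarrow> functional F (x \<oplus>\<^bsub>H\<^esub> y) = functional F x + functional F y"
    "x \<in> carrier H \<Longrightarrow> functional F (a \<odot>\<^bsub>H\<^esub> x) = a * functional F x"
    "w \<in> carrier W \<Longrightarrow> functional F (T w) = fold (lact v) (SOME x. reduced_expr w x) F []" by auto
qed

lemma functional_zero [simp]: "functional F \<zero>\<^bsub>H\<^esub> = 0"
  using functional_smult[of "\<zero>\<^bsub>H\<^esub>" F 0] by simp

lemma functional_T:
  assumes "admissible delta F" "reduced x"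
  shows "functional F (T (cl x)) = fold (lact v) x F []"
proof -
  let ?y = "SOME y. reduced_expr (cl x) y"
  have "reduced_expr (cl x) ?y"
    by (rule someI[of _ x]) (use assms(2) reduced_expr_cl ceq_refl red_words in blast)
  then have "braid_eq x ?y" using reduced_expr_cl[OF assms(2)] matsumoto assms(2) by blast
  from fold_lact_braid_eq[OF assms(1) v_delta this] show ?thesis
    using functional_T'[OF red_cl_carrier[OF assms(2)]] by simp
qed

text \<open>
  Left multiplication by \<open>T\<^sub>s\<close> becomes the action on functions.  If the length goes up, this is the
  definition; if it goes down, it is the quadratic relation on both sides.
\<close>
lemma functional_left:
  assumes F: "admissible delta F" and s: "s \<in> nodes X" and h: "h \<in> carrier H"
  shows "functional F (T (cl [s]) \<otimes>\<^bsub>H\<^esub> h) = functional (lact v s F) h"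
proof -
  have c: "T (cl [s]) \<in> carrier H" using s by simp
  show ?thesis using h
  proof (rule hecke_induct)
    fix x assume x: "reduced x"
    show "functional F (T (cl [s]) \<otimes>\<^bsub>H\<^esub> T (cl x)) = functional (lact v s F) (T (cl x))"
    proof (cases "reduced (s # x)")
      case True
      then show ?thesis using T_up[OF True] functional_T[OF F True] functional_T[OF admissible_lact[OF F] x] by simp
    next
      case False
      then obtain y where y: "x \<sim> s # y" "reduced (s # y)" using red_Cons_cases[OF x s] by blast
      have ry: "reduced y" using red_ConsD[OF y(2)] .
      have e: "cl x = cl (s # y)" using cl_iff[OF red_words[OF x]] y(1) by blast
      have "functional F (T (cl [s]) \<otimes>\<^bsub>H\<^esub> T (cl x)) = q * fold (lact v) y F [] + (q - 1) * fold (lact v) y (lact v s F) []"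
        unfolding e T_down[OF y(2)] using ry y(2) red_words[OF ry] red_words[OF y(2)]
        by (simp add: functional_add functional_smult functional_T[OF F])
      also have "\<dots> = fold (lact v) y (lact v s (lact v s F)) []"
        unfolding lact_square[OF F v_delta] fold_lact_linear by (simp add: q_def power2_eq_square)
      also have "\<dots> = functional (lact v s F) (T (cl x))"
        unfolding e functional_T[OF admissible_lact[OF F] y(2)] by simp
      finally show ?thesis .
    qed
  qed (use c in \<open>simp_all add: H.r_distr H.smult_mult_right functional_add functional_smult\<close>)
qed

lemma functional_word:
  assumes "admissible delta F" "x \<in> words" "h \<in> carrier H"
  shows "functional F (T_word x \<otimes>\<^bsub>H\<^esub> h) = functional (fold (lact v) x F) h"
  using assms(1,2)
proof (induction x arbitrary: F)
  case (Cons s x)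
  then have "functional F (T_word (s # x) \<otimes>\<^bsub>H\<^esub> h) = functional F (T (cl [s]) \<otimes>\<^bsub>H\<^esub> (T_word x \<otimes>\<^bsub>H\<^esub> h))"
    using assms(3) by (simp add: H.m_assoc)
  also have "\<dots> = functional (lact v s F) (T_word x \<otimes>\<^bsub>H\<^esub> h)"
    using functional_left Cons.prems assms(3) by simp
  also have "\<dots> = functional (fold (lact v) x (lact v s F)) h"
    using Cons.IH[OF admissible_lact[OF Cons.prems(1)]] Cons.prems(2) by simp
  finally show ?case by simp
qed (use assms(3) in simp)

lemma red_Nil: "reduced []" using FC_red[OF FC_Nil] by simp

lemma functional_one: "admissible delta F \<Longrightarrow> functional F \<one>\<^bsub>H\<^esub> = F []"
  using functional_T[OF _ red_Nil] T_one by simp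

lemma functional_T_word: "admissible delta F \<Longrightarrow> x \<in> words \<Longrightarrow> functional F (T_word x) = fold (lact v) x F []"
  using functional_word[of F x "\<one>\<^bsub>H\<^esub>"] functional_one[OF admissible_fold[of delta F v x]] by simp

text \<open>
  This follows from the case of left multiplication, since the two actions on functions commute.
\<close>
lemma functional_right:
  assumes F: "admissible delta F" and s: "s \<in> nodes X" and h: "h \<in> carrier H"
  shows "functional F (h \<otimes>\<^bsub>H\<^esub> T (cl [s])) = functional (ract v s F) h"
proof -
  have c: "T (cl [s]) \<in> carrier H" using s by simp
  show ?thesis using h
  proof (rule hecke_induct)
    fix x assume x: "reduced x"
    have w: "x \<in> words" using red_words[OF x] .
    have "functional F (T (cl x) \<otimes>\<^bsub>H\<^esub> T (cl [s])) = functional (fold (lact v) x F) (T_word [s])"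
      using T_red[OF x] functional_word[OF F w c] c by simp
    also have "\<dots> = fold (lact v) x (ract v s F) []"
      using functional_T_word[OF admissible_fold[OF F], of "[s]"] s
      by (simp add: fold_lact_ract) (simp add: lact_def ract_def)
    also have "\<dots> = functional (ract v s F) (T (cl x))" using functional_T[OF admissible_ract[OF F] x] by simp
    finally show "functional F (T (cl x) \<otimes>\<^bsub>H\<^esub> T (cl [s])) = functional (ract v s F) (T (cl x))" .
  qed (use c in \<open>simp_all add: H.l_distr H.smult_mult_left functional_add functional_smult\<close>)
qed

definition null_space :: "'h set" where
  "null_space = {h \<in> carrier H. \<forall>F. admissible delta F \<longrightarrow> functional F h = 0}"

text \<open>
  Multiplication by an element of the algebra turns one admissible functional into a combination of others, so that
  the common kernel is an ideal.
\<close>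
lemma null_space_left:
  assumes "h \<in> carrier H" "k \<in> null_space" shows "h \<otimes>\<^bsub>H\<^esub> k \<in> null_space"
  using assms(1)
proof (rule hecke_induct)
  fix x assume x: "reduced x"
  have k: "k \<in> carrier H" using assms(2) by (simp add: null_space_def)
  have "functional F (T_word x \<otimes>\<^bsub>H\<^esub> k) = 0" if "admissible delta F" for F
    using functional_word[OF that red_words[OF x] k] admissible_fold[OF that] assms(2)
    by (simp add: null_space_def)
  then show "T (cl x) \<otimes>\<^bsub>H\<^esub> k \<in> null_space"
    using k red_words[OF x] T_red[OF x] by (simp add: null_space_def)
qed (use assms(2) in \<open>auto simp: null_space_def H.l_distr H.smult_mult_left functional_add functional_smult\<close>)

lemma null_space_right:
  assumes "h \<in> carrier H" "k \<in> null_space" shows "k \<otimes>\<^bsub>H\<^esub> h \<in> null_space"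
proof -
  have word: "k \<otimes>\<^bsub>H\<^esub> T_word x \<in> null_space" if "x \<in> words" "k \<in> null_space" for x k
    using that
  proof (induction x arbitrary: k rule: list.induct)
    case (Cons s x)
    have kc: "k \<in> carrier H" using Cons.prems by (simp add: null_space_def)
    have s: "s \<in> nodes X" using Cons.prems(1) by simp
    have "functional F (k \<otimes>\<^bsub>H\<^esub> T (cl [s])) = 0" if "admissible delta F" for F
      using functional_right[OF that s kc] admissible_ract[OF that] Cons.prems(2) by (simp add: null_space_def)
    then have "k \<otimes>\<^bsub>H\<^esub> T (cl [s]) \<in> null_space" using kc s by (simp add: null_space_def)
    then show ?case using Cons kc by (simp add: H.m_assoc[symmetric])
  qed (auto simp: null_space_def)
  show ?thesis using assms(1)
  proof (rule hecke_induct)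
    fix x assume x: "reduced x"
    show "k \<otimes>\<^bsub>H\<^esub> T (cl x) \<in> null_space" using word[OF red_words[OF x] assms(2)] T_red[OF x] by simp
  qed (use assms(2) in \<open>auto simp: null_space_def H.r_distr H.smult_mult_right functional_add functional_smult\<close>)
qed

lemma null_space_ideal: "ideal null_space H"
proof (rule idealI)
  show "ring H" by (rule H.ring_axioms)
  show "subgroup null_space (add_monoid H)"
  proof (rule subgroup.intro)
    fix x assume x: "x \<in> null_space"
    have "\<ominus>\<^bsub>H\<^esub> x = (- 1) \<odot>\<^bsub>H\<^esub> x" using x by (simp add: H.smult_minus_left null_space_def)
    then have "\<ominus>\<^bsub>H\<^esub> x \<in> null_space" using x by (simp add: null_space_def functional_smult)
    then show "inv\<^bsub>add_monoid H\<^esub> x \<in> null_space" by (simp add: a_inv_def)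
  qed (auto simp: null_space_def functional_add)
qed (use null_space_left null_space_right in auto)

lemma functional_finsum:
  "finite A \<Longrightarrow> A \<subseteq> carrier W \<Longrightarrow> functional F (\<Oplus>\<^bsub>H\<^esub>w\<in>A. T w) = (\<Sum>w\<in>A. functional F (T w))"
proof (induction A rule: finite_induct)
  case (insert w A)
  then have "T \<in> A \<rightarrow> carrier H" "T w \<in> carrier H" using T_closed by auto
  then show ?case using insert by (simp add: functional_add H.finsum_closed)
qed simp

abbreviation dihedral_sum :: "'a \<Rightarrow> 'a \<Rightarrow> 'h" where
  "dihedral_sum s t \<equiv> \<Oplus>\<^bsub>H\<^esub>w\<in>dihedral X s t. T w"

lemma dihedral_carrier: "link s t \<Longrightarrow> dihedral X s t \<subseteq> carrier W"
  using dihedral_eq dihedral_red red_cl_carrier by auto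

text \<open>
  With \<open>T\<^sub>s = v b\<^sub>s - 1\<close>, the sum of the six basis elements is a multiple of \<open>b\<^sub>s b\<^sub>t b\<^sub>s - b\<^sub>s\<close>.  By the ideal
  property it suffices to compute the value of \<open>F\<close> here, with no further factors.
\<close>
lemma dihedral_sum_null:
  assumes "link s t"
  shows "dihedral_sum s t \<in> null_space"
  unfolding null_space_def
proof (intro CollectI conjI allI impI)
  show "dihedral_sum s t \<in> carrier H" using dihedral_carrier[OF assms] T_closed by (intro H.finsum_closed) auto
  fix F :: "'a list \<Rightarrow> laurent" assume F: "admissible delta F"
  let ?D = "{[], [s], [t], [s, t], [t, s], [s, t, s]}"
  have ne: "s \<noteq> t" using assms E_irrefl by auto
  have "functional F (dihedral_sum s t) = (\<Sum>w\<in>cl ` ?D. functional F (T w))"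
    using functional_finsum[of "dihedral X s t" F] dihedral_carrier[OF assms] dihedral_eq[OF assms] by simp
  also have "\<dots> = (\<Sum>x\<in>?D. functional F (T (cl x)))"
    using sum.reindex[OF dihedral_inj[OF assms]] by simp
  also have "\<dots> = (\<Sum>x\<in>?D. fold (lact v) x F [])"
    by (rule sum.cong) (use functional_T[OF F] dihedral_red[OF assms] in auto)
  also have "\<dots> = 0"
  proof -
    have "v * (v * (delta * F [s])) = v * (v * v + 1) * F [s]" unfolding v_delta by (simp add: algebra_simps)
    then show ?thesis using ne admissibleD(4)[OF F, of s "[]"] admissibleD(5)[OF F assms, of "[]"]
      by (simp add: lact_def algebra_simps)
  qed
  finally show "functional F (dihedral_sum s t) = 0" .
qed

abbreviation J :: "'h set" where "J \<equiv> J_ideal X H T"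

lemma J_null: "J \<subseteq> null_space"
  unfolding J_ideal_def
  by (rule H.genideal_minimal[OF null_space_ideal]) (use dihedral_sum_null in \<open>auto simp: link_def\<close>)

lemma J_generators: "{dihedral_sum s t |s t. s \<in> nodes X \<and> t \<in> nodes X \<and> adj X s t} \<subseteq> carrier H"
  using dihedral_sum_null by (auto simp: link_def null_space_def)

lemma J_ideal: "ideal J H"
  unfolding J_ideal_def by (rule H.genideal_ideal[OF J_generators])

lemma dihedral_sum_J: "link s t \<Longrightarrow> dihedral_sum s t \<in> J"
  unfolding J_ideal_def using H.genideal_self[OF J_generators] by (auto simp: link_def)

section \<open>The Temperley--Lieb algebra\<close>

sublocale J: ideal "J_ideal X H T" H by (rule J_ideal)

abbreviation R :: "(laurent, 'h set) module" where "R \<equiv> TL X H T"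

definition proj :: "'h \<Rightarrow> 'h set" where "proj h = J +>\<^bsub>H\<^esub> h"

lemma TL_fields:
  "carrier R = proj ` carrier H" "one R = proj \<one>\<^bsub>H\<^esub>" "zero R = J"
  "monoid.mult R = rcoset_mult H J" "ring.add R = set_add H"
  by (auto simp: TL_def ring.defs module.defs FactRing_def A_RCOSETS_defs proj_def a_r_coset_def)

lemma proj_closed [simp]: "h \<in> carrier H \<Longrightarrow> proj h \<in> carrier R"
  by (simp add: TL_fields)

lemma proj_mult: "x \<in> carrier H \<Longrightarrow> y \<in> carrier H \<Longrightarrow> proj x \<otimes>\<^bsub>R\<^esub> proj y = proj (x \<otimes>\<^bsub>H\<^esub> y)"
  by (simp add: TL_fields proj_def J.rcoset_mult_add)

lemma proj_add: "x \<in> carrier H \<Longrightarrow> y \<in> carrier H \<Longrightarrow> proj x \<oplus>\<^bsub>R\<^esub> proj y = proj (x \<oplus>\<^bsub>H\<^esub> y)"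
  by (simp add: TL_fields proj_def J.a_rcos_sum)

lemma J_subset: "j \<in> J \<Longrightarrow> j \<in> carrier H"
  using J.a_subset by blast

lemma proj_mem: "y \<in> proj x \<longleftrightarrow> (\<exists>j\<in>J. y = j \<oplus>\<^bsub>H\<^esub> x)"
  by (auto simp: proj_def a_r_coset_def')

lemma proj_eqI: "j \<in> J \<Longrightarrow> x \<in> carrier H \<Longrightarrow> proj (j \<oplus>\<^bsub>H\<^esub> x) = proj x"
  using J.a_repr_independence'[of "j \<oplus>\<^bsub>H\<^esub> x" x] proj_mem[of "j \<oplus>\<^bsub>H\<^esub> x" x] by (auto simp: proj_def)

lemma proj_zero: "zero R = proj \<zero>\<^bsub>H\<^esub>"
  using proj_mem[of _ "\<zero>\<^bsub>H\<^esub>"] J_subset by (auto simp: TL_fields)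

lemma proj_J: "j \<in> J \<Longrightarrow> proj j = zero R"
  using proj_eqI[of j "\<zero>\<^bsub>H\<^esub>"] J_subset by (simp add: proj_zero)

lemma J_smult: "j \<in> J \<Longrightarrow> a \<odot>\<^bsub>H\<^esub> j \<in> J"
  using J.I_l_closed[of j "a \<odot>\<^bsub>H\<^esub> \<one>\<^bsub>H\<^esub>"] J_subset[of j] by (simp add: H.smult_mult_left)

lemma proj_smult:
  assumes "h \<in> carrier H" shows "a \<odot>\<^bsub>R\<^esub> proj h = proj (a \<odot>\<^bsub>H\<^esub> h)"
proof -
  have 1: "proj (a \<odot>\<^bsub>H\<^esub> x) = proj (a \<odot>\<^bsub>H\<^esub> h)" if x: "x \<in> proj h" for x
  proof -
    obtain j where j: "j \<in> J" "x = j \<oplus>\<^bsub>H\<^esub> h" using x proj_mem by blast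
    then show ?thesis using assms J_subset proj_eqI[OF J_smult] by (simp add: H.smult_add_right)
  qed
  have "h \<in> proj h" using J.a_rcos_self[OF assms] by (simp add: proj_def)
  then have 2: "(\<Union>x\<in>proj h. proj (a \<odot>\<^bsub>H\<^esub> h)) = proj (a \<odot>\<^bsub>H\<^esub> h)" by blast
  have "a \<odot>\<^bsub>R\<^esub> proj h = (\<Union>x\<in>proj h. proj (a \<odot>\<^bsub>H\<^esub> x))"
    by (simp add: TL_def ring.defs module.defs proj_def)
  also have "\<dots> = (\<Union>x\<in>proj h. proj (a \<odot>\<^bsub>H\<^esub> h))" by (intro SUP_cong) (simp_all add: 1)
  finally show ?thesis using 2 by simp
qed

lemma TL_rep: "x \<in> carrier R \<Longrightarrow> \<exists>h\<in>carrier H. x = proj h"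
  by (auto simp: TL_fields)

lemma TL_ring: "ring R"
proof (rule ringI)
  show "abelian_group R"
  proof (rule abelian_groupI)
    fix x assume "x \<in> carrier R"
    then obtain h where h: "h \<in> carrier H" "x = proj h" using TL_rep by blast
    then show "\<exists>y\<in>carrier R. y \<oplus>\<^bsub>R\<^esub> x = \<zero>\<^bsub>R\<^esub>"
      by (intro bexI[of _ "proj (\<ominus>\<^bsub>H\<^esub> h)"]) (auto simp: proj_add proj_zero H.l_neg)
    show "\<zero>\<^bsub>R\<^esub> \<oplus>\<^bsub>R\<^esub> x = x" using h by (simp add: proj_zero proj_add)
  next
    fix x y z assume "x \<in> carrier R" "y \<in> carrier R" "z \<in> carrier R"
    then obtain a b c where "a \<in> carrier H" "b \<in> carrier H" "c \<in> carrier H" "x = proj a" "y = proj b" "z = proj c"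
      using TL_rep by meson
    then show "x \<oplus>\<^bsub>R\<^esub> y \<oplus>\<^bsub>R\<^esub> z = x \<oplus>\<^bsub>R\<^esub> (y \<oplus>\<^bsub>R\<^esub> z)" by (simp add: proj_add H.a_assoc)
  next
    fix x y assume "x \<in> carrier R" "y \<in> carrier R"
    then obtain a b where "a \<in> carrier H" "b \<in> carrier H" "x = proj a" "y = proj b"
      using TL_rep by meson
    then show "x \<oplus>\<^bsub>R\<^esub> y = y \<oplus>\<^bsub>R\<^esub> x" "x \<oplus>\<^bsub>R\<^esub> y \<in> carrier R"
      by (simp_all add: proj_add H.a_comm)
  qed (simp add: proj_zero)
  show "Group.monoid R"
  proof (rule monoidI)
    fix x y z assume "x \<in> carrier R" "y \<in> carrier R" "z \<in> carrier R"
    then obtain a b c where "a \<in> carrier H" "b \<in> carrier H" "c \<in> carrier H" "x = proj a" "y = proj b" "z = proj c"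
      using TL_rep by meson
    then show "x \<otimes>\<^bsub>R\<^esub> y \<otimes>\<^bsub>R\<^esub> z = x \<otimes>\<^bsub>R\<^esub> (y \<otimes>\<^bsub>R\<^esub> z)" by (simp add: proj_mult H.m_assoc)
  next
    fix x y assume "x \<in> carrier R" "y \<in> carrier R"
    then obtain a b where "a \<in> carrier H" "b \<in> carrier H" "x = proj a" "y = proj b"
      using TL_rep by meson
    then show "x \<otimes>\<^bsub>R\<^esub> y \<in> carrier R" by (simp add: proj_mult)
  next
    fix x assume "x \<in> carrier R"
    then obtain h where h: "h \<in> carrier H" "x = proj h" using TL_rep by blast
    then show "\<one>\<^bsub>R\<^esub> \<otimes>\<^bsub>R\<^esub> x = x" "x \<otimes>\<^bsub>R\<^esub> \<one>\<^bsub>R\<^esub> = x" by (simp_all add: TL_fields(2) proj_mult)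
  qed (simp add: TL_fields)
next
  fix x y z assume "x \<in> carrier R" "y \<in> carrier R" "z \<in> carrier R"
  then obtain a b c where "a \<in> carrier H" "b \<in> carrier H" "c \<in> carrier H" "x = proj a" "y = proj b" "z = proj c"
    using TL_rep by meson
  then show "(x \<oplus>\<^bsub>R\<^esub> y) \<otimes>\<^bsub>R\<^esub> z = x \<otimes>\<^bsub>R\<^esub> z \<oplus>\<^bsub>R\<^esub> y \<otimes>\<^bsub>R\<^esub> z"
    "z \<otimes>\<^bsub>R\<^esub> (x \<oplus>\<^bsub>R\<^esub> y) = z \<otimes>\<^bsub>R\<^esub> x \<oplus>\<^bsub>R\<^esub> z \<otimes>\<^bsub>R\<^esub> y"
    by (simp_all add: proj_add proj_mult H.l_distr H.r_distr)
qed

sublocale R: laurent_algebra "TL X H T"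
proof (unfold laurent_algebra_def laurent_algebra_axioms_def, intro conjI allI impI)
  show "ring R" by (rule TL_ring)
  show "module laurent_ring R"
  proof (rule moduleI)
    show "cring laurent_ring" using H.smodule.R.is_cring .
    show "abelian_group R" using TL_ring by (rule ring.is_abelian_group)
  next
    fix a x assume "x \<in> carrier R"
    then obtain h where "h \<in> carrier H" "x = proj h" using TL_rep by blast
    then show "a \<odot>\<^bsub>R\<^esub> x \<in> carrier R" by (simp add: proj_smult)
  next
    fix a b x assume "x \<in> carrier R"
    then obtain h where "h \<in> carrier H" "x = proj h" using TL_rep by blast
    then show "(a \<oplus>\<^bsub>laurent_ring\<^esub> b) \<odot>\<^bsub>R\<^esub> x = a \<odot>\<^bsub>R\<^esub> x \<oplus>\<^bsub>R\<^esub> b \<odot>\<^bsub>R\<^esub> x"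
      "(a \<otimes>\<^bsub>laurent_ring\<^esub> b) \<odot>\<^bsub>R\<^esub> x = a \<odot>\<^bsub>R\<^esub> (b \<odot>\<^bsub>R\<^esub> x)"
      by (simp_all add: proj_smult proj_add H.smult_add_left H.smult_assoc)
  next
    fix a x y assume "x \<in> carrier R" "y \<in> carrier R"
    then obtain b c where "b \<in> carrier H" "c \<in> carrier H" "x = proj b" "y = proj c" using TL_rep by meson
    then show "a \<odot>\<^bsub>R\<^esub> (x \<oplus>\<^bsub>R\<^esub> y) = a \<odot>\<^bsub>R\<^esub> x \<oplus>\<^bsub>R\<^esub> a \<odot>\<^bsub>R\<^esub> y"
      by (simp add: proj_smult proj_add H.smult_add_right)
  next
    fix x assume "x \<in> carrier R"
    then obtain h where "h \<in> carrier H" "x = proj h" using TL_rep by blast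
    then show "\<one>\<^bsub>laurent_ring\<^esub> \<odot>\<^bsub>R\<^esub> x = x" by (simp add: proj_smult)
  qed
next
  fix a x y assume "x \<in> carrier R" "y \<in> carrier R"
  then obtain b c where "b \<in> carrier H" "c \<in> carrier H" "x = proj b" "y = proj c" using TL_rep by meson
  then show "(a \<odot>\<^bsub>R\<^esub> x) \<otimes>\<^bsub>R\<^esub> y = a \<odot>\<^bsub>R\<^esub> (x \<otimes>\<^bsub>R\<^esub> y)" "x \<otimes>\<^bsub>R\<^esub> (a \<odot>\<^bsub>R\<^esub> y) = a \<odot>\<^bsub>R\<^esub> (x \<otimes>\<^bsub>R\<^esub> y)"
    by (simp_all add: proj_smult proj_mult H.smult_mult_left H.smult_mult_right)
qed

section \<open>The monomial generators\<close>

definition \<tau> :: "'a \<Rightarrow> 'h set" where "\<tau> s = proj (T (cl [s]))"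

abbreviation b :: "'a \<Rightarrow> 'h set" where "b s \<equiv> tl_b X H T s"
abbreviation b_word :: "'a list \<Rightarrow> 'h set" where "b_word x \<equiv> tl_b_word X H T x"

lemma tl_t_proj: "tl_t X H T w = proj (T w)" by (simp add: tl_t_def proj_def)

lemma \<tau>_closed [simp]: "s \<in> nodes X \<Longrightarrow> \<tau> s \<in> carrier R" by (simp add: \<tau>_def)

lemma b_eq: "s \<in> nodes X \<Longrightarrow> b s = vinv \<odot>\<^bsub>R\<^esub> (\<tau> s \<oplus>\<^bsub>R\<^esub> \<one>\<^bsub>R\<^esub>)"
  by (simp add: tl_b_def tl_t_proj one_W T_one gen_cl \<tau>_def TL_fields(2)[symmetric] R.smult_add_right)

lemma b_closed [simp]: "s \<in> nodes X \<Longrightarrow> b s \<in> carrier R" by (simp add: b_eq)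

lemma \<tau>_eq: "s \<in> nodes X \<Longrightarrow> \<tau> s = v \<odot>\<^bsub>R\<^esub> b s \<oplus>\<^bsub>R\<^esub> (- 1) \<odot>\<^bsub>R\<^esub> \<one>\<^bsub>R\<^esub>"
  by (simp add: b_eq R.smult_assoc[symmetric] R.smult_minus_left R.a_assoc R.r_neg)

lemma red_single: "s \<in> nodes X \<Longrightarrow> reduced [s]" using FC_red[OF FC_single] by simp

lemma \<tau>_square: "s \<in> nodes X \<Longrightarrow> \<tau> s \<otimes>\<^bsub>R\<^esub> \<tau> s = q \<odot>\<^bsub>R\<^esub> \<one>\<^bsub>R\<^esub> \<oplus>\<^bsub>R\<^esub> (q - 1) \<odot>\<^bsub>R\<^esub> \<tau> s"
  using T_down[OF red_single] by (simp add: \<tau>_def proj_mult proj_add[symmetric] proj_smult[symmetric] T_one TL_fields(2)[symmetric])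

lemma T_pair: "reduced [s, t] \<Longrightarrow> T (cl [s, t]) = T (cl [s]) \<otimes>\<^bsub>H\<^esub> T (cl [t])"
  using T_up[of s "[t]"] by simp

lemma \<tau>_commute:
  assumes "s \<in> nodes X" "t \<in> nodes X" "ind s t"
  shows "\<tau> s \<otimes>\<^bsub>R\<^esub> \<tau> t = \<tau> t \<otimes>\<^bsub>R\<^esub> \<tau> s"
proof -
  have "commuting [s, t]" "commuting [t, s]" using assms E_sym E_irrefl by (auto simp: commuting_def ind_def)
  then have "reduced [s, t]" "reduced [t, s]" using FC_red commuting_FC assms by auto
  moreover have "cl [s, t] = cl [t, s]" using cl_iff[of "[s, t]"] ceq_commute assms by simp
  ultimately show ?thesis using assms T_pair by (simp add: \<tau>_def proj_mult) metis
qed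

lemma dihedral_sum_zero:
  assumes "link s t"
  shows "\<tau> s \<otimes>\<^bsub>R\<^esub> \<tau> t \<otimes>\<^bsub>R\<^esub> \<tau> s \<oplus>\<^bsub>R\<^esub> \<tau> s \<otimes>\<^bsub>R\<^esub> \<tau> t \<oplus>\<^bsub>R\<^esub> \<tau> t \<otimes>\<^bsub>R\<^esub> \<tau> s \<oplus>\<^bsub>R\<^esub> \<tau> s \<oplus>\<^bsub>R\<^esub> \<tau> t \<oplus>\<^bsub>R\<^esub> \<one>\<^bsub>R\<^esub> = \<zero>\<^bsub>R\<^esub>"
proof -
  let ?D = "{[], [s], [t], [s, t], [t, s], [s, t, s]}"
  have st: "s \<in> nodes X" "t \<in> nodes X" "s \<noteq> t" using assms E_irrefl by (auto simp: link_def)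
  have r: "\<And>x. x \<in> ?D \<Longrightarrow> reduced x" using dihedral_red[OF assms] .
  let ?S = "T (cl [s])" and ?T = "T (cl [t])"
  have c: "?S \<in> carrier H" "?T \<in> carrier H" using st by auto
  have w: "T (cl [s, t]) = ?S \<otimes>\<^bsub>H\<^esub> ?T" "T (cl [t, s]) = ?T \<otimes>\<^bsub>H\<^esub> ?S"
    "T (cl [s, t, s]) = ?S \<otimes>\<^bsub>H\<^esub> (?T \<otimes>\<^bsub>H\<^esub> ?S)"
    using T_pair[of s t] T_pair[of t s] T_up[of s "[t, s]"] r by auto
  have "dihedral_sum s t = (\<Oplus>\<^bsub>H\<^esub>w\<in>cl ` ?D. T w)" by (simp add: dihedral_eq[OF assms])
  also have "\<dots> = (\<Oplus>\<^bsub>H\<^esub>x\<in>?D. T (cl x))"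
  proof (rule H.finsum_reindex[OF _ dihedral_inj[OF assms]])
    show "T \<in> cl ` ?D \<rightarrow> carrier H" using T_cl_closed[OF red_words[OF r]] by blast
  qed
  also have "\<dots> = \<one>\<^bsub>H\<^esub> \<oplus>\<^bsub>H\<^esub> (?S \<oplus>\<^bsub>H\<^esub> (?T \<oplus>\<^bsub>H\<^esub> (?S \<otimes>\<^bsub>H\<^esub> ?T \<oplus>\<^bsub>H\<^esub> (?T \<otimes>\<^bsub>H\<^esub> ?S \<oplus>\<^bsub>H\<^esub> ?S \<otimes>\<^bsub>H\<^esub> (?T \<otimes>\<^bsub>H\<^esub> ?S)))))"
    using st w c by (simp add: T_one)
  finally have "proj (\<one>\<^bsub>H\<^esub> \<oplus>\<^bsub>H\<^esub> (?S \<oplus>\<^bsub>H\<^esub> (?T \<oplus>\<^bsub>H\<^esub> (?S \<otimes>\<^bsub>H\<^esub> ?T \<oplus>\<^bsub>H\<^esub> (?T \<otimes>\<^bsub>H\<^esub> ?S \<oplus>\<^bsub>H\<^esub> ?S \<otimes>\<^bsub>H\<^esub> (?T \<otimes>\<^bsub>H\<^esub> ?S)))))) = \<zero>\<^bsub>R\<^esub>"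
    using proj_J[OF dihedral_sum_J[OF assms]] by simp
  then have "\<one>\<^bsub>R\<^esub> \<oplus>\<^bsub>R\<^esub> (\<tau> s \<oplus>\<^bsub>R\<^esub> (\<tau> t \<oplus>\<^bsub>R\<^esub> (\<tau> s \<otimes>\<^bsub>R\<^esub> \<tau> t \<oplus>\<^bsub>R\<^esub> (\<tau> t \<otimes>\<^bsub>R\<^esub> \<tau> s \<oplus>\<^bsub>R\<^esub> \<tau> s \<otimes>\<^bsub>R\<^esub> (\<tau> t \<otimes>\<^bsub>R\<^esub> \<tau> s))))) = \<zero>\<^bsub>R\<^esub>"
    using c by (simp add: \<tau>_def TL_fields(2) proj_mult proj_add)
  moreover have "\<tau> s \<in> carrier R" "\<tau> t \<in> carrier R" using st by auto
  then have "\<tau> s \<otimes>\<^bsub>R\<^esub> \<tau> t \<otimes>\<^bsub>R\<^esub> \<tau> s \<oplus>\<^bsub>R\<^esub> \<tau> s \<otimes>\<^bsub>R\<^esub> \<tau> t \<oplus>\<^bsub>R\<^esub> \<tau> t \<otimes>\<^bsub>R\<^esub> \<tau> s \<oplus>\<^bsub>R\<^esub> \<tau> s \<oplus>\<^bsub>R\<^esub> \<tau> t \<oplus>\<^bsub>R\<^esub> \<one>\<^bsub>R\<^esub> =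
    \<one>\<^bsub>R\<^esub> \<oplus>\<^bsub>R\<^esub> (\<tau> s \<oplus>\<^bsub>R\<^esub> (\<tau> t \<oplus>\<^bsub>R\<^esub> (\<tau> s \<otimes>\<^bsub>R\<^esub> \<tau> t \<oplus>\<^bsub>R\<^esub> (\<tau> t \<otimes>\<^bsub>R\<^esub> \<tau> s \<oplus>\<^bsub>R\<^esub> \<tau> s \<otimes>\<^bsub>R\<^esub> (\<tau> t \<otimes>\<^bsub>R\<^esub> \<tau> s)))))"
    by (simp add: R.m_assoc R.add.m_ac)
  ultimately show ?thesis by simp
qed

lemma b_square:
  assumes "s \<in> nodes X" shows "b s \<otimes>\<^bsub>R\<^esub> b s = delta \<odot>\<^bsub>R\<^esub> b s"
proof -
  let ?t = "\<tau> s"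
  have c: "?t \<in> carrier R" using assms by simp
  have "(?t \<oplus>\<^bsub>R\<^esub> \<one>\<^bsub>R\<^esub>) \<otimes>\<^bsub>R\<^esub> (?t \<oplus>\<^bsub>R\<^esub> \<one>\<^bsub>R\<^esub>) = ?t \<otimes>\<^bsub>R\<^esub> ?t \<oplus>\<^bsub>R\<^esub> (?t \<oplus>\<^bsub>R\<^esub> (?t \<oplus>\<^bsub>R\<^esub> \<one>\<^bsub>R\<^esub>))"
    using c by (simp add: R.l_distr R.r_distr R.m_assoc R.add.m_ac)
  also have "\<dots> = q \<odot>\<^bsub>R\<^esub> \<one>\<^bsub>R\<^esub> \<oplus>\<^bsub>R\<^esub> \<one>\<^bsub>R\<^esub> \<oplus>\<^bsub>R\<^esub> ((q - 1) \<odot>\<^bsub>R\<^esub> ?t \<oplus>\<^bsub>R\<^esub> ?t \<oplus>\<^bsub>R\<^esub> ?t)"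
  proof -
    have "q \<odot>\<^bsub>R\<^esub> \<one>\<^bsub>R\<^esub> \<in> carrier R" "(q - 1) \<odot>\<^bsub>R\<^esub> ?t \<in> carrier R" using c by auto
    then show ?thesis unfolding \<tau>_square[OF assms] using c by (simp add: R.l_distr R.r_distr R.m_assoc R.add.m_ac)
  qed
  also have "\<dots> = (q + 1) \<odot>\<^bsub>R\<^esub> (?t \<oplus>\<^bsub>R\<^esub> \<one>\<^bsub>R\<^esub>)"
  proof -
    have "(q - 1) \<odot>\<^bsub>R\<^esub> ?t \<oplus>\<^bsub>R\<^esub> ?t \<oplus>\<^bsub>R\<^esub> ?t = (q - 1 + 1 + 1) \<odot>\<^bsub>R\<^esub> ?t" using c by (simp only: R.smult_add_left R.smult_one R.smult_closed)
    moreover have "q \<odot>\<^bsub>R\<^esub> \<one>\<^bsub>R\<^esub> \<oplus>\<^bsub>R\<^esub> \<one>\<^bsub>R\<^esub> = (q + 1) \<odot>\<^bsub>R\<^esub> \<one>\<^bsub>R\<^esub>" by (simp add: R.smult_add_left)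
    ultimately show ?thesis using c by (simp add: R.smult_add_right R.a_comm)
  qed
  finally have "b s \<otimes>\<^bsub>R\<^esub> b s = (vinv * vinv * (q + 1)) \<odot>\<^bsub>R\<^esub> (?t \<oplus>\<^bsub>R\<^esub> \<one>\<^bsub>R\<^esub>)"
    using assms c by (simp add: b_eq R.smult_mult_left R.smult_mult_right R.smult_assoc)
  moreover have "vinv * vinv * (q + 1) = delta * vinv"
  proof -
    have "vinv * vinv * (v * v) = (vinv * v) * (vinv * v)" by (simp only: ac_simps)
    then show ?thesis by (simp add: q_def power2_eq_square delta_def algebra_simps)
  qed
  ultimately show ?thesis using assms c by (simp add: b_eq R.smult_assoc)
qed

lemma b_commute:
  assumes "s \<in> nodes X" "t \<in> nodes X" "ind s t"
  shows "b s \<otimes>\<^bsub>R\<^esub> b t = b t \<otimes>\<^bsub>R\<^esub> b s"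
proof -
  have c: "\<tau> s \<in> carrier R" "\<tau> t \<in> carrier R" using assms by auto
  have "(\<tau> s \<oplus>\<^bsub>R\<^esub> \<one>\<^bsub>R\<^esub>) \<otimes>\<^bsub>R\<^esub> (\<tau> t \<oplus>\<^bsub>R\<^esub> \<one>\<^bsub>R\<^esub>) = \<tau> s \<otimes>\<^bsub>R\<^esub> \<tau> t \<oplus>\<^bsub>R\<^esub> (\<tau> s \<oplus>\<^bsub>R\<^esub> (\<tau> t \<oplus>\<^bsub>R\<^esub> \<one>\<^bsub>R\<^esub>))" using c by (simp add: R.l_distr R.r_distr R.m_assoc R.add.m_ac)
  also have "\<dots> = \<tau> t \<otimes>\<^bsub>R\<^esub> \<tau> s \<oplus>\<^bsub>R\<^esub> (\<tau> s \<oplus>\<^bsub>R\<^esub> (\<tau> t \<oplus>\<^bsub>R\<^esub> \<one>\<^bsub>R\<^esub>))" using \<tau>_commute[OF assms] by simp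
  also have "\<dots> = (\<tau> t \<oplus>\<^bsub>R\<^esub> \<one>\<^bsub>R\<^esub>) \<otimes>\<^bsub>R\<^esub> (\<tau> s \<oplus>\<^bsub>R\<^esub> \<one>\<^bsub>R\<^esub>)" using c by (simp add: R.l_distr R.r_distr R.m_assoc R.add.m_ac)
  finally show ?thesis using assms c by (simp add: b_eq R.smult_mult_left R.smult_mult_right)
qed

text \<open>
  Expanding \<open>(\<tau>\<^sub>s + 1)(\<tau>\<^sub>t + 1)(\<tau>\<^sub>s + 1)\<close> gives the dihedral sum, which is zero, and \<open>\<tau>\<^sub>s\<^sup>2 + \<tau>\<^sub>s = q (\<tau>\<^sub>s + 1)\<close>.
\<close>
lemma b_zigzag:
  assumes "link s t"
  shows "b s \<otimes>\<^bsub>R\<^esub> (b t \<otimes>\<^bsub>R\<^esub> b s) = b s"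
proof -
  have st: "s \<in> nodes X" "t \<in> nodes X" using assms by (auto simp: link_def)
  then have c: "\<tau> s \<in> carrier R" "\<tau> t \<in> carrier R" by auto
  have "(\<tau> s \<oplus>\<^bsub>R\<^esub> \<one>\<^bsub>R\<^esub>) \<otimes>\<^bsub>R\<^esub> ((\<tau> t \<oplus>\<^bsub>R\<^esub> \<one>\<^bsub>R\<^esub>) \<otimes>\<^bsub>R\<^esub> (\<tau> s \<oplus>\<^bsub>R\<^esub> \<one>\<^bsub>R\<^esub>)) =
    (\<tau> s \<otimes>\<^bsub>R\<^esub> \<tau> t \<otimes>\<^bsub>R\<^esub> \<tau> s \<oplus>\<^bsub>R\<^esub> \<tau> s \<otimes>\<^bsub>R\<^esub> \<tau> t \<oplus>\<^bsub>R\<^esub> \<tau> t \<otimes>\<^bsub>R\<^esub> \<tau> s \<oplus>\<^bsub>R\<^esub> \<tau> s \<oplus>\<^bsub>R\<^esub> \<tau> t \<oplus>\<^bsub>R\<^esub> \<one>\<^bsub>R\<^esub>) \<oplus>\<^bsub>R\<^esub>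
    (\<tau> s \<otimes>\<^bsub>R\<^esub> \<tau> s \<oplus>\<^bsub>R\<^esub> \<tau> s)" using c by (simp add: R.l_distr R.r_distr R.m_assoc R.add.m_ac)
  also have "\<dots> = q \<odot>\<^bsub>R\<^esub> \<one>\<^bsub>R\<^esub> \<oplus>\<^bsub>R\<^esub> ((q - 1) \<odot>\<^bsub>R\<^esub> \<tau> s \<oplus>\<^bsub>R\<^esub> \<tau> s)"
    unfolding dihedral_sum_zero[OF assms] \<tau>_square[OF st(1)] using c by (simp add: R.a_assoc)
  also have "\<dots> = q \<odot>\<^bsub>R\<^esub> (\<tau> s \<oplus>\<^bsub>R\<^esub> \<one>\<^bsub>R\<^esub>)"
  proof -
    have "(q - 1) \<odot>\<^bsub>R\<^esub> \<tau> s \<oplus>\<^bsub>R\<^esub> \<tau> s = (q - 1 + 1) \<odot>\<^bsub>R\<^esub> \<tau> s" using c by (simp only: R.smult_add_left R.smult_one)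
    then show ?thesis using c by (simp add: R.smult_add_right R.a_comm)
  qed
  finally have "b s \<otimes>\<^bsub>R\<^esub> (b t \<otimes>\<^bsub>R\<^esub> b s) = (vinv * (vinv * (vinv * q))) \<odot>\<^bsub>R\<^esub> (\<tau> s \<oplus>\<^bsub>R\<^esub> \<one>\<^bsub>R\<^esub>)"
    using st c by (simp add: b_eq R.smult_mult_left R.smult_mult_right R.smult_assoc)
  moreover have "vinv * (vinv * (vinv * q)) = vinv"
  proof -
    have "vinv * (vinv * (vinv * (v * v))) = vinv * ((vinv * v) * (vinv * v))" by (simp only: ac_simps)
    then show ?thesis by (simp add: q_def power2_eq_square)
  qed
  ultimately show ?thesis using st c by (simp add: b_eq)
qed

lemma b_word_simps [simp]: "b_word [] = \<one>\<^bsub>R\<^esub>" "b_word (s # x) = b s \<otimes>\<^bsub>R\<^esub> b_word x"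
  by (simp_all add: tl_b_word_def)

lemma b_word_closed [simp]: "x \<in> words \<Longrightarrow> b_word x \<in> carrier R"
  by (induction x rule: list.induct) auto

lemma b_word_append: "x \<in> words \<Longrightarrow> y \<in> words \<Longrightarrow> b_word (x @ y) = b_word x \<otimes>\<^bsub>R\<^esub> b_word y"
  by (induction x rule: list.induct) (auto simp: R.m_assoc)

lemma teq_words: "x \<approx> y \<Longrightarrow> x \<in> words \<longleftrightarrow> y \<in> words"
  using trace_eq_set[of ind x y] by (auto simp: in_lists_conv_set)

lemma b_word_teq: "x \<approx> y \<Longrightarrow> x \<in> words \<Longrightarrow> b_word x = b_word y"
proof (induction rule: trace_eq.induct)
  case (swap x p a c r)
  have "p @ a # c # r \<in> words" using teq_words[OF swap.hyps(1)] swap.prems by blast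
  then have w: "p \<in> words" "r \<in> words" "a \<in> nodes X" "c \<in> nodes X" by auto
  have "b a \<otimes>\<^bsub>R\<^esub> (b c \<otimes>\<^bsub>R\<^esub> b_word r) = b c \<otimes>\<^bsub>R\<^esub> (b a \<otimes>\<^bsub>R\<^esub> b_word r)"
    using w b_commute[OF w(3,4) swap.hyps(2)] by (simp add: R.m_assoc[symmetric])
  then show ?case using swap w by (simp add: b_word_append)
qed simp

lemma b_word_rstep:
  assumes "rstep c x y" "x \<in> words"
  shows "b_word x = (delta ^ c) \<odot>\<^bsub>R\<^esub> b_word y"
  using assms(1)
proof cases
  case (loop p s r)
  then have w: "p \<in> words" "r \<in> words" "s \<in> nodes X" using assms(2) by auto
  have "b s \<otimes>\<^bsub>R\<^esub> (b s \<otimes>\<^bsub>R\<^esub> b_word r) = delta \<odot>\<^bsub>R\<^esub> (b s \<otimes>\<^bsub>R\<^esub> b_word r)"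
    using w b_square[OF w(3)] by (simp add: R.m_assoc[symmetric] R.smult_mult_left)
  then show ?thesis using loop w by (simp add: b_word_append R.smult_mult_right)
next
  case (zigzag s t p r)
  then have w: "p \<in> words" "r \<in> words" "s \<in> nodes X" "t \<in> nodes X" using assms(2) by auto
  have "b s \<otimes>\<^bsub>R\<^esub> (b t \<otimes>\<^bsub>R\<^esub> (b s \<otimes>\<^bsub>R\<^esub> b_word r)) = (b s \<otimes>\<^bsub>R\<^esub> (b t \<otimes>\<^bsub>R\<^esub> b s)) \<otimes>\<^bsub>R\<^esub> b_word r"
    using w by (simp add: R.m_assoc)
  then show ?thesis using zigzag w b_zigzag[OF zigzag(4)] by (simp add: b_word_append)
qed

lemma reduces_words: "reduces k x y \<Longrightarrow> x \<in> words \<Longrightarrow> y \<in> words"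
  using reduces_set[of k x y] by (auto simp: in_lists_conv_set)

lemma b_word_reduces: "reduces k x y \<Longrightarrow> x \<in> words \<Longrightarrow> b_word x = (delta ^ k) \<odot>\<^bsub>R\<^esub> b_word y"
proof (induction rule: reduces.induct)
  case (stop x y)
  then show ?case using b_word_teq teq_words[OF stop.hyps] by simp
next
  case (more c x y k z)
  obtain x' y' where s: "x \<approx> x'" "rstep c x' y'" "y' \<approx> y" using more.hyps(1) unfolding tstep_def by blast
  have w: "x' \<in> words" using teq_words[OF s(1)] more.prems by blast
  have yw: "y \<in> words" using reduces_words[OF reduces_tstep[OF more.hyps(1)] more.prems] .
  have y'w: "y' \<in> words" using teq_words[OF s(3)] yw by blast
  have zw: "z \<in> words" using reduces_words[OF more.hyps(2) yw] .
  have "b_word x = (delta ^ c) \<odot>\<^bsub>R\<^esub> b_word y"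
    using b_word_teq[OF s(1) more.prems] b_word_rstep[OF s(2) w] b_word_teq[OF s(3) y'w] by simp
  then show ?case using more.IH[OF yw] zw by (simp add: R.smult_assoc[symmetric] power_add)
qed

lemma nf_words: "x \<in> words \<Longrightarrow> nf x \<in> words" using reduces_words[OF reduces_nf] .

text \<open>
  The reductions of words are valid in the algebra; so every product of generators is a power of \<open>\<delta>\<close> times a monomial.
\<close>
lemma b_word_nf: "x \<in> words \<Longrightarrow> b_word x = (delta ^ loops x) \<odot>\<^bsub>R\<^esub> b_word (nf x)"
  using b_word_reduces[OF reduces_nf] .

section \<open>The monomial basis\<close>

abbreviation mon :: "'a list set \<Rightarrow> 'h set" where "mon w \<equiv> monomial X H T w"

text \<open>
  Any two reduced words of an element of \<open>W\<^sub>c\<close> differ by commutations, so they give the same product.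
\<close>
lemma mon_cl:
  assumes "FC x" "x \<in> words" shows "mon (cl x) = b_word x"
  unfolding monomial_def
proof (rule the_equality)
  have r: "reduced x" using FC_red assms by blast
  show "\<exists>y. reduced_expr (cl x) y \<and> b_word x = b_word y"
    using reduced_expr_cl[OF r] ceq_refl[OF assms(2)] r by blast
  fix z assume "\<exists>y. reduced_expr (cl x) y \<and> z = b_word y"
  then obtain y where y: "reduced_expr (cl x) y" "z = b_word y" by blast
  then have "x \<sim> y" "reduced y" using reduced_expr_cl[OF r] by auto
  then have "length x = length y" using ceq_length_red[OF r] by simp
  then have "y \<approx> x" using FC_shortest(2)[OF assms(1) \<open>x \<sim> y\<close>] by blast
  then show "z = b_word x" using y b_word_teq[OF \<open>y \<approx> x\<close>] teq_words assms(2) by simp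
qed

lemma mon_closed [simp]: "w \<in> W_c X \<Longrightarrow> mon w \<in> carrier R"
  using W_cE[of w] mon_cl red_words by (metis b_word_closed)

text \<open>
  Functionals of admissible functions vanish on \<open>J\<close>; so the choice of a representative of the coset does not matter.
\<close>
definition tl_functional :: "('a list \<Rightarrow> laurent) \<Rightarrow> 'h set \<Rightarrow> laurent" where
  "tl_functional F C = functional F (SOME h. h \<in> C)"

lemma tl_functional_proj:
  assumes F: "admissible delta F" and h: "h \<in> carrier H"
  shows "tl_functional F (proj h) = functional F h"
proof -
  have "h \<in> proj h" using J.a_rcos_self[OF h] by (simp add: proj_def)
  then have "(SOME h'. h' \<in> proj h) \<in> proj h" by (rule someI)
  then obtain j where j: "j \<in> J" "(SOME h'. h' \<in> proj h) = j \<oplus>\<^bsub>H\<^esub> h" using proj_mem by blast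
  moreover have "functional F j = 0" using J_null j(1) F by (auto simp: null_space_def)
  ultimately show ?thesis using J_subset[OF j(1)] h by (simp add: tl_functional_def functional_add)
qed

lemma tl_functional_linear:
  assumes "admissible delta F" "x \<in> carrier R"
  shows "y \<in> carrier R \<Longrightarrow> tl_functional F (x \<oplus>\<^bsub>R\<^esub> y) = tl_functional F x + tl_functional F y"
    "tl_functional F (a \<odot>\<^bsub>R\<^esub> x) = a * tl_functional F x"
proof -
  obtain g where g: "g \<in> carrier H" "x = proj g" using TL_rep assms by meson
  then show "tl_functional F (a \<odot>\<^bsub>R\<^esub> x) = a * tl_functional F x"
    using assms(1) by (simp add: proj_smult tl_functional_proj functional_smult)
  assume "y \<in> carrier R"
  then obtain h where "h \<in> carrier H" "y = proj h" using TL_rep by meson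
  then show "tl_functional F (x \<oplus>\<^bsub>R\<^esub> y) = tl_functional F x + tl_functional F y"
    using g assms(1) by (simp add: proj_add tl_functional_proj functional_add)
qed

lemma tl_functional_zero: "admissible delta F \<Longrightarrow> tl_functional F \<zero>\<^bsub>R\<^esub> = 0"
  by (simp add: proj_zero tl_functional_proj)

text \<open>
  Solving \<open>\<tau>\<^sub>s = v b\<^sub>s - 1\<close> for \<open>b\<^sub>s\<close>.  By iteration, the functional of \<open>F\<close> takes the value \<open>F x\<close> at the
  product along \<open>x\<close>.
\<close>
lemma tl_functional_b:
  assumes F: "admissible delta F" and s: "s \<in> nodes X" and x: "x \<in> carrier R"
  shows "tl_functional F (b s \<otimes>\<^bsub>R\<^esub> x) = tl_functional (\<lambda>z. F (s # z)) x"
proof -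
  obtain h where h: "h \<in> carrier H" "x = proj h" using TL_rep x by blast
  have F': "admissible delta (\<lambda>z. F (s # z))" using admissible_shift[OF F, of "[s]" "[]"] by simp
  have "functional (lact v s F) h = v * functional (\<lambda>z. F (s # z)) h - functional F h" if "h \<in> carrier H" for h
    using that
  proof (rule hecke_induct)
    fix y assume "reduced y"
    moreover have "fold (lact v) y (lact v s F) [] = v * fold (lact v) y (\<lambda>z. F (s # z)) [] - fold (lact v) y F []"
      using fold_lact_linear[of v y v "\<lambda>z. F (s # z)" "- 1" F] by (simp add: lact_def[of v s F])
    ultimately show "functional (lact v s F) (T (cl y)) = v * functional (\<lambda>z. F (s # z)) (T (cl y)) - functional F (T (cl y))"
      using functional_T F F' admissible_lact[OF F] by simp
  next
    fix a y assume "y \<in> carrier H" "functional (lact v s F) y = v * functional (\<lambda>z. F (s # z)) y - functional F y"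
    then show "functional (lact v s F) (a \<odot>\<^bsub>H\<^esub> y) =
        v * functional (\<lambda>z. F (s # z)) (a \<odot>\<^bsub>H\<^esub> y) - functional F (a \<odot>\<^bsub>H\<^esub> y)"
      by (simp add: functional_smult right_diff_distrib mult.left_commute)
  qed (simp_all add: functional_add algebra_simps)
  note lin = this[OF h(1)]
  have "b s \<otimes>\<^bsub>R\<^esub> x = vinv \<odot>\<^bsub>R\<^esub> (proj (T (cl [s]) \<otimes>\<^bsub>H\<^esub> h) \<oplus>\<^bsub>R\<^esub> proj h)"
    using s h by (simp add: b_eq \<tau>_def R.smult_mult_left R.l_distr proj_mult)
  then have "tl_functional F (b s \<otimes>\<^bsub>R\<^esub> x) = vinv * (functional (lact v s F) h + functional F h)"
    using s h F by (simp add: tl_functional_linear tl_functional_proj functional_left)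
  also have "\<dots> = functional (\<lambda>z. F (s # z)) h" unfolding lin by (simp add: mult.assoc[symmetric])
  finally show ?thesis using h tl_functional_proj[OF F' h(1)] by simp
qed

lemma tl_functional_b_word: "admissible delta F \<Longrightarrow> x \<in> words \<Longrightarrow> tl_functional F (b_word x) = F x"
proof (induction x arbitrary: F rule: list.induct)
  case Nil
  then show ?case by (simp add: TL_fields(2) tl_functional_proj functional_one)
next
  case (Cons s x)
  have "admissible delta (\<lambda>z. F (s # z))" using admissible_shift[OF Cons.prems(1), of "[s]" "[]"] by simp
  then show ?case using Cons tl_functional_b by simp
qed

definition comb :: "('a list set \<Rightarrow>\<^sub>0 laurent) \<Rightarrow> 'h set" where
  "comb f = lincomb R (monomial X H T) f"

lemma comb_closed [simp]: "Poly_Mapping.keys f \<subseteq> W_c X \<Longrightarrow> comb f \<in> carrier R"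
  unfolding comb_def by (rule R.lincomb_closed) auto

lemma comb_add: "Poly_Mapping.keys f \<subseteq> W_c X \<Longrightarrow> Poly_Mapping.keys g \<subseteq> W_c X \<Longrightarrow> comb (f + g) = comb f \<oplus>\<^bsub>R\<^esub> comb g"
  unfolding comb_def by (rule R.lincomb_add[where I = "W_c X"]) auto

lemma comb_scale: "Poly_Mapping.keys f \<subseteq> W_c X \<Longrightarrow> comb (coeff_scale a f) = a \<odot>\<^bsub>R\<^esub> comb f"
  unfolding comb_def by (rule R.lincomb_scale[where I = "W_c X"]) auto

lemma comb_single: "w \<in> W_c X \<Longrightarrow> comb (Poly_Mapping.single w a) = a \<odot>\<^bsub>R\<^esub> mon w"
  unfolding comb_def by (rule R.lincomb_single) simp

lemma comb_zero [simp]: "comb 0 = \<zero>\<^bsub>R\<^esub>" by (simp add: comb_def)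

lemma comb_b_word: "x \<in> words \<Longrightarrow> b_word x = comb (Poly_Mapping.single (cl (nf x)) (delta ^ loops x))"
  using comb_single W_c_FC[OF FC_nf nf_words] mon_cl[OF FC_nf nf_words] b_word_nf by simp

lemma tl_functional_comb:
  assumes F: "admissible delta F" and f: "Poly_Mapping.keys f \<subseteq> W_c X"
  shows "tl_functional F (comb f) = (\<Sum>w\<in>Poly_Mapping.keys f. Poly_Mapping.lookup f w * tl_functional F (mon w))"
proof -
  have "finite A \<Longrightarrow> A \<subseteq> W_c X \<Longrightarrow> tl_functional F (\<Oplus>\<^bsub>R\<^esub>w\<in>A. Poly_Mapping.lookup f w \<odot>\<^bsub>R\<^esub> mon w) =
      (\<Sum>w\<in>A. Poly_Mapping.lookup f w * tl_functional F (mon w))" for A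
  proof (induction A rule: finite_induct)
    case (insert w A)
    then have "(\<lambda>w. Poly_Mapping.lookup f w \<odot>\<^bsub>R\<^esub> mon w) \<in> A \<rightarrow> carrier R" "mon w \<in> carrier R" by auto
    then show ?case using insert F by (simp add: tl_functional_linear R.finsum_closed)
  qed (simp add: tl_functional_zero[OF F])
  then show ?thesis using f unfolding comb_def lincomb_def by simp
qed

text \<open>
  The functional of \<open>chi delta x\<close> takes the value 1 at the monomial of \<open>x\<close> and 0 at all others.
\<close>
lemma comb_inj:
  assumes "Poly_Mapping.keys f \<subseteq> W_c X" "comb f = \<zero>\<^bsub>R\<^esub>"
  shows "f = 0"
proof (rule poly_mapping_eqI)
  fix w show "Poly_Mapping.lookup f w = Poly_Mapping.lookup 0 w"
  proof (cases "w \<in> Poly_Mapping.keys f")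
    case True
    then obtain x where x: "FC x" "reduced x" "w = cl x" using assms(1) W_cE by blast
    let ?F = "chi delta x"
    have val: "tl_functional ?F (mon w') = (if w' = w then 1 else 0)" if w': "w' \<in> Poly_Mapping.keys f" for w'
    proof -
      obtain y where y: "FC y" "reduced y" "w' = cl y" using assms(1) w' W_cE by blast
      have "tl_functional ?F (mon w') = ?F y"
        using mon_cl[OF y(1) red_words[OF y(2)]] tl_functional_b_word[OF admissible_chi red_words[OF y(2)]] y(3) by simp
      moreover have "nf y \<approx> x \<longleftrightarrow> y \<approx> x" using nf_FC[OF y(1)] teq_sym teq_trans by blast
      moreover have "y \<approx> x \<longleftrightarrow> cl y = cl x"
      proof
        assume "y \<approx> x"
        then show "cl y = cl x" using teq_ceq cl_iff red_words[OF y(2)] by blast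
      next
        assume "cl y = cl x"
        then have c: "y \<sim> x" using cl_iff red_words[OF y(2)] by blast
        then have "x \<approx> y" using FC_shortest(2)[OF y(1) c] ceq_length_red[OF y(2) c] x(2) by simp
        then show "y \<approx> x" by (rule teq_sym)
      qed
      ultimately show ?thesis using nf_FC[OF y(1)] x(3) y(3) by (simp add: chi_def)
    qed
    have "0 = tl_functional ?F (comb f)" using assms(2) tl_functional_zero[OF admissible_chi] by simp
    also have "\<dots> = (\<Sum>w'\<in>Poly_Mapping.keys f. Poly_Mapping.lookup f w' * (if w' = w then 1 else 0))"
      unfolding tl_functional_comb[OF admissible_chi assms(1)] by (rule sum.cong) (simp_all add: val)
    also have "\<dots> = Poly_Mapping.lookup f w" using True by (simp add: if_distrib cong: if_cong)
    finally show ?thesis by simp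
  qed (simp add: in_keys_iff)
qed

definition span :: "'h set set" where "span = comb ` {f. Poly_Mapping.keys f \<subseteq> W_c X}"

lemma span_add: "x \<in> span \<Longrightarrow> y \<in> span \<Longrightarrow> x \<oplus>\<^bsub>R\<^esub> y \<in> span"
proof -
  assume "x \<in> span" "y \<in> span"
  then obtain f g where "Poly_Mapping.keys f \<subseteq> W_c X" "Poly_Mapping.keys g \<subseteq> W_c X" "x = comb f" "y = comb g"
    by (auto simp: span_def)
  then show ?thesis using comb_add[of f g] subset_trans[OF keys_add[of f g], of "W_c X"]
    by (auto simp: span_def intro!: image_eqI[of _ comb "f + g"])
qed

lemma span_smult: "x \<in> span \<Longrightarrow> a \<odot>\<^bsub>R\<^esub> x \<in> span"
proof -
  assume "x \<in> span"
  then obtain f where "Poly_Mapping.keys f \<subseteq> W_c X" "x = comb f" by (auto simp: span_def)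
  then show ?thesis using comb_scale[of f a] subset_trans[OF keys_coeff_scale[of a f], of "W_c X"]
    by (auto simp: span_def intro!: image_eqI[of _ comb "coeff_scale a f"])
qed

lemma span_closed: "x \<in> span \<Longrightarrow> x \<in> carrier R" by (auto simp: span_def)

lemma span_zero: "\<zero>\<^bsub>R\<^esub> \<in> span" by (auto simp: span_def intro!: image_eqI[of _ comb 0])

lemma span_b_word: "x \<in> words \<Longrightarrow> b_word x \<in> span"
  using comb_b_word W_c_FC[OF FC_nf nf_words] by (auto simp: span_def)

lemma span_left: "x \<in> span \<Longrightarrow> s \<in> nodes X \<Longrightarrow> b s \<otimes>\<^bsub>R\<^esub> x \<in> span"
proof -
  assume "x \<in> span" and s: "s \<in> nodes X"
  then obtain f where f: "Poly_Mapping.keys f \<subseteq> W_c X" "x = comb f" by (auto simp: span_def)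
  have m: "b s \<otimes>\<^bsub>R\<^esub> mon w \<in> span" if "w \<in> W_c X" for w
  proof -
    obtain y where y: "FC y" "reduced y" "w = cl y" by (rule W_cE[OF \<open>w \<in> W_c X\<close>])
    then show ?thesis using mon_cl red_words span_b_word[of "s # y"] s by simp
  qed
  have "b s \<otimes>\<^bsub>R\<^esub> lincomb R (monomial X H T) f \<in> span"
    by (rule R.lincomb_induct[where P = "\<lambda>x. b s \<otimes>\<^bsub>R\<^esub> x \<in> span"])
      (use f s m in \<open>auto simp: R.r_distr R.smult_mult_right span_add span_smult span_zero subset_iff\<close>)
  then show ?thesis using f by (simp add: comb_def)
qed

lemma span_T_word: "x \<in> words \<Longrightarrow> proj (T_word x) \<in> span"
proof (induction x rule: list.induct)
  case Nil
  then show ?case using span_b_word[of "[]"] by (simp add: TL_fields(2))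
next
  case (Cons s x)
  then have IH: "proj (T_word x) \<in> span" and s: "s \<in> nodes X" and x: "x \<in> words" by auto
  have c: "proj (T_word x) \<in> carrier R" using span_closed[OF IH] .
  have "proj (T_word (s # x)) = \<tau> s \<otimes>\<^bsub>R\<^esub> proj (T_word x)" using s x by (simp add: \<tau>_def proj_mult)
  also have "\<dots> = v \<odot>\<^bsub>R\<^esub> (b s \<otimes>\<^bsub>R\<^esub> proj (T_word x)) \<oplus>\<^bsub>R\<^esub> (- 1) \<odot>\<^bsub>R\<^esub> proj (T_word x)"
    using s c by (simp add: \<tau>_eq R.l_distr R.smult_mult_left)
  finally show ?case using IH s span_left span_smult span_add by simp
qed

text \<open>
  The span is stable under the generators by \<open>b_word_nf\<close>, and it contains the unit.
\<close>
lemma span_eq: "carrier R = span"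
proof
  show "carrier R \<subseteq> span"
  proof
    fix x assume "x \<in> carrier R"
    then obtain h where h: "h \<in> carrier H" "x = proj h" using TL_rep by blast
    have "proj h \<in> span"
      using h(1)
    proof (rule hecke_induct)
      fix x assume "reduced x"
      then show "proj (T (cl x)) \<in> span" using T_red span_T_word red_words by simp
    qed (use span_zero span_add span_smult in \<open>simp_all add: proj_zero[symmetric] proj_add[symmetric] proj_smult[symmetric]\<close>)
    then show "x \<in> span" using h by simp
  qed
qed (use span_closed in blast)

lemma TL_combE:
  assumes "x \<in> carrier R" obtains f where "Poly_Mapping.keys f \<subseteq> W_c X" "x = comb f"
  using assms unfolding span_eq span_def by blast

end

section \<open>Laurent polynomials\<close>

lemma A_minus_closed:
  "0 \<in> A_minus" "1 \<in> A_minus" "vinv \<in> A_minus" "a \<in> A_minus \<Longrightarrow> - a \<in> A_minus"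
  "a \<in> A_minus \<Longrightarrow> c \<in> A_minus \<Longrightarrow> a + c \<in> A_minus" "a \<in> A_minus \<Longrightarrow> c \<in> A_minus \<Longrightarrow> a * c \<in> A_minus"
proof -
  show "a \<in> A_minus \<Longrightarrow> c \<in> A_minus \<Longrightarrow> a + c \<in> A_minus"
    using keys_add[of a c] by (auto simp: A_minus_def)
  show "a \<in> A_minus \<Longrightarrow> c \<in> A_minus \<Longrightarrow> a * c \<in> A_minus"
    using keys_mult[of a c] by (fastforce simp: A_minus_def)
qed (auto simp: A_minus_def vinv_def keys_minus)

lemma A_minus_power: "a \<in> A_minus \<Longrightarrow> a ^ n \<in> A_minus"
  by (induction n) (auto intro: A_minus_closed)

text \<open>
  The leading term of \<open>\<delta>\<^sup>k\<close> is \<open>v\<^sup>k\<close>, hence that of the product in question is \<open>v\<^bsup>1-n+k\<^esup>\<close> up to sign, and \<open>1 - n + k \<le> 0\<close>.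
\<close>
lemma A_minus_coefficient:
  assumes "k < n" shows "v * ((- vinv) ^ n * delta ^ k) \<in> A_minus"
proof -
  obtain m where n: "n = Suc (m + k)" using assms less_iff_Suc_add by (metis add.commute)
  have "v * ((- vinv) ^ n * delta ^ k) = (v * (- vinv)) * (- vinv) ^ m * ((- vinv) * delta) ^ k"
    by (simp only: n power_Suc power_add power_mult_distrib mult.assoc)
  also have "\<dots> = (- 1) * (- vinv) ^ m * (- (1 + vinv * vinv)) ^ k"
    by (simp add: delta_def distrib_left)
  also have "\<dots> \<in> A_minus" by (intro A_minus_closed A_minus_power)
  finally show ?thesis .
qed

definition lbar :: "laurent \<Rightarrow> laurent" where "lbar a = Poly_Mapping.map_key uminus a"

lemma lookup_lbar: "Poly_Mapping.lookup (lbar a) k = Poly_Mapping.lookup a (- k)"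
  by (simp add: lbar_def map_key.rep_eq)

lemma lbar_add: "lbar (a + c) = lbar a + lbar c"
  by (rule poly_mapping_eqI) (simp add: lookup_lbar lookup_add)

lemma lbar_single: "lbar (Poly_Mapping.single k c) = Poly_Mapping.single (- k) c"
  by (rule poly_mapping_eqI) (auto simp: lookup_lbar lookup_single when_def)

lemma lbar_lbar: "lbar (lbar a) = a"
  by (rule poly_mapping_eqI) (simp add: lookup_lbar)

lemma lbar_simps [simp]: "lbar 0 = 0" "lbar 1 = 1" "lbar (- 1) = - 1" "lbar v = vinv" "lbar vinv = v" "lbar delta = delta"
proof -
  show 0: "lbar 0 = 0" by (rule poly_mapping_eqI) (simp add: lookup_lbar)
  show 1: "lbar 1 = 1" using lbar_single[of 0 1] by simp
  have "lbar (- 1) + lbar 1 = lbar 0" using lbar_add[of "- 1" 1] by simp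
  then show "lbar (- 1) = - 1" using 0 1 by (simp add: add_eq_0_iff2)
  show v: "lbar v = vinv" "lbar vinv = v" by (simp_all add: v_def vinv_def lbar_single)
  then show "lbar delta = delta" by (simp add: delta_def lbar_add)
qed

lemma laurent_additive_induct:
  fixes a :: laurent
  assumes "\<And>k c. P (Poly_Mapping.single k c)" "\<And>a c. P a \<Longrightarrow> P c \<Longrightarrow> P (a + c)"
  shows "P a"
proof -
  have sum: "finite A \<Longrightarrow> P (\<Sum>k\<in>A. Poly_Mapping.single k (Poly_Mapping.lookup a k))" for A
  proof (induction A rule: finite_induct)
    case empty
    then show ?case using assms(1)[of 0 0] by simp
  qed (simp add: assms)
  have "(\<Sum>k\<in>Poly_Mapping.keys a. Poly_Mapping.single k (Poly_Mapping.lookup a k)) = a"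
    by (rule poly_mapping_eqI) (auto simp: lookup_sum lookup_single when_def in_keys_iff)
  then show ?thesis using sum[of "Poly_Mapping.keys a"] by simp
qed

lemma lbar_mult: "lbar (a * c) = lbar a * lbar c"
proof (induction a rule: laurent_additive_induct)
  case (1 k i)
  show ?case
    by (induction c rule: laurent_additive_induct) (simp_all add: mult_single lbar_single lbar_add distrib_left)
qed (simp add: lbar_add distrib_right)

lemma lbar_power: "lbar (a ^ n) = lbar a ^ n"
  by (induction n) (simp_all add: lbar_mult)

lemma laurent_induct:
  fixes a :: laurent
  assumes "P v" "P vinv" "P 1" "P (- 1)" "\<And>a c. P a \<Longrightarrow> P c \<Longrightarrow> P (a + c)" "\<And>a c. P a \<Longrightarrow> P c \<Longrightarrow> P (a * c)"
  shows "P a"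
proof (induction a rule: laurent_additive_induct)
  case (1 k c)
  have pow: "P (u ^ n)" if "P u" for u n by (induction n) (simp_all add: assms that)
  have "Poly_Mapping.single (int n) 1 = v ^ n" "Poly_Mapping.single (- int n) 1 = vinv ^ n" for n
  proof (induction n)
    case (Suc n)
    have "Poly_Mapping.single (int (Suc n)) (1::int) = v * Poly_Mapping.single (int n) 1"
      "Poly_Mapping.single (- int (Suc n)) (1::int) = vinv * Poly_Mapping.single (- int n) 1"
      by (simp_all add: v_def vinv_def mult_single)
    then show "Poly_Mapping.single (int (Suc n)) 1 = v ^ Suc n" "Poly_Mapping.single (- int (Suc n)) 1 = vinv ^ Suc n"
      unfolding Suc power_Suc .
  qed simp_all
  then have k: "P (Poly_Mapping.single k 1)" using pow assms(1,2) by (cases k rule: int_cases2) metis+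
  have P0: "P 0" using assms(5)[OF assms(3,4)] by simp
  have "P (Poly_Mapping.single 0 (int n))" "P (Poly_Mapping.single 0 (- int n))" for n
  proof (induction n)
    case (Suc n)
    have e: "int (Suc n) = 1 + int n" "- int (Suc n) = - 1 + - int n" by simp_all
    show "P (Poly_Mapping.single 0 (int (Suc n)))"
      unfolding e single_add using assms(3,5) Suc by simp
    have "P (Poly_Mapping.single 0 (- 1))" using assms(4) by (simp add: single_uminus)
    from assms(5)[OF this Suc(2)] show "P (Poly_Mapping.single 0 (- int (Suc n)))"
      unfolding e(2) single_add .
  qed (simp_all add: P0)
  then have c: "P (Poly_Mapping.single 0 c)" by (cases c rule: int_cases2) metis+
  show ?case using assms(6)[OF k c] by (simp add: mult_single)
qed (rule assms(5))

text \<open>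
  All exponents in \<open>a\<close> are negative, and by invariance all of them are positive as well.
\<close>
lemma bar_invariant_small:
  assumes "v * a \<in> A_minus" "lbar a = a" shows "a = 0"
proof (rule poly_mapping_eqI)
  fix k
  have neg: "Poly_Mapping.lookup a k = 0" if "k \<ge> 0" for k
  proof -
    have "Poly_Mapping.lookup (v * a) (k + 1) = Poly_Mapping.lookup a k"
    proof (induction a rule: laurent_additive_induct)
      case (1 j c)
      then show ?case by (simp add: v_def mult_single lookup_single when_def)
    qed (simp add: distrib_left lookup_add)
    moreover have "k + 1 \<notin> Poly_Mapping.keys (v * a)" using assms(1) that by (auto simp: A_minus_def)
    ultimately show ?thesis by (simp add: in_keys_iff)
  qed
  have "Poly_Mapping.lookup a k = Poly_Mapping.lookup a (- k)" using lookup_lbar[of a k] assms(2) by simp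
  then show "Poly_Mapping.lookup a k = Poly_Mapping.lookup 0 k" using neg[of k] neg[of "- k"] by (cases "k \<ge> 0") auto
qed

section \<open>Lattices\<close>

context laurent_algebra begin

definition lattice_span :: "'i set \<Rightarrow> ('i \<Rightarrow> 'm) \<Rightarrow> 'm set" where
  "lattice_span I c = lincomb M c ` coeffs A_minus I"

lemma coeffs_A_minus_zero: "0 \<in> coeffs A_minus I"
  by (simp add: coeffs_def A_minus_closed)

lemma coeffs_A_minus_add: "f \<in> coeffs A_minus I \<Longrightarrow> g \<in> coeffs A_minus I \<Longrightarrow> f + g \<in> coeffs A_minus I"
  using keys_add[of f g] by (auto simp: coeffs_def lookup_add A_minus_closed)

lemma coeffs_A_minus_scale: "a \<in> A_minus \<Longrightarrow> f \<in> coeffs A_minus I \<Longrightarrow> coeff_scale a f \<in> coeffs A_minus I"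
  using keys_coeff_scale[of a f] by (auto simp: coeffs_def A_minus_closed)

lemma lattice_span_closed: "(\<And>i. i \<in> I \<Longrightarrow> c i \<in> carrier M) \<Longrightarrow> x \<in> lattice_span I c \<Longrightarrow> x \<in> carrier M"
  by (auto simp: lattice_span_def coeffs_def intro: lincomb_closed)

lemma lattice_span_zero: "\<zero> \<in> lattice_span I c"
  unfolding lattice_span_def using coeffs_A_minus_zero[of I] lincomb_zero[of c] by (metis image_eqI)

lemma lattice_span_add:
  assumes c: "\<And>i. i \<in> I \<Longrightarrow> c i \<in> carrier M" and "x \<in> lattice_span I c" "y \<in> lattice_span I c"
  shows "x \<oplus> y \<in> lattice_span I c"
proof -
  obtain f g where fg: "f \<in> coeffs A_minus I" "g \<in> coeffs A_minus I" "x = lincomb M c f" "y = lincomb M c g"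
    using assms(2,3) by (auto simp: lattice_span_def)
  have "x \<oplus> y = lincomb M c (f + g)"
    unfolding fg by (rule lincomb_add[where I = I, symmetric]) (use c fg in \<open>auto simp: coeffs_def\<close>)
  then show ?thesis using coeffs_A_minus_add[OF fg(1,2)] by (auto simp: lattice_span_def)
qed

lemma lattice_span_smult:
  assumes c: "\<And>i. i \<in> I \<Longrightarrow> c i \<in> carrier M" and "a \<in> A_minus" "x \<in> lattice_span I c"
  shows "a \<odot> x \<in> lattice_span I c"
proof -
  obtain f where f: "f \<in> coeffs A_minus I" "x = lincomb M c f" using assms(3) by (auto simp: lattice_span_def)
  have "a \<odot> x = lincomb M c (coeff_scale a f)"
    unfolding f by (rule lincomb_scale[where I = I, symmetric]) (use c f in \<open>auto simp: coeffs_def\<close>)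
  then show ?thesis using coeffs_A_minus_scale[OF assms(2) f(1)] by (auto simp: lattice_span_def)
qed

lemma lattice_span_base: "i \<in> I \<Longrightarrow> c i \<in> carrier M \<Longrightarrow> c i \<in> lattice_span I c"
proof -
  assume i: "i \<in> I" "c i \<in> carrier M"
  have "Poly_Mapping.single i 1 \<in> coeffs A_minus I"
    using i by (auto simp: coeffs_def lookup_single when_def A_minus_closed)
  moreover have "lincomb M c (Poly_Mapping.single i 1) = c i" using lincomb_single[of c i 1] i by simp
  ultimately show ?thesis unfolding lattice_span_def by (metis image_eqI)
qed

lemma lattice_span_mono:
  assumes c: "\<And>i. i \<in> I \<Longrightarrow> c i \<in> carrier M" and d: "\<And>i. i \<in> I \<Longrightarrow> d i \<in> carrier M"
    and "f \<in> coeffs A_minus I" "\<And>i. i \<in> Poly_Mapping.keys f \<Longrightarrow> c i \<in> lattice_span I d"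
  shows "lincomb M c f \<in> lattice_span I d"
proof (rule lincomb_induct)
  show "c i \<in> carrier M" if "i \<in> Poly_Mapping.keys f" for i
    using c that assms(3) by (auto simp: coeffs_def)
  show "Poly_Mapping.lookup f i \<odot> c i \<in> lattice_span I d" if "i \<in> Poly_Mapping.keys f" for i
  proof (rule lattice_span_smult[OF d])
    show "Poly_Mapping.lookup f i \<in> A_minus" using assms(3) by (simp add: coeffs_def)
    show "c i \<in> lattice_span I d" by (rule assms(4)[OF that])
  qed
  show "\<zero> \<in> lattice_span I d" by (rule lattice_span_zero)
  show "x \<oplus> y \<in> lattice_span I d" if "x \<in> lattice_span I d" "y \<in> lattice_span I d" for x y
    by (rule lattice_span_add[OF d that])
qed

end

context hecke begin

section \<open>From the standard basis to the monomial basis\<close>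

text \<open>
  The coordinates of \<open>a b\<^sub>x\<close> with respect to the monomial basis.
\<close>
definition word_term :: "'a list \<Rightarrow> laurent \<Rightarrow> ('a list set \<Rightarrow>\<^sub>0 laurent)" where
  "word_term x a = Poly_Mapping.single (cl (nf x)) (a * delta ^ loops x)"

lemma comb_word_term: "x \<in> words \<Longrightarrow> comb (word_term x a) = a \<odot>\<^bsub>R\<^esub> b_word x"
  using comb_single[OF W_c_FC[OF FC_nf nf_words]] mon_cl[OF FC_nf nf_words] b_word_nf[of x] nf_words[of x]
  by (simp add: word_term_def R.smult_assoc)

lemma keys_word_term: "x \<in> words \<Longrightarrow> Poly_Mapping.keys (word_term x a) \<subseteq> W_c X"
  using W_c_FC[OF FC_nf nf_words] by (auto simp: word_term_def)

lemma keys_word_terms: "set L \<subseteq> words \<Longrightarrow> Poly_Mapping.keys (\<Sum>x\<leftarrow>L. word_term x (c x)) \<subseteq> W_c X"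
proof (induction L)
  case (Cons x L)
  then show ?case
    using keys_word_term[of x "c x"] keys_add[of "word_term x (c x)" "\<Sum>x\<leftarrow>L. word_term x (c x)"] by auto
qed simp

lemma comb_word_terms_Cons:
  "set (x # L) \<subseteq> words \<Longrightarrow> comb (\<Sum>y\<leftarrow>x # L. word_term y (c y)) = c x \<odot>\<^bsub>R\<^esub> b_word x \<oplus>\<^bsub>R\<^esub> comb (\<Sum>y\<leftarrow>L. word_term y (c y))"
  using comb_add[OF keys_word_term keys_word_terms, of x L "c x" c] comb_word_term[of x "c x"] by simp

lemma Cons_words: "set L \<subseteq> words \<Longrightarrow> s \<in> nodes X \<Longrightarrow> set (map ((#) s) L) \<subseteq> words"
proof
  fix y assume L: "set L \<subseteq> words" "s \<in> nodes X" "y \<in> set (map ((#) s) L)"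
  then obtain z where "z \<in> set L" "y = s # z" by auto
  moreover from this have "z \<in> words" using L(1) by blast
  ultimately show "y \<in> words" using L(2) by simp
qed

lemma comb_word_terms_left:
  assumes "s \<in> nodes X"
  shows "set L \<subseteq> words \<Longrightarrow>
    b s \<otimes>\<^bsub>R\<^esub> comb (\<Sum>y\<leftarrow>L. word_term y (c y)) = comb (\<Sum>y\<leftarrow>L. word_term (s # y) (c y))"
proof (induction L)
  case (Cons x L)
  have w: "set ((s # x) # map ((#) s) L) \<subseteq> words" using Cons.prems assms Cons_words[of L s] by simp
  have t: "(\<Sum>y\<leftarrow>x # L. word_term (s # y) (c y)) = (\<Sum>y\<leftarrow>(s # x) # map ((#) s) L. word_term y (c (tl y)))"
    by (simp add: o_def)
  have "comb (\<Sum>y\<leftarrow>x # L. word_term (s # y) (c y)) = c x \<odot>\<^bsub>R\<^esub> b_word (s # x) \<oplus>\<^bsub>R\<^esub> comb (\<Sum>y\<leftarrow>L. word_term (s # y) (c y))"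
    unfolding t comb_word_terms_Cons[OF w] by (simp add: o_def)
  moreover have "b s \<otimes>\<^bsub>R\<^esub> comb (\<Sum>y\<leftarrow>x # L. word_term y (c y)) = c x \<odot>\<^bsub>R\<^esub> b_word (s # x) \<oplus>\<^bsub>R\<^esub> b s \<otimes>\<^bsub>R\<^esub> comb (\<Sum>y\<leftarrow>L. word_term y (c y))"
    unfolding comb_word_terms_Cons[OF Cons.prems] using Cons.prems assms keys_word_terms[of L c]
    by (simp add: R.r_distr R.smult_mult_right)
  ultimately show ?case using Cons by simp
qed (use assms in simp)

lemma comb_word_terms_smult:
  assumes "set L \<subseteq> words"
  shows "a \<odot>\<^bsub>R\<^esub> comb (\<Sum>y\<leftarrow>L. word_term y (c y)) = comb (\<Sum>y\<leftarrow>L. word_term y (a * c y))"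
proof -
  have "coeff_scale a (\<Sum>y\<leftarrow>L. word_term y (c y)) = (\<Sum>y\<leftarrow>L. word_term y (a * c y))"
  proof (induction L)
    case Nil
    then show ?case by (intro poly_mapping_eqI) simp
  next
    case (Cons x L)
    have "coeff_scale a (word_term x (c x) + g) = word_term x (a * c x) + coeff_scale a g" for g
      by (intro poly_mapping_eqI) (simp add: lookup_add word_term_def lookup_single when_def algebra_simps)
    then show ?case using Cons by simp
  qed
  then show ?thesis using comb_scale[OF keys_word_terms[OF assms], of a c] by simp
qed

definition expansion :: "'a list \<Rightarrow> ('a list set \<Rightarrow>\<^sub>0 laurent)" where
  "expansion x = (\<Sum>I\<leftarrow>subseqs x. word_term I ((- vinv) ^ (length x - length I)))"

lemma subseqs_words: "x \<in> words \<Longrightarrow> set (subseqs x) \<subseteq> words"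
  using set_subseqs_subset[of _ x] by (auto simp: in_lists_conv_set)

text \<open>
  Multiplying out the product of the factors \<open>v\<^sup>-\<^sup>1 \<tau>\<^sub>s = b\<^sub>s - v\<^sup>-\<^sup>1\<close>.
\<close>
lemma T_word_expansion: "x \<in> words \<Longrightarrow> vinv ^ length x \<odot>\<^bsub>R\<^esub> proj (T_word x) = comb (expansion x)"
proof (induction x rule: list.induct)
  case Nil
  have "nf [] \<approx> []" "loops [] = 0" using nf_FC[OF FC_Nil] by auto
  then show ?case using comb_word_term[of "[]" 1] by (simp add: expansion_def TL_fields(2))
next
  case (Cons s x)
  then have s: "s \<in> nodes X" and x: "x \<in> words" by auto
  let ?c = "\<lambda>I. (- vinv) ^ (length x - length I)"
  let ?Y = "vinv ^ length x \<odot>\<^bsub>R\<^esub> proj (T_word x)"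
  have Y: "?Y \<in> carrier R" using x by simp
  have "vinv ^ length (s # x) \<odot>\<^bsub>R\<^esub> proj (T_word (s # x)) = (vinv \<odot>\<^bsub>R\<^esub> \<tau> s) \<otimes>\<^bsub>R\<^esub> ?Y"
    using s x by (simp add: \<tau>_def proj_mult[symmetric] R.smult_mult_left R.smult_mult_right R.smult_assoc)
      (simp add: R.smult_assoc[symmetric] mult.commute)
  also have "vinv \<odot>\<^bsub>R\<^esub> \<tau> s = b s \<oplus>\<^bsub>R\<^esub> (- vinv) \<odot>\<^bsub>R\<^esub> \<one>\<^bsub>R\<^esub>"
    using s by (simp add: \<tau>_eq R.smult_add_right R.smult_assoc[symmetric])
  also have "\<dots> \<otimes>\<^bsub>R\<^esub> ?Y = b s \<otimes>\<^bsub>R\<^esub> ?Y \<oplus>\<^bsub>R\<^esub> (- vinv) \<odot>\<^bsub>R\<^esub> ?Y"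
    using s Y by (simp add: R.l_distr R.smult_mult_left)
  also have "\<dots> = comb (\<Sum>I\<leftarrow>subseqs x. word_term (s # I) (?c I)) \<oplus>\<^bsub>R\<^esub> comb (\<Sum>I\<leftarrow>subseqs x. word_term I (- vinv * ?c I))"
    unfolding Cons.IH[OF x] expansion_def
      comb_word_terms_left[OF s subseqs_words[OF x]] comb_word_terms_smult[OF subseqs_words[OF x]] ..
  also have "(\<Sum>I\<leftarrow>subseqs x. word_term I (- vinv * ?c I)) =
      (\<Sum>I\<leftarrow>subseqs x. word_term I ((- vinv) ^ (length (s # x) - length I)))"
    by (intro arg_cong[of _ _ sum_list] map_cong) (auto simp: Suc_diff_le dest: length_subseqs_le)
  also have "(\<Sum>I\<leftarrow>subseqs x. word_term (s # I) (?c I)) =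
      (\<Sum>I\<leftarrow>map ((#) s) (subseqs x). word_term I ((- vinv) ^ (length (s # x) - length I)))"
    by (simp add: o_def)
  also have "comb \<dots> \<oplus>\<^bsub>R\<^esub> comb (\<Sum>I\<leftarrow>subseqs x. word_term I ((- vinv) ^ (length (s # x) - length I))) = comb (expansion (s # x))"
  proof -
    from comb_add[OF keys_word_terms[OF Cons_words[OF subseqs_words[OF x] s]] keys_word_terms[OF subseqs_words[OF x]]] show ?thesis
      unfolding expansion_def by (simp add: Let_def)
  qed
  finally show ?case .
qed

section \<open>The bar involution\<close>

lemma comb_eq_iff:
  assumes "Poly_Mapping.keys f \<subseteq> W_c X" "Poly_Mapping.keys g \<subseteq> W_c X" "comb f = comb g"
  shows "f = g"
proof -
  have k: "Poly_Mapping.keys (coeff_scale (- 1) g) \<subseteq> W_c X" using subset_trans[OF keys_coeff_scale assms(2)] .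
  have "comb (f + coeff_scale (- 1) g) = comb f \<oplus>\<^bsub>R\<^esub> (- 1) \<odot>\<^bsub>R\<^esub> comb g"
    using comb_add[OF assms(1) k] comb_scale[OF assms(2)] by simp
  also have "\<dots> = \<zero>\<^bsub>R\<^esub>" using assms comb_closed[OF assms(2)] by (simp add: R.smult_minus_left R.r_neg)
  finally have "f + coeff_scale (- 1) g = 0"
    using comb_inj subset_trans[OF keys_add, of f "coeff_scale (- 1) g" "W_c X"] assms(1) k by simp
  then have "Poly_Mapping.lookup (f + coeff_scale (- 1) g) i = 0" for i by simp
  then show ?thesis by (intro poly_mapping_eqI) (simp add: lookup_add)
qed

definition coord :: "'h set \<Rightarrow> ('a list set \<Rightarrow>\<^sub>0 laurent)" where
  "coord x = (THE f. Poly_Mapping.keys f \<subseteq> W_c X \<and> comb f = x)"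

lemma coord_comb: "Poly_Mapping.keys f \<subseteq> W_c X \<Longrightarrow> coord (comb f) = f"
  unfolding coord_def using comb_eq_iff by (intro the_equality) auto

definition coeff_bar :: "('a list set \<Rightarrow>\<^sub>0 laurent) \<Rightarrow> ('a list set \<Rightarrow>\<^sub>0 laurent)" where
  "coeff_bar f = Poly_Mapping.map lbar f"

lemma lookup_coeff_bar: "Poly_Mapping.lookup (coeff_bar f) i = lbar (Poly_Mapping.lookup f i)"
  by (simp add: coeff_bar_def Poly_Mapping.map.rep_eq when_def)

lemma keys_coeff_bar: "Poly_Mapping.keys (coeff_bar f) \<subseteq> Poly_Mapping.keys f"
  by (auto simp: in_keys_iff lookup_coeff_bar)

text \<open>
  The semilinear map that fixes the monomials.  It turns out to be the bar involution (\<open>tl_bar_eq\<close>).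
\<close>
definition bar :: "'h set \<Rightarrow> 'h set" where
  "bar = restrict (\<lambda>x. comb (coeff_bar (coord x))) (carrier R)"

lemma bar_comb: "Poly_Mapping.keys f \<subseteq> W_c X \<Longrightarrow> bar (comb f) = comb (coeff_bar f)"
  by (simp add: bar_def coord_comb)

lemma keys_coeff_bar_W_c: "Poly_Mapping.keys f \<subseteq> W_c X \<Longrightarrow> Poly_Mapping.keys (coeff_bar f) \<subseteq> W_c X"
  using subset_trans[OF keys_coeff_bar] .

lemma bar_closed [simp]: "x \<in> carrier R \<Longrightarrow> bar x \<in> carrier R"
  using TL_combE[of x] bar_comb keys_coeff_bar_W_c comb_closed by metis

lemma bar_add:
  assumes "x \<in> carrier R" "y \<in> carrier R" shows "bar (x \<oplus>\<^bsub>R\<^esub> y) = bar x \<oplus>\<^bsub>R\<^esub> bar y"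
proof -
  obtain f where f: "Poly_Mapping.keys f \<subseteq> W_c X" "x = comb f" using TL_combE[OF assms(1)] .
  obtain g where g: "Poly_Mapping.keys g \<subseteq> W_c X" "y = comb g" using TL_combE[OF assms(2)] .
  have "coeff_bar (f + g) = coeff_bar f + coeff_bar g"
    by (rule poly_mapping_eqI) (simp add: lookup_coeff_bar lookup_add lbar_add)
  then show ?thesis
    using f g subset_trans[OF keys_add, of f g "W_c X"] keys_coeff_bar_W_c
    by (simp add: comb_add[symmetric] bar_comb)
qed

lemma bar_smult:
  assumes "x \<in> carrier R" shows "bar (a \<odot>\<^bsub>R\<^esub> x) = lbar a \<odot>\<^bsub>R\<^esub> bar x"
proof -
  obtain f where f: "Poly_Mapping.keys f \<subseteq> W_c X" "x = comb f" using TL_combE[OF assms] .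
  have "coeff_bar (coeff_scale a f) = coeff_scale (lbar a) (coeff_bar f)"
    by (rule poly_mapping_eqI) (simp add: lookup_coeff_bar lbar_mult)
  then show ?thesis
    using f subset_trans[OF keys_coeff_scale f(1), of a] keys_coeff_bar_W_c[OF f(1)]
    by (simp add: comb_scale[symmetric] bar_comb)
qed

lemma bar_zero [simp]: "bar \<zero>\<^bsub>R\<^esub> = \<zero>\<^bsub>R\<^esub>"
  using bar_smult[of "\<zero>\<^bsub>R\<^esub>" 0] by simp

lemma bar_bar:
  assumes "x \<in> carrier R" shows "bar (bar x) = x"
proof -
  obtain f where f: "Poly_Mapping.keys f \<subseteq> W_c X" "x = comb f" using TL_combE[OF assms] .
  have "coeff_bar (coeff_bar f) = f" by (rule poly_mapping_eqI) (simp add: lookup_coeff_bar lbar_lbar)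
  then show ?thesis using f keys_coeff_bar_W_c[OF f(1)] by (simp add: bar_comb)
qed

lemma bar_b_word: "x \<in> words \<Longrightarrow> bar (b_word x) = b_word x"
proof -
  assume x: "x \<in> words"
  have "coeff_bar (Poly_Mapping.single (cl (nf x)) (delta ^ loops x)) = Poly_Mapping.single (cl (nf x)) (delta ^ loops x)"
    by (rule poly_mapping_eqI) (simp add: lookup_coeff_bar lookup_single when_def lbar_power)
  then show ?thesis using comb_b_word[OF x] bar_comb W_c_FC[OF FC_nf nf_words[OF x]] by simp
qed

lemma bar_mon: "w \<in> W_c X \<Longrightarrow> bar (mon w) = mon w"
  using W_cE[of w] mon_cl bar_b_word red_words by metis

lemma TL_induct:
  assumes "x \<in> carrier R" "P \<zero>\<^bsub>R\<^esub>"
    "\<And>x y. x \<in> carrier R \<Longrightarrow> y \<in> carrier R \<Longrightarrow> P x \<Longrightarrow> P y \<Longrightarrow> P (x \<oplus>\<^bsub>R\<^esub> y)"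
    "\<And>a x. x \<in> words \<Longrightarrow> P (a \<odot>\<^bsub>R\<^esub> b_word x)"
  shows "P x"
proof -
  obtain f where f: "Poly_Mapping.keys f \<subseteq> W_c X" "x = comb f" using TL_combE[OF assms(1)] .
  have m: "P (a \<odot>\<^bsub>R\<^esub> mon w)" if "w \<in> W_c X" for a w
    using W_cE[OF that] assms(4) mon_cl red_words by metis
  show ?thesis unfolding f(2) comb_def
    by (rule R.lincomb_induct) (use f(1) assms(2,3) m in auto)
qed

text \<open>
  The product of two monomials is \<open>\<delta>\<^sup>k\<close> times a monomial, and \<open>\<delta>\<close> is invariant.
\<close>
lemma bar_mult:
  assumes "x \<in> carrier R" "y \<in> carrier R" shows "bar (x \<otimes>\<^bsub>R\<^esub> y) = bar x \<otimes>\<^bsub>R\<^esub> bar y"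
  using assms(1)
proof (rule TL_induct)
  fix a x assume x: "x \<in> words"
  show "bar (a \<odot>\<^bsub>R\<^esub> b_word x \<otimes>\<^bsub>R\<^esub> y) = bar (a \<odot>\<^bsub>R\<^esub> b_word x) \<otimes>\<^bsub>R\<^esub> bar y"
    using assms(2)
  proof (rule TL_induct)
    fix c z assume "z \<in> words"
    then show "bar (a \<odot>\<^bsub>R\<^esub> b_word x \<otimes>\<^bsub>R\<^esub> (c \<odot>\<^bsub>R\<^esub> b_word z)) = bar (a \<odot>\<^bsub>R\<^esub> b_word x) \<otimes>\<^bsub>R\<^esub> bar (c \<odot>\<^bsub>R\<^esub> b_word z)"
      using x by (simp add: R.smult_mult_left R.smult_mult_right bar_smult b_word_append[symmetric] bar_b_word)
  qed (use x in \<open>simp_all add: R.r_distr bar_add\<close>)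
qed (use assms(2) in \<open>simp_all add: R.l_distr bar_add\<close>)

lemma bar_one [simp]: "bar \<one>\<^bsub>R\<^esub> = \<one>\<^bsub>R\<^esub>"
  using bar_b_word[of "[]"] by simp

text \<open>
  For \<open>u w = 1\<close> and \<open>u + w = \<delta>\<close>, the product of \<open>u b\<^sub>s - 1\<close> and \<open>w b\<^sub>s - 1\<close> is
  \<open>(\<delta> - u - w) b\<^sub>s + 1 = 1\<close>.  The elements \<open>\<tau>\<^sub>s\<close> and \<open>bar \<tau>\<^sub>s\<close> are the cases \<open>u = v\<close> and
  \<open>u = v\<^sup>-\<^sup>1\<close>.
\<close>
lemma bar_\<tau>:
  assumes s: "s \<in> nodes X"
  shows "\<tau> s \<otimes>\<^bsub>R\<^esub> bar (\<tau> s) = \<one>\<^bsub>R\<^esub>" "bar (\<tau> s) \<otimes>\<^bsub>R\<^esub> \<tau> s = \<one>\<^bsub>R\<^esub>"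
proof -
  let ?b = "b s"
  have c: "?b \<in> carrier R" using s by simp
  have bb: "bar ?b = ?b" using bar_b_word[of "[s]"] s c by simp
  have bt: "bar (\<tau> s) = vinv \<odot>\<^bsub>R\<^esub> ?b \<oplus>\<^bsub>R\<^esub> (- 1) \<odot>\<^bsub>R\<^esub> \<one>\<^bsub>R\<^esub>"
    using s by (simp add: \<tau>_eq bar_add bar_smult bb)
  have gen: "(u \<odot>\<^bsub>R\<^esub> ?b \<oplus>\<^bsub>R\<^esub> (- 1) \<odot>\<^bsub>R\<^esub> \<one>\<^bsub>R\<^esub>) \<otimes>\<^bsub>R\<^esub> (w \<odot>\<^bsub>R\<^esub> ?b \<oplus>\<^bsub>R\<^esub> (- 1) \<odot>\<^bsub>R\<^esub> \<one>\<^bsub>R\<^esub>) = \<one>\<^bsub>R\<^esub>"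
    if uw: "u * w = 1" "u + w = delta" for u w
  proof -
    have "(u \<odot>\<^bsub>R\<^esub> ?b \<oplus>\<^bsub>R\<^esub> (- 1) \<odot>\<^bsub>R\<^esub> \<one>\<^bsub>R\<^esub>) \<otimes>\<^bsub>R\<^esub> (w \<odot>\<^bsub>R\<^esub> ?b \<oplus>\<^bsub>R\<^esub> (- 1) \<odot>\<^bsub>R\<^esub> \<one>\<^bsub>R\<^esub>) =
        (w * (u * delta)) \<odot>\<^bsub>R\<^esub> ?b \<oplus>\<^bsub>R\<^esub> ((- w) \<odot>\<^bsub>R\<^esub> ?b \<oplus>\<^bsub>R\<^esub> ((- u) \<odot>\<^bsub>R\<^esub> ?b \<oplus>\<^bsub>R\<^esub> \<one>\<^bsub>R\<^esub>))"
      using c s by (simp add: R.l_distr R.r_distr R.smult_mult_left R.smult_mult_right b_square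
          R.smult_assoc[symmetric] R.smult_add_right R.a_assoc mult.assoc)
    also have "w * (u * delta) = delta" using uw(1) by (simp add: mult.assoc[symmetric] mult.commute[of w u])
    also have "delta \<odot>\<^bsub>R\<^esub> ?b \<oplus>\<^bsub>R\<^esub> ((- w) \<odot>\<^bsub>R\<^esub> ?b \<oplus>\<^bsub>R\<^esub> ((- u) \<odot>\<^bsub>R\<^esub> ?b \<oplus>\<^bsub>R\<^esub> \<one>\<^bsub>R\<^esub>)) =
        (delta + (- w + - u)) \<odot>\<^bsub>R\<^esub> ?b \<oplus>\<^bsub>R\<^esub> \<one>\<^bsub>R\<^esub>"
      using c by (simp only: R.smult_add_left R.a_assoc R.smult_closed R.one_closed R.a_closed)
    also have "delta + (- w + - u) = 0" unfolding uw(2)[symmetric] by simp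
    also have "0 \<odot>\<^bsub>R\<^esub> ?b \<oplus>\<^bsub>R\<^esub> \<one>\<^bsub>R\<^esub> = \<one>\<^bsub>R\<^esub>" using c by simp
    finally show ?thesis .
  qed
  show "\<tau> s \<otimes>\<^bsub>R\<^esub> bar (\<tau> s) = \<one>\<^bsub>R\<^esub>" "bar (\<tau> s) \<otimes>\<^bsub>R\<^esub> \<tau> s = \<one>\<^bsub>R\<^esub>"
    using gen[of v vinv] gen[of vinv v] s by (simp_all add: bt \<tau>_eq[symmetric] delta_def add.commute)
qed

lemma T_word_append: "x \<in> words \<Longrightarrow> y \<in> words \<Longrightarrow> T_word (x @ y) = T_word x \<otimes>\<^bsub>H\<^esub> T_word y"
  by (induction x rule: list.induct) (auto simp: H.m_assoc)

lemma bar_T_word: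
  "x \<in> words \<Longrightarrow> proj (T_word (rev x)) \<otimes>\<^bsub>R\<^esub> bar (proj (T_word x)) = \<one>\<^bsub>R\<^esub> \<and>
    bar (proj (T_word x)) \<otimes>\<^bsub>R\<^esub> proj (T_word (rev x)) = \<one>\<^bsub>R\<^esub>"
proof (induction x rule: list.induct)
  case Nil
  then show ?case by (simp add: TL_fields(2)[symmetric])
next
  case (Cons s x)
  then have s: "s \<in> nodes X" and x: "x \<in> words" by auto
  let ?Z = "proj (T_word (rev x))" and ?Y = "bar (proj (T_word x))"
  have c: "?Z \<in> carrier R" "?Y \<in> carrier R" "\<tau> s \<in> carrier R" "bar (\<tau> s) \<in> carrier R"
    using s x by (auto simp: rev_words)
  have 1: "proj (T_word (rev (s # x))) = ?Z \<otimes>\<^bsub>R\<^esub> \<tau> s"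
    using s x T_word_append[of "rev x" "[s]"] by (simp add: \<tau>_def proj_mult rev_words)
  have "proj (T_word (s # x)) = \<tau> s \<otimes>\<^bsub>R\<^esub> proj (T_word x)" using s x by (simp add: \<tau>_def proj_mult)
  then have 2: "bar (proj (T_word (s # x))) = bar (\<tau> s) \<otimes>\<^bsub>R\<^esub> ?Y" using s x by (simp add: bar_mult)
  have "?Z \<otimes>\<^bsub>R\<^esub> \<tau> s \<otimes>\<^bsub>R\<^esub> (bar (\<tau> s) \<otimes>\<^bsub>R\<^esub> ?Y) = ?Z \<otimes>\<^bsub>R\<^esub> ((\<tau> s \<otimes>\<^bsub>R\<^esub> bar (\<tau> s)) \<otimes>\<^bsub>R\<^esub> ?Y)" using c by (simp add: R.m_assoc)
  also have "\<dots> = \<one>\<^bsub>R\<^esub>" using Cons.IH[OF x] bar_\<tau>[OF s] c by simp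
  finally have 3: "?Z \<otimes>\<^bsub>R\<^esub> \<tau> s \<otimes>\<^bsub>R\<^esub> (bar (\<tau> s) \<otimes>\<^bsub>R\<^esub> ?Y) = \<one>\<^bsub>R\<^esub>" .
  have "bar (\<tau> s) \<otimes>\<^bsub>R\<^esub> ?Y \<otimes>\<^bsub>R\<^esub> (?Z \<otimes>\<^bsub>R\<^esub> \<tau> s) = bar (\<tau> s) \<otimes>\<^bsub>R\<^esub> ((?Y \<otimes>\<^bsub>R\<^esub> ?Z) \<otimes>\<^bsub>R\<^esub> \<tau> s)" using c by (simp add: R.m_assoc)
  also have "\<dots> = \<one>\<^bsub>R\<^esub>" using Cons.IH[OF x] bar_\<tau>[OF s] c by simp
  finally show ?case using 3 unfolding 1 2 by simp
qed

lemma red_rev: "reduced x \<Longrightarrow> reduced (rev x)"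
  unfolding reduced_def using ceq_rev[of "rev x"] by (auto simp: rev_words) (metis ceq_rev length_rev rev_rev_ident)

lemma bar_t:
  assumes "w \<in> carrier W"
  shows "bar (tl_t X H T w) = inv\<^bsub>R\<^esub> (tl_t X H T (inv\<^bsub>W\<^esub> w))"
proof -
  obtain x where x: "reduced x" "w = cl x" using W_red[OF assms] by blast
  have w: "x \<in> words" using red_words[OF x(1)] .
  have 1: "tl_t X H T w = proj (T_word x)" using x T_red by (simp add: tl_t_proj)
  have 2: "tl_t X H T (inv\<^bsub>W\<^esub> w) = proj (T_word (rev x))"
    using x inv_W[OF w] T_red[OF red_rev[OF x(1)]] by (simp add: tl_t_proj)
  show ?thesis unfolding 1 2
    by (rule R.inv_unique') (use bar_T_word[OF w] w in \<open>auto simp: rev_words\<close>)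
qed

text \<open>
  Uniqueness: \<open>v\<close> generates the Laurent polynomials as a ring once its inverse is added, and the image of \<open>v\<^sup>-\<^sup>1\<close> is
  known because the map is an involution.  So the map is semilinear, and it is prescribed on the
  spanning set of all \<open>t\<^sub>w\<close>.
\<close>
lemma tl_bar_eq: "tl_bar X H T = bar"
  unfolding tl_bar_def
proof (rule the_equality)
  have bij: "bij_betw bar (carrier R) (carrier R)"
    by (rule bij_betw_byWitness[where f' = bar]) (auto simp: bar_bar)
  show "bar \<in> extensional (carrier R) \<and> bar \<in> ring_iso R R \<and> (\<forall>x\<in>carrier R. bar (bar x) = x) \<and>
    bar (v \<odot>\<^bsub>R\<^esub> \<one>\<^bsub>R\<^esub>) = vinv \<odot>\<^bsub>R\<^esub> \<one>\<^bsub>R\<^esub> \<and>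
    (\<forall>w\<in>carrier W. bar (tl_t X H T w) = inv\<^bsub>R\<^esub> (tl_t X H T (inv\<^bsub>W\<^esub> w)))"
  proof (intro conjI ballI)
    show "bar \<in> extensional (carrier R)" by (simp add: bar_def)
    show "bar \<in> ring_iso R R" by (rule ring_iso_memI) (simp_all add: bar_mult bar_add bij)
  qed (simp_all add: bar_bar bar_smult bar_t)
next
  fix f assume f: "f \<in> extensional (carrier R) \<and> f \<in> ring_iso R R \<and> (\<forall>x\<in>carrier R. f (f x) = x) \<and>
    f (v \<odot>\<^bsub>R\<^esub> \<one>\<^bsub>R\<^esub>) = vinv \<odot>\<^bsub>R\<^esub> \<one>\<^bsub>R\<^esub> \<and>
    (\<forall>w\<in>carrier W. f (tl_t X H T w) = inv\<^bsub>R\<^esub> (tl_t X H T (inv\<^bsub>W\<^esub> w)))"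
  then have hom: "f \<in> ring_hom R R" by (simp add: ring_iso_def)
  note h = ring_hom_closed[OF hom] ring_hom_mult[OF hom] ring_hom_add[OF hom] ring_hom_one[OF hom]
  have f0: "f \<zero>\<^bsub>R\<^esub> = \<zero>\<^bsub>R\<^esub>"
    using h(1)[of "\<zero>\<^bsub>R\<^esub>"] h(3)[of "\<zero>\<^bsub>R\<^esub>" "\<zero>\<^bsub>R\<^esub>"] by (intro R.add_cancel_self) auto
  have scal: "f (a \<odot>\<^bsub>R\<^esub> \<one>\<^bsub>R\<^esub>) = lbar a \<odot>\<^bsub>R\<^esub> \<one>\<^bsub>R\<^esub>" for a
  proof (induction a rule: laurent_induct)
    case 1
    then show ?case using f by simp
  next
    case 2
    have fv: "f (v \<odot>\<^bsub>R\<^esub> \<one>\<^bsub>R\<^esub>) = vinv \<odot>\<^bsub>R\<^esub> \<one>\<^bsub>R\<^esub>" and ff: "\<And>x. x \<in> carrier R \<Longrightarrow> f (f x) = x" using f by blast+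
    show ?case using ff[of "v \<odot>\<^bsub>R\<^esub> \<one>\<^bsub>R\<^esub>"] unfolding fv by simp
  next
    case 3
    then show ?case using h(4) by simp
  next
    case 4
    have "f ((- 1) \<odot>\<^bsub>R\<^esub> \<one>\<^bsub>R\<^esub>) \<oplus>\<^bsub>R\<^esub> \<one>\<^bsub>R\<^esub> = f ((- 1) \<odot>\<^bsub>R\<^esub> \<one>\<^bsub>R\<^esub> \<oplus>\<^bsub>R\<^esub> \<one>\<^bsub>R\<^esub>)" using h(3,4) by simp
    also have "\<dots> = \<zero>\<^bsub>R\<^esub>" using f0 by (simp add: R.smult_minus_left R.l_neg)
    finally have "\<ominus>\<^bsub>R\<^esub> \<one>\<^bsub>R\<^esub> = f ((- 1) \<odot>\<^bsub>R\<^esub> \<one>\<^bsub>R\<^esub>)" by (rule R.minus_equality) (simp_all add: h(1))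
    then show ?case by (simp add: R.smult_minus_left)
  next
    case (5 a c)
    then show ?case by (simp add: R.smult_add_left h(3) lbar_add)
  next
    case (6 a c)
    have "(a * c) \<odot>\<^bsub>R\<^esub> \<one>\<^bsub>R\<^esub> = (a \<odot>\<^bsub>R\<^esub> \<one>\<^bsub>R\<^esub>) \<otimes>\<^bsub>R\<^esub> (c \<odot>\<^bsub>R\<^esub> \<one>\<^bsub>R\<^esub>)"
      "(lbar a * lbar c) \<odot>\<^bsub>R\<^esub> \<one>\<^bsub>R\<^esub> = (lbar a \<odot>\<^bsub>R\<^esub> \<one>\<^bsub>R\<^esub>) \<otimes>\<^bsub>R\<^esub> (lbar c \<odot>\<^bsub>R\<^esub> \<one>\<^bsub>R\<^esub>)"
      by (simp_all add: R.smult_assoc R.smult_mult_left)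
    then show ?case using 6 by (simp add: h(2) lbar_mult)
  qed
  have eq: "f (proj k) = bar (proj k)" if "k \<in> carrier H" for k
    using that
  proof (rule hecke_induct)
    fix x assume "reduced x"
    then have "cl x \<in> carrier W" by (rule red_cl_carrier)
    then show "f (proj (T (cl x))) = bar (proj (T (cl x)))" using f bar_t tl_t_proj by metis
  next
    fix a x assume x: "x \<in> carrier H" "f (proj x) = bar (proj x)"
    have "proj (a \<odot>\<^bsub>H\<^esub> x) = (a \<odot>\<^bsub>R\<^esub> \<one>\<^bsub>R\<^esub>) \<otimes>\<^bsub>R\<^esub> proj x"
      using x(1) by (simp add: proj_smult[symmetric] R.smult_mult_left)
    then show "f (proj (a \<odot>\<^bsub>H\<^esub> x)) = bar (proj (a \<odot>\<^bsub>H\<^esub> x))"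
      using x by (simp add: h(2) scal bar_mult bar_smult)
  qed (use f0 in \<open>simp_all add: proj_zero[symmetric] proj_add[symmetric] h(3) bar_add\<close>)
  show "f = bar"
  proof (rule extensionalityI)
    show "f \<in> extensional (carrier R)" using f by blast
    show "bar \<in> extensional (carrier R)" by (simp add: bar_def)
    fix x assume "x \<in> carrier R"
    then show "f x = bar x" using TL_rep eq by blast
  qed
qed

end

section \<open>The canonical basis\<close>

locale tight_hecke = hecke X H T
  for X :: "'a coxeter_graph" and H :: "(laurent, 'h) module" and T :: "'a list set \<Rightarrow> 'h" +
  assumes tight: "FC x \<Longrightarrow> x \<in> words \<Longrightarrow> tight x"
begin

abbreviation tnorm :: "'a list set \<Rightarrow> 'h set" where "tnorm w \<equiv> tl_tnorm X H T w"

text \<open>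
  Coordinates in \<open>v\<^sup>-\<^sup>1\<int>[v\<^sup>-\<^sup>1]\<close>; the corresponding elements form \<open>v\<^sup>-\<^sup>1\<close> times the lattice (\<open>sublattice_iff\<close>).
\<close>
definition small :: "('a list set \<Rightarrow>\<^sub>0 laurent) \<Rightarrow> bool" where
  "small h \<longleftrightarrow> Poly_Mapping.keys h \<subseteq> W_c X \<and> (\<forall>i. v * Poly_Mapping.lookup h i \<in> A_minus)"

lemma keys_word_terms_image:
  "Poly_Mapping.keys (\<Sum>I\<leftarrow>L. word_term I (c I)) \<subseteq> (\<lambda>I. cl (nf I)) ` set L"
proof (induction L)
  case (Cons I L)
  have "Poly_Mapping.keys (word_term I (c I)) \<subseteq> {cl (nf I)}" by (simp add: word_term_def)
  then show ?case using Cons keys_add[of "word_term I (c I)" "\<Sum>I\<leftarrow>L. word_term I (c I)"] by auto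
qed simp

lemma small_word_terms:
  assumes "set L \<subseteq> words" "\<And>I. I \<in> set L \<Longrightarrow> v * (c I * delta ^ loops I) \<in> A_minus"
  shows "small (\<Sum>I\<leftarrow>L. word_term I (c I))"
proof -
  have "v * Poly_Mapping.lookup (\<Sum>I\<leftarrow>L. word_term I (c I)) i \<in> A_minus" for i
    using assms(2)
  proof (induction L)
    case (Cons I L)
    then have "v * Poly_Mapping.lookup (word_term I (c I)) i \<in> A_minus"
      by (simp add: word_term_def lookup_single when_def A_minus_closed)
    then show ?case using Cons by (simp add: lookup_add distrib_left A_minus_closed)
  qed (simp add: A_minus_closed)
  then show ?thesis using keys_word_terms[OF assms(1)] by (simp add: small_def)
qed

lemma small_coeffs: "small h \<Longrightarrow> h \<in> coeffs A_minus (W_c X)"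
proof -
  assume h: "small h"
  have "Poly_Mapping.lookup h i = vinv * (v * Poly_Mapping.lookup h i)" for i by (simp add: mult.assoc[symmetric])
  then have "Poly_Mapping.lookup h i \<in> A_minus" for i using h A_minus_closed(3,6) by (metis small_def)
  then show ?thesis using h by (simp add: coeffs_def small_def)
qed

text \<open>
  In the expansion along a reduced word of \<open>w\<close>, a proper subword \<open>I\<close> has the coefficient
  \<open>(- v\<^sup>-\<^sup>1)\<^sup>n \<delta>\<^sup>k\<close> with \<open>n = |x| - |I|\<close> and \<open>k = loops I\<close>, where \<open>k < n\<close> by tightness.
\<close>
lemma tnorm_monomial:
  assumes "w \<in> W_c X"
  obtains h where "small h" "\<forall>u\<in>Poly_Mapping.keys h. cox_length u < cox_length w"
    "tnorm w = mon w \<oplus>\<^bsub>R\<^esub> comb h"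
proof -
  obtain x where x: "FC x" "reduced x" "w = cl x" using W_cE[OF assms] .
  have w: "x \<in> words" using red_words[OF x(2)] .
  obtain rest where r: "subseqs x = x # rest" "\<And>I. I \<in> set rest \<Longrightarrow> length I < length x" using subseqs_eq_Cons by blast
  have rw: "set rest \<subseteq> words" using subseqs_words[OF w] r(1) by simp
  let ?c = "\<lambda>I. (- vinv) ^ (length x - length I)"
  let ?h = "\<Sum>I\<leftarrow>rest. word_term I (?c I)"
  have 1: "small ?h"
  proof (rule small_word_terms[OF rw])
    fix I assume I: "I \<in> set rest"
    then have "loops I + length I < length x" using tight[OF x(1) w] r unfolding tight_def by simp
    then show "v * (?c I * delta ^ loops I) \<in> A_minus" by (intro A_minus_coefficient) simp
  qed
  have 2: "cox_length u < cox_length w" if u: "u \<in> Poly_Mapping.keys ?h" for u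
  proof -
    obtain I where I: "I \<in> set rest" "u = cl (nf I)" using u keys_word_terms_image[where L = rest and c = ?c] by blast
    have "reduced (nf I)" using FC_red[OF FC_nf nf_words] rw I(1) by blast
    then show ?thesis using cox_length_cl x(2,3) I r(2) nf_length[of I] by fastforce
  qed
  have "tnorm w = comb (expansion x)"
    using T_word_expansion[OF w] T_red[OF x(2)] x(3) cox_length_cl[OF x(2)] by (simp add: tl_tnorm_def tl_t_proj)
  also have "expansion x = word_term x 1 + ?h" by (simp add: expansion_def r(1))
  also have "comb \<dots> = mon w \<oplus>\<^bsub>R\<^esub> comb ?h"
    using comb_add[OF keys_word_term[OF w]] 1 comb_word_term[OF w, of 1] w mon_cl[OF x(1) w] x(3) by (simp add: small_def)
  finally show ?thesis using that[OF 1] 2 by blast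
qed

lemma tnorm_closed: "w \<in> W_c X \<Longrightarrow> tnorm w \<in> carrier R"
  using T_closed by (auto simp: tl_tnorm_def tl_t_proj W_c_def)

lemma comb_small_lattice: "small h \<Longrightarrow> comb h \<in> R.lattice_span (W_c X) (monomial X H T)"
  using small_coeffs by (auto simp: R.lattice_span_def comb_def)

text \<open>
  A unitriangular system can be solved by induction on the length, and the solution has coefficients in \<open>\<int>[v\<^sup>-\<^sup>1]\<close> again.
\<close>
lemma lattice_eq: "lattice X H T = R.lattice_span (W_c X) (monomial X H T)"
proof -
  have "tnorm w \<in> R.lattice_span (W_c X) (monomial X H T)" if w: "w \<in> W_c X" for w
  proof -
    obtain h where h: "small h" "tnorm w = mon w \<oplus>\<^bsub>R\<^esub> comb h" using tnorm_monomial[OF w] by metis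
    show ?thesis unfolding h(2)
      by (intro R.lattice_span_add mon_closed R.lattice_span_base comb_small_lattice w h(1))
  qed
  then have "lincomb R tnorm f \<in> R.lattice_span (W_c X) (monomial X H T)" if f: "f \<in> coeffs A_minus (W_c X)" for f
    using f by (intro R.lattice_span_mono tnorm_closed mon_closed f) (auto simp: coeffs_def)
  moreover have mon: "mon w \<in> R.lattice_span (W_c X) tnorm" if "w \<in> W_c X" for w
    using that
  proof (induction "cox_length w" arbitrary: w rule: less_induct)
    case less
    obtain h where h: "small h" "\<forall>u\<in>Poly_Mapping.keys h. cox_length u < cox_length w"
      "tnorm w = mon w \<oplus>\<^bsub>R\<^esub> comb h" by (rule tnorm_monomial[OF less.prems])
    have hk: "Poly_Mapping.keys h \<subseteq> W_c X" using h(1) by (simp add: small_def)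
    have ch: "comb h \<in> R.lattice_span (W_c X) tnorm" unfolding comb_def
    proof (rule R.lattice_span_mono[OF mon_closed tnorm_closed small_coeffs[OF h(1)]])
      fix u assume u: "u \<in> Poly_Mapping.keys h"
      show "mon u \<in> R.lattice_span (W_c X) tnorm" using less.hyps[OF bspec[OF h(2) u]] u hk by blast
    qed
    have "mon w = tnorm w \<oplus>\<^bsub>R\<^esub> (- 1) \<odot>\<^bsub>R\<^esub> comb h"
      unfolding h(3) using less.prems comb_closed[OF hk] by (simp add: R.smult_minus_left R.a_assoc R.r_neg)
    also have "\<dots> \<in> R.lattice_span (W_c X) tnorm"
    proof (rule R.lattice_span_add[OF tnorm_closed])
      show "tnorm w \<in> R.lattice_span (W_c X) tnorm"
        by (rule R.lattice_span_base) (use less.prems tnorm_closed in auto)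
      show "(- 1) \<odot>\<^bsub>R\<^esub> comb h \<in> R.lattice_span (W_c X) tnorm"
        by (rule R.lattice_span_smult[where I = "W_c X"]) (use tnorm_closed ch in \<open>auto intro: A_minus_closed\<close>)
    qed
    finally show ?case .
  qed
  have "lincomb R (monomial X H T) f \<in> R.lattice_span (W_c X) tnorm" if f: "f \<in> coeffs A_minus (W_c X)" for f
    using f mon by (intro R.lattice_span_mono tnorm_closed mon_closed f) (auto simp: coeffs_def)
  ultimately show ?thesis unfolding lattice_def R.lattice_span_def by blast
qed

definition sublattice :: "'h set set" where "sublattice = (\<lambda>y. vinv \<odot>\<^bsub>R\<^esub> y) ` lattice X H T"

lemma sublattice_iff: "x \<in> sublattice \<longleftrightarrow> (\<exists>h. small h \<and> x = comb h)"
proof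
  assume "x \<in> sublattice"
  then obtain f where f: "f \<in> coeffs A_minus (W_c X)" "x = vinv \<odot>\<^bsub>R\<^esub> comb f"
    unfolding sublattice_def lattice_eq R.lattice_span_def comb_def by blast
  have fk: "Poly_Mapping.keys f \<subseteq> W_c X" using f(1) by (simp add: coeffs_def)
  have vv: "v * (vinv * a) = a" for a by (simp only: mult.assoc[symmetric] v_vinv mult_1_left)
  have "small (coeff_scale vinv f)"
    using f(1) subset_trans[OF keys_coeff_scale fk, of vinv] by (simp add: small_def coeffs_def vv)
  then show "\<exists>h. small h \<and> x = comb h" using comb_scale[OF fk, of vinv] f(2) by metis
next
  assume "\<exists>h. small h \<and> x = comb h"
  then obtain h where h: "small h" "x = comb h" by blast
  have hk: "Poly_Mapping.keys h \<subseteq> W_c X" using h(1) by (simp add: small_def)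
  have c: "coeff_scale v h \<in> coeffs A_minus (W_c X)"
    using h(1) subset_trans[OF keys_coeff_scale hk, of v] by (simp add: small_def coeffs_def)
  have "x = vinv \<odot>\<^bsub>R\<^esub> comb (coeff_scale v h)"
    using comb_scale[OF hk] comb_closed[OF hk] h(2) by (simp add: R.smult_assoc[symmetric])
  then show "x \<in> sublattice" using c unfolding sublattice_def lattice_eq R.lattice_span_def comb_def by blast
qed

lemma lattice_closed: "x \<in> lattice X H T \<Longrightarrow> x \<in> carrier R"
  unfolding lattice_eq by (rule R.lattice_span_closed[OF mon_closed])

lemma sublattice_subgroup: "subgroup sublattice (add_monoid R)"
proof (rule subgroup.intro)
  show "sublattice \<subseteq> carrier (add_monoid R)"
    using comb_closed by (auto simp: sublattice_iff small_def)
next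
  fix x y assume "x \<in> sublattice" "y \<in> sublattice"
  then obtain g h where gh: "small g" "small h" "x = comb g" "y = comb h" by (auto simp: sublattice_iff)
  then have k: "Poly_Mapping.keys g \<subseteq> W_c X" "Poly_Mapping.keys h \<subseteq> W_c X" by (auto simp: small_def)
  have "small (g + h)"
    using gh subset_trans[OF keys_add, of g h "W_c X"] by (simp add: small_def lookup_add distrib_left A_minus_closed)
  then show "x \<otimes>\<^bsub>add_monoid R\<^esub> y \<in> sublattice" using comb_add[OF k] gh by (auto simp: sublattice_iff)
next
  have "small 0" by (simp add: small_def A_minus_closed)
  then show "\<one>\<^bsub>add_monoid R\<^esub> \<in> sublattice" using comb_zero by (auto simp: sublattice_iff intro: exI[of _ 0])
next
  fix x assume "x \<in> sublattice"
  then obtain h where h: "small h" "x = comb h" by (auto simp: sublattice_iff)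
  have hk: "Poly_Mapping.keys h \<subseteq> W_c X" using h(1) by (simp add: small_def)
  have "small (coeff_scale (- 1) h)"
    using h(1) subset_trans[OF keys_coeff_scale hk, of "- 1"] by (simp add: small_def A_minus_closed)
  moreover have "\<ominus>\<^bsub>R\<^esub> x = comb (coeff_scale (- 1) h)"
    using comb_scale[OF hk] comb_closed[OF hk] h(2) by (simp add: R.smult_minus_left)
  ultimately have "\<ominus>\<^bsub>R\<^esub> x \<in> sublattice" by (auto simp: sublattice_iff)
  then show "inv\<^bsub>add_monoid R\<^esub> x \<in> sublattice" by (simp add: a_inv_def)
qed

lemma lattice_proj_eq: "lattice_proj X H T x = sublattice +>\<^bsub>R\<^esub> x"
  by (simp add: lattice_proj_def sublattice_def)

theorem monomial_IC_basis: "IC_basis X H T (monomial X H T)"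
  unfolding IC_basis_def
proof (intro conjI ballI)
  show "is_basis A_minus R (lattice X H T) (W_c X) (monomial X H T)"
    unfolding is_basis_def
  proof (intro conjI ballI impI)
    show "mon w \<in> lattice X H T" if "w \<in> W_c X" for w
      unfolding lattice_eq using that by (intro R.lattice_span_base) auto
    show "lattice X H T = lincomb R (monomial X H T) ` coeffs A_minus (W_c X)"
      by (simp add: lattice_eq R.lattice_span_def)
    show "f = 0" if "f \<in> coeffs A_minus (W_c X)" "lincomb R (monomial X H T) f = \<zero>\<^bsub>R\<^esub>" for f
      using comb_inj[of f] that by (simp add: coeffs_def comb_def)
  qed
next
  fix w assume w: "w \<in> W_c X"
  show "tl_bar X H T (mon w) = mon w" using tl_bar_eq bar_mon[OF w] by simp
  obtain h where h: "small h" "tnorm w = mon w \<oplus>\<^bsub>R\<^esub> comb h" using tnorm_monomial[OF w] by metis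
  have c: "comb h \<in> carrier R" using h(1) by (simp add: small_def)
  have "tnorm w = comb h \<oplus>\<^bsub>R\<^esub> mon w" unfolding h(2) by (rule R.a_comm[OF mon_closed[OF w] c])
  moreover have "comb h \<in> sublattice" using h(1) by (auto simp: sublattice_iff)
  ultimately have "tnorm w \<in> sublattice +>\<^bsub>R\<^esub> mon w" by (auto simp: a_r_coset_def')
  from R.a_repr_independence[OF this mon_closed[OF w] sublattice_subgroup]
  show "lattice_proj X H T (mon w) = lattice_proj X H T (tnorm w)" by (simp add: lattice_proj_eq)
qed

text \<open>
  Modulo \<open>v\<^sup>-\<^sup>1\<close> times the lattice, \<open>c\<^sub>w\<close> and \<open>b\<^sub>w\<close> agree, so that their difference has coordinates in
  \<open>v\<^sup>-\<^sup>1\<int>[v\<^sup>-\<^sup>1]\<close>.  As it is bar invariant and the monomials are, its coordinates are invariant, hence zero.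
\<close>
theorem IC_basis_unique:
  assumes c: "IC_basis X H T c" and w: "w \<in> W_c X"
  shows "c w = mon w"
proof -
  have cl: "c w \<in> lattice X H T" using c w by (auto simp: IC_basis_def is_basis_def)
  have cc: "c w \<in> carrier R" using lattice_closed[OF cl] .
  have "lattice_proj X H T (c w) = lattice_proj X H T (mon w)"
    using c w monomial_IC_basis unfolding IC_basis_def by simp
  then have e: "sublattice +>\<^bsub>R\<^esub> c w = sublattice +>\<^bsub>R\<^esub> mon w" by (simp add: lattice_proj_eq)
  have "\<zero>\<^bsub>R\<^esub> \<in> sublattice" using subgroup.one_closed[OF sublattice_subgroup] by simp
  then have "c w \<in> sublattice +>\<^bsub>R\<^esub> c w" using cc by (auto simp: a_r_coset_def' intro!: bexI[of _ "\<zero>\<^bsub>R\<^esub>"])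
  then obtain h where h: "small h" "c w = comb h \<oplus>\<^bsub>R\<^esub> mon w"
    unfolding e by (auto simp: a_r_coset_def' sublattice_iff)
  have hk: "Poly_Mapping.keys h \<subseteq> W_c X" using h(1) by (simp add: small_def)
  have "bar (c w) = c w" using c w tl_bar_eq by (auto simp: IC_basis_def)
  then have "bar (comb h) \<oplus>\<^bsub>R\<^esub> mon w = comb h \<oplus>\<^bsub>R\<^esub> mon w"
    using h(2) w hk by (simp add: bar_add bar_mon)
  then have "comb (coeff_bar h) = comb h" using w hk keys_coeff_bar_W_c[OF hk] by (simp add: bar_comb)
  then have "coeff_bar h = h" using comb_eq_iff keys_coeff_bar_W_c[OF hk] hk by blast
  then have "lbar (Poly_Mapping.lookup h i) = Poly_Mapping.lookup h i" for i using lookup_coeff_bar[of h i] by simp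
  then have "Poly_Mapping.lookup h i = 0" for i using bar_invariant_small h(1) by (simp add: small_def)
  then have "h = 0" by (intro poly_mapping_eqI) simp
  then show ?thesis using h(2) w by simp
qed

end

section \<open>Graphs of type ADE\<close>

text \<open>
  A line is found on the nodes \<open>1, 2, \<dots>\<close> of a graph \<open>E\<^sub>n\<close>, and a graph of type D by leaving out node 1 and renumbering.
\<close>
lemma type_ADE_embedding:
  assumes "type_ADE X"
  obtains g n where "4 \<le> n" "inj_on g (nodes X)" "g ` nodes X \<subseteq> {..<n}"
    "\<And>s t. s \<in> nodes X \<Longrightarrow> t \<in> nodes X \<Longrightarrow> fork (g s) (g t) \<longleftrightarrow> adj X s t" "nodes X \<noteq> {}"
proof -
  have reduce: thesis
    if Y: "graph_iso X Y" "inj_on k (nodes Y)" "k ` nodes Y \<subseteq> {..<n}" "4 \<le> n" "nodes Y \<noteq> {}"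
      "\<And>i j. i \<in> nodes Y \<Longrightarrow> j \<in> nodes Y \<Longrightarrow> fork (k i) (k j) \<longleftrightarrow> adj Y i j"
    for Y :: "nat coxeter_graph" and k n
  proof -
    obtain f where f: "bij_betw f (nodes X) (nodes Y)"
      "\<And>s t. s \<in> nodes X \<Longrightarrow> t \<in> nodes X \<Longrightarrow> adj X s t \<longleftrightarrow> adj Y (f s) (f t)"
      using Y(1) unfolding graph_iso_def by blast
    have im: "f ` nodes X = nodes Y" using f(1) by (simp add: bij_betw_def)
    show thesis
    proof (rule \<open>\<And>g n. 4 \<le> n \<Longrightarrow> inj_on g (nodes X) \<Longrightarrow> g ` nodes X \<subseteq> {..<n} \<Longrightarrow>
        (\<And>s t. s \<in> nodes X \<Longrightarrow> t \<in> nodes X \<Longrightarrow> fork (g s) (g t) \<longleftrightarrow> adj X s t) \<Longrightarrow> nodes X \<noteq> {} \<Longrightarrow> thesis\<close>[of n "k \<circ> f"])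
      show "4 \<le> n" by fact
      show "inj_on (k \<circ> f) (nodes X)" using f(1) im Y(2) by (simp add: comp_inj_on bij_betw_def)
      show "(k \<circ> f) ` nodes X \<subseteq> {..<n}" using im Y(3) by (metis image_comp)
      show "nodes X \<noteq> {}" using im Y(5) by auto
      fix s t assume "s \<in> nodes X" "t \<in> nodes X"
      then have st: "adj X s t \<longleftrightarrow> adj Y (f s) (f t)" "f s \<in> nodes Y" "f t \<in> nodes Y" using f(2) im by blast+
      show "fork ((k \<circ> f) s) ((k \<circ> f) t) \<longleftrightarrow> adj X s t" unfolding o_def st(1) by (rule Y(6)[OF st(2,3)])
    qed
  qed
  from assms consider n where "n \<ge> 1" "graph_iso X (graph_A n)" | n where "n \<ge> 4" "graph_iso X (graph_D n)"
    | n where "n \<ge> 6" "graph_iso X (graph_E n)" unfolding type_ADE_def by blast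
  then show thesis
  proof cases
    case 1
    show thesis by (rule reduce[OF 1(2), of id "n + 4"]) (use 1(1) in \<open>auto simp: graph_A_def\<close>)
  next
    case 2
    show thesis
    proof (rule reduce[OF 2(2), of "\<lambda>i. if i = 0 then 0 else Suc i" "n + 4"])
      show "inj_on (\<lambda>i. if i = 0 then 0 else Suc i) (nodes (graph_D n))" by (auto simp: inj_on_def)
      fix i j show "fork (if i = 0 then 0 else Suc i) (if j = 0 then 0 else Suc j) \<longleftrightarrow> adj (graph_D n) i j"
        by (auto simp: graph_D_def forked_line_def line_adj_def)
    qed (use 2(1) in \<open>auto simp: graph_D_def forked_line_def\<close>)
  next
    case 3
    show thesis by (rule reduce[OF 3(2), of id "n + 4"]) (use 3(1) in \<open>auto simp: graph_E_def forked_line_def\<close>)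
  qed
qed

theorem theorem3p6:
  fixes X :: "'a coxeter_graph"
    and H :: "(laurent, 'h) module"
    and T :: "'a list set \<Rightarrow> 'h"
  assumes "type_ADE X"
    and "hecke_algebra X H T"
  shows "IC_basis X H T (monomial X H T) \<and>
    (\<forall>c. IC_basis X H T c \<longrightarrow> (\<forall>w\<in>W_c X. c w = monomial X H T w))"
proof -
  obtain g n where g: "4 \<le> n" "inj_on g (nodes X)" "g ` nodes X \<subseteq> {..<n}" "nodes X \<noteq> {}"
    and adj: "\<And>s t. s \<in> nodes X \<Longrightarrow> t \<in> nodes X \<Longrightarrow> fork (g s) (g t) \<longleftrightarrow> adj X s t"
    using type_ADE_embedding[OF assms(1)] by metis
  interpret simply_laced X
  proof
    fix s t assume "s \<in> nodes X" "t \<in> nodes X" "adj X s t"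
    then show "adj X t s" using adj[of s t] adj[of t s] by (auto simp: line_adj_def)
  next
    fix s assume "s \<in> nodes X"
    then show "\<not> adj X s s" using adj[of s s] by (auto simp: line_adj_def)
  qed
  have bound: "length y \<le> n * (2 * n + 4)" if y: "FC y" "set y \<subseteq> nodes X" for y
  proof -
    have "gap_ok fork (map g y)"
    proof (rule gap_ok_map)
      show "gap_ok link y" using y(1) by (simp add: FC_iff_gap_ok)
      show "inj_on g (set y)" using inj_on_subset[OF g(2) y(2)] .
      fix s t assume "s \<in> set y" "t \<in> set y"
      then have st: "s \<in> nodes X" "t \<in> nodes X" using y(2) by auto
      show "fork (g s) (g t) \<longleftrightarrow> link s t" unfolding adj[OF st] using st by (simp add: link_def)
    qed
    from fork_bounded[OF this g(1)] show ?thesis using g(3) y(2) by auto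
  qed
  interpret tight_hecke X H T
  proof
    show "hecke_algebra X H T" by fact
    show "nodes X \<noteq> {}" by fact
    fix x assume "FC x" "x \<in> words"
    then show "tight x" using FC_tight[OF bound] by (auto simp: in_lists_conv_set subset_iff)
  qed
  show ?thesis using monomial_IC_basis IC_basis_unique by blast
qed

end
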